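(* Let $\varrho$ be a primitive inflation rule in one dimension, with inflation multiplier $\lambda$, and let $B(k)$ be the corresponding Fourier matrix, with $\det(B(k))\neq0$ for some $k\in\mathbb R$. If there is an $\varepsilon>0$ such that $$\chi^{B}(k)\,\leqslant\,\log\sqrt{\lambda}-\varepsilon$$ holds for Lebesgue-a.e. $k\in\mathbb R$, where $\chi^B(k)$ is the maximal Lyapunov exponent of the Fourier matrix cocycle, then the diffraction measure of the system cannot have an absolutely continuous part.
   Context: Let $\mathcal A=\{a_1,\dots,a_{n_a}\}$ be a finite alphabet and $\varrho$ a primitive substitution on $\mathcal A$: each letter is mapped to a non-empty finite word, and the substitution matrix $M_\varrho=(M_{ij})$, with $M_{ij}$ the number of letters $a_i$ in $\varrho(a_j)$, is primitive. Let $\lambda>1$ be its Perron–Frobenius (PF) eigenvalue, called the inflation multiplier. The associated (geometric) inflation rule, also denoted $\varrho$, uses intervals (prototiles) of natural lengths $\ell_1,\dots,\ell_{n_a}>0$, where $(\ell_1,\dots,\ell_{n_a})$ is a fixed left PF eigenvector of $M_\varrho$; a tile of type $a_i$ is expanded by $\lambda$ and then dissected into tiles of the original sizes in the order specified by $\varrho(a_i)$. Tiles of different type but equal length are distinguished by colour. Hull: Starting from a tiling of $\mathbb R$ that is a fixed point of $\varrho$ (or of a suitable power), the hull $\mathbb Y$ is the closure of its translation orbit in the local topology. Each tiling is identified with the coloured point set $\Lambda=\bigcup_i\Lambda_i$, where $\Lambda_i$ is the set of left endpoints of tiles of type $a_i$ (disjoint union). The system $(\mathbb Y,\mathbb R)$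 is strictly ergodic. Displacement sets and Fourier matrix: $T_{ij}$ is the set of all relative positions (left endpoints, relative to the left endpoint of the patch) of tiles of type $a_i$ in the patch $\varrho(a_j)$ (an interval of length $\lambda\ell_j$ dissected into tiles). $B(k)=(B_{ij}(k))$ with $B_{ij}(k)=\sum_{t\in T_{ij}}\mathrm e^{2\pi\mathrm i tk}$. The Fourier matrix cocycle is $B^{(n)}(k)=B(k)B(\lambda k)\cdots B(\lambda^{n-1}k)$, and $$\chi^B(k)=\limsup_{n\to\infty}\frac1n\log\|B^{(n)}(k)\|$$ with any matrix norm. Diffraction: with $\nu_{ij}(z)=\operatorname{dens}(\Lambda_i\cap(\Lambda_j-z))/\operatorname{dens}(\Lambda)$ (independent of $\Lambda\in\mathbb Y$) and $\Upsilon_{ij}=\sum_{z\in\Lambda-\Lambda}\nu_{ij}(z)\delta_z$, the weighted Dirac comb $\sum_i u_i\delta_{\Lambda_i}$, with weights $u\in\mathbb C^{n_a}$ and $\delta_{\Lambda_i}=\sum_{x\in\Lambda_i}\delta_x$, has autocorrelation $\gamma_u=\operatorname{dens}(\Lambda)\sum_{i,j}\overline{u_i}\,\Upsilon_{ij}\,u_j$; its Fourier transform $\widehat{\gamma_u}$ is a positive measure, called the diffraction measure. That the diffraction measure of the system has no absolutely continuous part means that, for every choice of weights $u$, the absolutely continuous part (in the Lebesgue decomposition) of $\widehat{\gamma_u}$ vanishes. *)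

theory Defs
  imports "HOL-Analysis.Analysis"
begin

text \<open>
  A finite type \<open>'a\<close> serves as the alphabet, and a substitution is its action
  \<open>\<rho> :: 'a \<Rightarrow> 'a list\<close> on letters.
\<close>

definition subst_matrix :: "('a::finite \<Rightarrow> 'a list) \<Rightarrow> real^'a^'a" where
  "subst_matrix \<rho> = (\<chi> i j. real (count_list (\<rho> j) i))"

definition primitive_matrix :: "real^'n^'n \<Rightarrow> bool" where
  "primitive_matrix M \<longleftrightarrow>
     (\<forall>i j. 0 \<le> M $ i $ j) \<and> (\<exists>n\<ge>1. \<forall>i j. 0 < (((**) M ^^ n) (mat 1)) $ i $ j)"

definition primitive_substitution :: "('a::finite \<Rightarrow> 'a list) \<Rightarrow> bool" where
  "primitive_substitution \<rho> \<longleftrightarrow> (\<forall>a. \<rho> a \<noteq> []) \<and> primitive_matrix (subst_matrix \<rho>)"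

definition complex_spectrum :: "real^'n^'n \<Rightarrow> complex set" where
  "complex_spectrum M =
     {\<mu>. \<exists>v::complex^'n. v \<noteq> 0 \<and> (\<chi> i j. complex_of_real (M $ i $ j)) *v v = \<mu> *s v}"

text \<open>
  The Perron--Frobenius eigenvalue is the eigenvalue that equals the spectral radius.
\<close>

definition is_pf_eigenvalue :: "real^'n^'n \<Rightarrow> real \<Rightarrow> bool" where
  "is_pf_eigenvalue M lam \<longleftrightarrow>
     complex_of_real lam \<in> complex_spectrum M \<and> (\<forall>\<mu>\<in>complex_spectrum M. cmod \<mu> \<le> lam)"

definition is_left_pf_eigenvector :: "real^'n^'n \<Rightarrow> real \<Rightarrow> real^'n \<Rightarrow> bool" where
  "is_left_pf_eigenvector M lam l \<longleftrightarrow>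
     (\<forall>i. 0 < l $ i) \<and> l v* M = lam *s l"


section \<open>Displacement sets and the Fourier matrix cocycle\<close>

text \<open>
  The tile number \<open>p\<close> of the patch \<open>\<rho> j\<close> starts at the total length of the tiles before it.
\<close>

definition displacements :: "('a::finite \<Rightarrow> 'a list) \<Rightarrow> real^'a \<Rightarrow> 'a \<Rightarrow> 'a \<Rightarrow> real set" where
  "displacements \<rho> l i j =
     {(\<Sum>q<p. l $ (\<rho> j ! q)) | p. p < length (\<rho> j) \<and> \<rho> j ! p = i}"

definition fourier_matrix ::
    "('a::finite \<Rightarrow> 'a list) \<Rightarrow> real^'a \<Rightarrow> real \<Rightarrow> complex^'a^'a" where
  "fourier_matrix \<rho> l k = (\<chi> i j. \<Sum>t\<in>displacements \<rho> l i j. cis (2 * pi * t * k))"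

primrec fourier_cocycle ::
    "('a::finite \<Rightarrow> 'a list) \<Rightarrow> real \<Rightarrow> real^'a \<Rightarrow> nat \<Rightarrow> real \<Rightarrow> complex^'a^'a" where
  "fourier_cocycle \<rho> lam l 0 k = mat 1"
| "fourier_cocycle \<rho> lam l (Suc n) k =
     fourier_cocycle \<rho> lam l n k ** fourier_matrix \<rho> l (lam ^ n * k)"

text \<open>
  The exponent is extended real, with \<open>log 0 = -\<infinity>\<close>, because \<open>ln 0 = 0\<close> in the library.
  The norm on \<open>complex^'a^'a\<close> is the Frobenius norm.
\<close>

definition ereal_log :: "real \<Rightarrow> ereal" where
  "ereal_log x = (if x = 0 then - \<infinity> else ereal (ln x))"

definition lyapunov_exponent ::
    "('a::finite \<Rightarrow> 'a list) \<Rightarrow> real \<Rightarrow> real^'a \<Rightarrow> real \<Rightarrow> ereal" where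
  "lyapunov_exponent \<rho> lam l k =
     limsup (\<lambda>n. ereal (1 / real n) * ereal_log (norm (fourier_cocycle \<rho> lam l n k)))"


section \<open>Tilings and the hull\<close>

text \<open>
  A tiling is given by its coloured point set: \<open>\<Lambda> i\<close> is the set of left endpoints of the tiles
  of type \<open>i\<close>, and every point of the line lies in exactly one half-open tile.
\<close>

definition is_tiling :: "real^'a \<Rightarrow> ('a \<Rightarrow> real set) \<Rightarrow> bool" where
  "is_tiling l \<Lambda> \<longleftrightarrow> (\<forall>y. \<exists>!(i, x). x \<in> \<Lambda> i \<and> x \<le> y \<and> y < x + l $ i)"

definition inflate ::
    "('a::finite \<Rightarrow> 'a list) \<Rightarrow> real \<Rightarrow> real^'a \<Rightarrow> ('a \<Rightarrow> real set) \<Rightarrow> ('a \<Rightarrow> real set)" where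
  "inflate \<rho> lam l \<Lambda> = (\<lambda>i. {lam * x + t | x t j. x \<in> \<Lambda> j \<and> t \<in> displacements \<rho> l i j})"

definition is_inflation_fixed_point ::
    "('a::finite \<Rightarrow> 'a list) \<Rightarrow> real \<Rightarrow> real^'a \<Rightarrow> ('a \<Rightarrow> real set) \<Rightarrow> bool" where
  "is_inflation_fixed_point \<rho> lam l \<Lambda> \<longleftrightarrow>
     is_tiling l \<Lambda> \<and> (\<exists>N\<ge>1. (inflate \<rho> lam l ^^ N) \<Lambda> = \<Lambda>)"

definition shift_tiling :: "real \<Rightarrow> ('a \<Rightarrow> real set) \<Rightarrow> ('a \<Rightarrow> real set)" where
  "shift_tiling t \<Lambda> = (\<lambda>i. (\<lambda>x. x + t) ` \<Lambda> i)"

text \<open>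
  In the local topology, two tilings are \<open>\<epsilon>\<close>-close if they agree on \<open>[-1/\<epsilon>, 1/\<epsilon>]\<close> after a
  translation by at most \<open>\<epsilon>\<close>.
\<close>

definition locally_close :: "real \<Rightarrow> ('a \<Rightarrow> real set) \<Rightarrow> ('a \<Rightarrow> real set) \<Rightarrow> bool" where
  "locally_close \<epsilon> \<Lambda> \<Lambda>' \<longleftrightarrow>
     (\<exists>s. \<bar>s\<bar> \<le> \<epsilon> \<and>
        (\<forall>i. \<Lambda> i \<inter> {- 1 / \<epsilon> .. 1 / \<epsilon>} = shift_tiling s \<Lambda>' i \<inter> {- 1 / \<epsilon> .. 1 / \<epsilon>}))"

definition tiling_hull :: "('a \<Rightarrow> real set) \<Rightarrow> ('a \<Rightarrow> real set) set" where
  "tiling_hull \<Lambda> = {\<Lambda>'. \<forall>\<epsilon>>0. \<exists>t. locally_close \<epsilon> \<Lambda>' (shift_tiling t \<Lambda>)}"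


section \<open>Pair correlations and the autocorrelation\<close>

definition dens :: "real set \<Rightarrow> real" where
  "dens S = Lim at_top (\<lambda>r. real (card (S \<inter> {- r .. r})) / (2 * r))"

abbreviation point_set :: "('a \<Rightarrow> real set) \<Rightarrow> real set" where
  "point_set \<Lambda> \<equiv> (\<Union>i. \<Lambda> i)"

definition pair_correlation :: "('a \<Rightarrow> real set) \<Rightarrow> 'a \<Rightarrow> 'a \<Rightarrow> real \<Rightarrow> real" where
  "pair_correlation \<Lambda> i j z = dens (\<Lambda> i \<inter> (\<lambda>x. x - z) ` \<Lambda> j) / dens (point_set \<Lambda>)"

definition difference_set :: "('a \<Rightarrow> real set) \<Rightarrow> real set" where
  "difference_set \<Lambda> = {x - y | x y. x \<in> point_set \<Lambda> \<and> y \<in> point_set \<Lambda>}"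

text \<open>
  The autocorrelation is the pure point measure with mass \<open>autocorrelation \<Lambda> u z\<close> at each
  \<open>z \<in> difference_set \<Lambda>\<close> and no mass elsewhere.
\<close>

definition autocorrelation :: "('a::finite \<Rightarrow> real set) \<Rightarrow> complex^'a \<Rightarrow> real \<Rightarrow> complex" where
  "autocorrelation \<Lambda> u z =
     complex_of_real (dens (point_set \<Lambda>)) *
     (\<Sum>i\<in>UNIV. \<Sum>j\<in>UNIV. cnj (u $ i) * complex_of_real (pair_correlation \<Lambda> i j z) * u $ j)"


section \<open>Fourier transforms of pure point measures\<close>

definition schwartz :: "(real \<Rightarrow> complex) \<Rightarrow> bool" where
  "schwartz \<phi> \<longleftrightarrow>
     (\<exists>D. D 0 = \<phi> \<and>
        (\<forall>n x. (D n has_vector_derivative D (Suc n) x) (at x)) \<and>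
        (\<forall>m n. bounded (range (\<lambda>x. x ^ m *\<^sub>R D n x))))"

definition fourier_transform :: "(real \<Rightarrow> complex) \<Rightarrow> real \<Rightarrow> complex" where
  "fourier_transform \<phi> k = (LINT x|lborel. cis (- 2 * pi * k * x) * \<phi> x)"

text \<open>
  The positive Radon measure \<open>\<mu>\<close> is the Fourier transform, as a tempered distribution, of the
  measure \<open>\<Sum>z\<in>Z. g z \<delta>\<^sub>z\<close>: the integral of \<open>\<phi>\<close> against \<open>\<mu>\<close> is the integral of the Fourier
  transform of \<open>\<phi>\<close> against that measure.
\<close>

definition is_fourier_transform_of_comb ::
    "real set \<Rightarrow> (real \<Rightarrow> complex) \<Rightarrow> real measure \<Rightarrow> bool" where
  "is_fourier_transform_of_comb Z g \<mu> \<longleftrightarrow>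
     sets \<mu> = sets borel \<and>
     (\<forall>K. compact K \<longrightarrow> emeasure \<mu> K < \<infinity>) \<and>
     (\<forall>\<phi>. schwartz \<phi> \<longrightarrow>
        integrable \<mu> \<phi> \<and>
        ((\<lambda>z. g z * fourier_transform \<phi> z) has_sum (LINT k|\<mu>. \<phi> k)) Z)"

definition is_diffraction_measure ::
    "('a::finite \<Rightarrow> real set) \<Rightarrow> complex^'a \<Rightarrow> real measure \<Rightarrow> bool" where
  "is_diffraction_measure \<Lambda> u \<mu> \<longleftrightarrow>
     is_fourier_transform_of_comb (difference_set \<Lambda>) (autocorrelation \<Lambda> u) \<mu>"


section \<open>The absolutely continuous part\<close>

definition lebesgue_decomposition ::
    "real measure \<Rightarrow> real measure \<Rightarrow> real measure \<Rightarrow> bool" where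
  "lebesgue_decomposition \<mu> \<mu>ac \<mu>s \<longleftrightarrow>
     sets \<mu>ac = sets borel \<and> sets \<mu>s = sets borel \<and>
     (\<forall>A\<in>sets borel. emeasure \<mu> A = emeasure \<mu>ac A + emeasure \<mu>s A) \<and>
     absolutely_continuous lborel \<mu>ac \<and>
     (\<exists>E\<in>null_sets lborel. emeasure \<mu>s (- E) = 0)"

definition ac_part :: "real measure \<Rightarrow> real measure" where
  "ac_part \<mu> = (THE \<mu>ac. \<exists>\<mu>s. lebesgue_decomposition \<mu> \<mu>ac \<mu>s)"

end

theory Submission
  imports Defs
begin

text \<open>
  Let \<open>\<nu>\<^sub>i\<^sub>j(z)\<close> be the density of the points \<open>x\<close> of type \<open>i\<close> such that \<open>x + z\<close> has type \<open>j\<close>.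
  These densities exist uniformly in position: the normalised pair counts in the supertiles of
  order \<open>n\<close> obey a primitive stochastic recursion up to boundary terms that decay exponentially.
  Since \<open>\<Lambda>0\<close> is fixed by the \<open>m\<close>-th power of the inflation whenever \<open>m\<close> is a multiple of the
  period, sorting its points by the supertiles of order \<open>m\<close> that contain them gives
  \<open>\<nu>\<^sub>i\<^sub>j(z) = lam\<^sup>-\<^sup>m \<Sum> \<nu>\<^sub>p\<^sub>q(lam\<^sup>-\<^sup>m (z + r - s))\<close>, without any appeal to recognisability. On the Fourier
  side this expresses the diffraction measure at \<open>k\<close> by \<open>lam\<^sup>-\<^sup>2\<^sup>m\<close> times the measures at
  \<open>lam\<^sup>m k\<close>, conjugated by \<open>B\<^sup>(\<^sup>m\<^sup>)(k)\<close>. All these measures grow at most linearly, so a bounded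
  set on which \<open>\<parallel>B\<^sup>(\<^sup>m\<^sup>)(k)\<parallel>\<^sup>2 \<le> lam\<^sup>m exp (- m \<epsilon>)\<close> for all large \<open>m\<close> has diffraction at most a
  constant times \<open>exp (- m \<epsilon>)\<close>, hence none. By the bound on the Lyapunov exponent countably many
  such sets cover almost every \<open>k\<close>, so the diffraction measure lives on a null set.
\<close>

section \<open>Schwartz functions and bump functions\<close>

text \<open>The threshold log sqrt(lam) is the point where three powers of lam cancel: lam^(-2m)
  from the renormalisation, lam^m from the squared cocycle, and lam^m from the mass of a window
  dilated by lam^m. Any exponential gain beyond that forces the mass to vanish. Three obstacles
  shape the rest. The diffraction measure is given only through Schwartz test functions, so
  indicators must be replaced by smooth bumps. The mixed pair correlations have complex Fourier
  transforms; they are never constructed as measures, but polarisation writes them as combinations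
  of four diffraction measures, which is why all weights are treated together. Finally, a tiling of
  the hull agrees with translates of \<open>\<Lambda>0\<close> only window by window, at
  uncontrolled positions, so densities must be uniform in the position of the window before they
  carry over.\<close>

text \<open>\<open>schwartz\<close> asks for one sequence of all derivatives at once. A class closed
  under differentiation yields it by dependent choice, and only the decay of a generic member is
  left to check.\<close>

lemma schwartzI:
  assumes "\<phi> \<in> S"
    and deriv: "\<And>f. f \<in> S \<Longrightarrow> \<exists>g\<in>S. \<forall>x. (f has_vector_derivative g x) (at x)"
    and bdd: "\<And>f m. f \<in> S \<Longrightarrow> bounded (range (\<lambda>x. x ^ m *\<^sub>R f x))"
  shows "schwartz \<phi>"
proof -
  have "\<exists>D. \<forall>n. (D n \<in> S \<and> (n = 0 \<longrightarrow> D n = \<phi>)) \<and> (\<forall>x. (D n has_vector_derivative D (Suc n) x) (at x))"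
    by (rule dependent_nat_choice) (use assms(1) deriv in auto)
  then show ?thesis
    unfolding schwartz_def using bdd by metis
qed

lemma schwartz_bounded: "schwartz \<phi> \<Longrightarrow> bounded (range (\<lambda>x. x ^ m *\<^sub>R \<phi> x))"
  unfolding schwartz_def by metis

lemma schwartz_deriv:
  assumes "schwartz \<phi>"
  obtains \<psi> where "schwartz \<psi>" "\<And>x. (\<phi> has_vector_derivative \<psi> x) (at x)"
proof -
  obtain D where D: "D 0 = \<phi>" "\<And>n x. (D n has_vector_derivative D (Suc n) x) (at x)"
    "\<And>m n. bounded (range (\<lambda>x. x ^ m *\<^sub>R D n x))"
    using assms unfolding schwartz_def by blast
  have "schwartz (D 1)"
    unfolding schwartz_def using D by (intro exI[of _ "\<lambda>n. D (Suc n)"]) auto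
  then show ?thesis using that[of "D 1"] D(1) D(2)[of 0] by auto
qed

lemma schwartz_lincomb:
  assumes "schwartz \<phi>" "schwartz \<psi>"
  shows "schwartz (\<lambda>x. a * \<phi> x + b * \<psi> x)"
proof (rule schwartzI[where S = "{\<lambda>x. a * f x + b * g x | f g. schwartz f \<and> schwartz g}"])
  show "(\<lambda>x. a * \<phi> x + b * \<psi> x) \<in> {\<lambda>x. a * f x + b * g x | f g. schwartz f \<and> schwartz g}"
    using assms by blast
next
  fix h assume "h \<in> {\<lambda>x. a * f x + b * g x | f g. schwartz f \<and> schwartz g}"
  then obtain f g where h: "h = (\<lambda>x. a * f x + b * g x)" and fg: "schwartz f" "schwartz g" by auto
  obtain f' where f': "schwartz f'" "\<And>x. (f has_vector_derivative f' x) (at x)"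
    using schwartz_deriv[OF fg(1)] by blast
  obtain g' where g': "schwartz g'" "\<And>x. (g has_vector_derivative g' x) (at x)"
    using schwartz_deriv[OF fg(2)] by blast
  have "\<forall>x. (h has_vector_derivative a * f' x + b * g' x) (at x)"
    unfolding h by (auto intro!: has_vector_derivative_add has_vector_derivative_mult_right f' g')
  then show "\<exists>k\<in>{\<lambda>x. a * f x + b * g x | f g. schwartz f \<and> schwartz g}.
      \<forall>x. (h has_vector_derivative k x) (at x)"
    using f' g' by (intro bexI[of _ "\<lambda>x. a * f' x + b * g' x"]) auto
next
  fix h and m :: nat assume "h \<in> {\<lambda>x. a * f x + b * g x | f g. schwartz f \<and> schwartz g}"
  then obtain f g where h: "h = (\<lambda>x. a * f x + b * g x)" and fg: "schwartz f" "schwartz g" by auto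
  obtain F where F: "\<And>x. norm (x ^ m *\<^sub>R f x) \<le> F"
    using schwartz_bounded[OF fg(1), of m] unfolding bounded_iff by auto
  obtain G where G: "\<And>x. norm (x ^ m *\<^sub>R g x) \<le> G"
    using schwartz_bounded[OF fg(2), of m] unfolding bounded_iff by auto
  have "norm (x ^ m *\<^sub>R h x) \<le> norm a * F + norm b * G" for x
  proof -
    have "norm (x ^ m *\<^sub>R h x) = norm (a * (x ^ m *\<^sub>R f x) + b * (x ^ m *\<^sub>R g x))"
      unfolding h by (simp add: algebra_simps scaleR_conv_of_real)
    also have "\<dots> \<le> norm a * norm (x ^ m *\<^sub>R f x) + norm b * norm (x ^ m *\<^sub>R g x)"
      by (metis norm_mult norm_triangle_ineq)
    also have "\<dots> \<le> norm a * F + norm b * G"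
      by (intro add_mono mult_left_mono F G) auto
    finally show ?thesis .
  qed
  then show "bounded (range (\<lambda>x. x ^ m *\<^sub>R h x))" unfolding bounded_iff by auto
qed

lemma schwartz_0: "schwartz (\<lambda>x. 0)"
  by (rule schwartzI[where S = "{\<lambda>x. 0}"]) auto

lemma schwartz_sum:
  "finite J \<Longrightarrow> (\<And>j. j \<in> J \<Longrightarrow> schwartz (\<phi> j)) \<Longrightarrow> schwartz (\<lambda>x. \<Sum>j\<in>J. \<phi> j x)"
proof (induction J rule: finite_induct)
  case (insert j J)
  then show ?case using schwartz_lincomb[of "\<phi> j" "\<lambda>x. \<Sum>j\<in>J. \<phi> j x" 1 1] by simp
qed (simp add: schwartz_0)

text \<open>The derivative is the same phase times f' + i c f, so phases times Schwartz functions
  form a class closed under differentiation.\<close>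

lemma schwartz_mult_cis:
  assumes "schwartz \<phi>"
  shows "schwartz (\<lambda>x. cis (c * x) * \<phi> x)"
proof (rule schwartzI[where S = "{\<lambda>x. cis (c * x) * f x | f. schwartz f}"])
  fix h assume "h \<in> {\<lambda>x. cis (c * x) * f x | f. schwartz f}"
  then obtain f where h: "h = (\<lambda>x. cis (c * x) * f x)" and f: "schwartz f" by auto
  obtain f' where f': "schwartz f'" "\<And>x. (f has_vector_derivative f' x) (at x)"
    using schwartz_deriv[OF f] by blast
  have cis: "((\<lambda>x. cis (c * x)) has_vector_derivative \<i> * of_real c * cis (c * x)) (at x)" for x
  proof -
    have "((\<lambda>x. cis (c * x)) has_vector_derivative (c *\<^sub>R (\<i> * cis (c * x)))) (at x)"
      by (auto intro!: derivative_eq_intros simp: has_vector_derivative_def algebra_simps)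
    then show ?thesis by (simp add: scaleR_conv_of_real algebra_simps)
  qed
  have "\<forall>x. (h has_vector_derivative cis (c * x) * (1 * f' x + \<i> * of_real c * f x)) (at x)"
    unfolding h
    by (intro allI has_vector_derivative_eq_rhs[OF has_vector_derivative_mult[OF cis f'(2)]])
       (simp add: algebra_simps)
  then show "\<exists>k\<in>{\<lambda>x. cis (c * x) * f x | f. schwartz f}. \<forall>x. (h has_vector_derivative k x) (at x)"
    using schwartz_lincomb[OF f'(1) f, of 1 "\<i> * of_real c"]
    by (intro bexI[of _ "\<lambda>x. cis (c * x) * (1 * f' x + \<i> * of_real c * f x)"] CollectI exI conjI)
       (rule refl | assumption)+
next
  fix h and m :: nat assume "h \<in> {\<lambda>x. cis (c * x) * f x | f. schwartz f}"
  then obtain f where h: "h = (\<lambda>x. cis (c * x) * f x)" and f: "schwartz f" by auto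
  show "bounded (range (\<lambda>x. x ^ m *\<^sub>R h x))"
    using schwartz_bounded[OF f, of m] unfolding bounded_iff h by (auto simp: norm_mult)
qed (use assms in blast)

text \<open>For y = c x + d, the power |x|^m is at most a constant times |y|^m + |d|^m, so decay in
  y gives decay in x.\<close>

lemma schwartz_affine:
  assumes "schwartz \<phi>" and "c \<noteq> 0"
  shows "schwartz (\<lambda>x. \<phi> (c * x + d))"
proof -
  have *: "\<exists>F. \<forall>x. norm (x ^ m *\<^sub>R f (c * x + d)) \<le> F" if f: "schwartz f" for f and m :: nat
  proof -
    obtain F0 Fm where F: "\<And>x. norm (f x) \<le> F0" "\<And>x. norm (x ^ m *\<^sub>R f x) \<le> Fm"
      using schwartz_bounded[OF f, of 0] schwartz_bounded[OF f, of m] unfolding bounded_iff by auto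
    have "norm (x ^ m *\<^sub>R f (c * x + d)) \<le> (2 / \<bar>c\<bar>) ^ m * (Fm + \<bar>d\<bar> ^ m * F0)" for x
    proof -
      define y where "y = c * x + d"
      have x: "x = (y - d) / c" using assms(2) by (simp add: y_def)
      have "\<bar>y - d\<bar> ^ m \<le> (2 * max \<bar>y\<bar> \<bar>d\<bar>) ^ m"
        by (intro power_mono) auto
      also have "\<dots> \<le> 2 ^ m * (\<bar>y\<bar> ^ m + \<bar>d\<bar> ^ m)"
        by (auto simp: power_mult_distrib max_def)
      finally have "\<bar>x\<bar> ^ m \<le> (2 / \<bar>c\<bar>) ^ m * (\<bar>y\<bar> ^ m + \<bar>d\<bar> ^ m)"
        unfolding x by (simp add: power_divide field_simps divide_right_mono)
      then have "norm (x ^ m *\<^sub>R f y) \<le> (2 / \<bar>c\<bar>) ^ m * (\<bar>y\<bar> ^ m + \<bar>d\<bar> ^ m) * norm (f y)"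
        by (simp add: power_abs mult_right_mono)
      also have "\<dots> = (2 / \<bar>c\<bar>) ^ m * (norm (y ^ m *\<^sub>R f y) + \<bar>d\<bar> ^ m * norm (f y))"
        by (simp add: algebra_simps power_abs)
      also have "\<dots> \<le> (2 / \<bar>c\<bar>) ^ m * (Fm + \<bar>d\<bar> ^ m * F0)"
        by (intro mult_left_mono add_mono F) auto
      finally show ?thesis unfolding y_def .
    qed
    then show ?thesis by blast
  qed
  show ?thesis
  proof (rule schwartzI[where S = "{\<lambda>x. f (c * x + d) | f. schwartz f}"])
    fix h assume "h \<in> {\<lambda>x. f (c * x + d) | f. schwartz f}"
    then obtain f where h: "h = (\<lambda>x. f (c * x + d))" and f: "schwartz f" by auto
    obtain f' where f': "schwartz f'" "\<And>x. (f has_vector_derivative f' x) (at x)"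
      using schwartz_deriv[OF f] by blast
    \<comment> \<open>The vanishing second summand makes the derivative literally an instance of
      \<open>schwartz_lincomb\<close>, which serves here for scalar multiples.\<close>
    have "\<forall>x. (h has_vector_derivative (of_real c * f' (c * x + d) + 0 * f' (c * x + d))) (at x)"
    proof
      fix x
      have "((\<lambda>x. c * x + d) has_vector_derivative c) (at x)"
        by (auto intro!: derivative_eq_intros simp: has_vector_derivative_def)
      from vector_diff_chain_at[OF this f'(2)]
      show "(h has_vector_derivative (of_real c * f' (c * x + d) + 0 * f' (c * x + d))) (at x)"
        by (simp add: h o_def scaleR_conv_of_real)
    qed
    then show "\<exists>k\<in>{\<lambda>x. f (c * x + d) | f. schwartz f}. \<forall>x. (h has_vector_derivative k x) (at x)"
      using schwartz_lincomb[OF f'(1) f'(1), of "of_real c" 0]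
      by (intro bexI[of _ "\<lambda>x. of_real c * f' (c * x + d) + 0 * f' (c * x + d)"] CollectI
          exI[of _ "\<lambda>x. of_real c * f' x + 0 * f' x"] conjI)
         (rule refl | assumption)+
  next
    fix h and m :: nat assume "h \<in> {\<lambda>x. f (c * x + d) | f. schwartz f}"
    then show "bounded (range (\<lambda>x. x ^ m *\<^sub>R h x))"
      using * unfolding bounded_iff by auto
  qed (use assms in blast)
qed

section \<open>The standard bump function\<close>

text \<open>With T = 1 / (1 - x^2), the functions p T^k exp(-T), extended by 0, form a class closed
  under differentiation; \<open>p = 1\<close> and \<open>k = 0\<close> give the usual bump.\<close>

definition bump_term :: "real poly \<Rightarrow> nat \<Rightarrow> real \<Rightarrow> real" where
  "bump_term p k x =
     (if \<bar>x\<bar> < 1 then poly p x * (1 / (1 - x\<^sup>2)) ^ k * exp (- (1 / (1 - x\<^sup>2))) else 0)"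

lemma power_exp_bounded: "\<exists>C. \<forall>t\<ge>0. t ^ k * exp (- t) \<le> (C::real)"
proof -
  have "t ^ k * exp (- t) \<le> fact k" if "t \<ge> 0" for t :: real
  proof -
    have "t ^ k / fact k \<le> exp t"
      using that sum_le_suminf[OF summable_exp, of "{k}" t]
      by (auto simp: exp_def scaleR_conv_of_real field_simps inverse_eq_divide)
    then show ?thesis by (simp add: exp_minus field_simps)
  qed
  then show ?thesis by blast
qed

text \<open>The exponential beats two more powers of T = 1 / (1 - x^2). The resulting quadratic
  vanishing at the end points is what makes the extension by 0 differentiable there.\<close>

lemma bump_term_le: "\<exists>C. \<forall>x. \<bar>bump_term p k x\<bar> \<le> C * (1 - x\<^sup>2)\<^sup>2"
proof -
  obtain C where C: "\<And>t. t \<ge> 0 \<Longrightarrow> t ^ (k + 2) * exp (- t) \<le> (C::real)"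
    using power_exp_bounded[of "k + 2"] by auto
  have "bounded (poly p ` {-1..1})"
    by (intro compact_imp_bounded compact_continuous_image continuous_intros) auto
  then obtain P where P: "\<And>x. \<bar>x\<bar> \<le> 1 \<Longrightarrow> \<bar>poly p x\<bar> \<le> P"
    unfolding bounded_iff by (metis abs_le_iff atLeastAtMost_iff imageI minus_le_iff real_norm_def)
  have P0: "P \<ge> 0" using P[of 0] by auto
  have C0: "C \<ge> 0" using C[of 0] by auto
  have "\<bar>bump_term p k x\<bar> \<le> (P * C) * (1 - x\<^sup>2)\<^sup>2" for x
  proof (cases "\<bar>x\<bar> < 1")
    case True
    then have x: "1 - x\<^sup>2 > 0" by (simp add: abs_square_less_1)
    define t where "t = 1 / (1 - x\<^sup>2)"
    have t: "t > 0" "(1 - x\<^sup>2) = 1 / t" using x by (auto simp: t_def)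
    have "t ^ k * exp (- t) = (t ^ (k + 2) * exp (- t)) * (1 / t)\<^sup>2"
      using t(1) by (simp add: field_simps power2_eq_square)
    also have "\<dots> \<le> C * (1 - x\<^sup>2)\<^sup>2"
      unfolding t(2) using C[of t] t(1) by (intro mult_right_mono) auto
    finally have "t ^ k * exp (- t) \<le> C * (1 - x\<^sup>2)\<^sup>2" .
    then have "\<bar>poly p x\<bar> * (t ^ k * exp (- t)) \<le> P * (C * (1 - x\<^sup>2)\<^sup>2)"
      using P[of x] True t(1) P0 by (intro mult_mono[of "\<bar>poly p x\<bar>"]) auto
    then show ?thesis using True t(1) by (simp add: bump_term_def t_def[symmetric] abs_mult mult.assoc)
  next
    case False
    then show ?thesis using P0 C0 by (simp add: bump_term_def)
  qed
  then show ?thesis by blast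
qed

text \<open>Since T' = 2 x T^2 and T (1 - x^2) = 1, each term of the product rule can be brought to
  the common power T^(k+2); \<open>q\<close> collects the coefficients, with
  \<open>[:1, 0, -1:]\<close> standing for 1 - x^2.\<close>

lemma bump_term_deriv:
  fixes p :: "real poly" and k :: nat
  defines "q \<equiv> pderiv p * [:1, 0, -1:]\<^sup>2 + [:0, 2 * real k:] * p * [:1, 0, -1:] - [:0, 2:] * p"
  shows "(bump_term p k has_real_derivative bump_term q (k + 2) x) (at x)"
proof -
  consider "\<bar>x\<bar> < 1" | "\<bar>x\<bar> > 1" | "\<bar>x\<bar> = 1" by linarith
  then show ?thesis
  proof cases
    case 1
    define T where "T = (\<lambda>x::real. 1 / (1 - x\<^sup>2))"
    have x: "1 - x\<^sup>2 > 0" using 1 by (simp add: abs_square_less_1)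
    have dT: "(T has_real_derivative 2 * x * (T x)\<^sup>2) (at x)"
      unfolding T_def using x
      by (auto intro!: derivative_eq_intros simp: power2_eq_square field_simps)
    have "((\<lambda>x. poly p x * T x ^ k * exp (- T x)) has_real_derivative
            (poly (pderiv p) x * T x ^ k * exp (- T x) + poly p x * (real k * T x ^ (k - 1) * (2 * x * (T x)\<^sup>2)) * exp (- T x)
              - poly p x * T x ^ k * exp (- T x) * (2 * x * (T x)\<^sup>2))) (at x)"
      by (auto intro!: derivative_eq_intros dT poly_DERIV simp: algebra_simps)
    moreover have "poly (pderiv p) x * T x ^ k * exp (- T x) + poly p x * (real k * T x ^ (k - 1) * (2 * x * (T x)\<^sup>2)) * exp (- T x)
              - poly p x * T x ^ k * exp (- T x) * (2 * x * (T x)\<^sup>2) = bump_term q (k + 2) x"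
    proof -
      have inv: "T x * (1 - x\<^sup>2) = 1" using x by (simp add: T_def)
      \<comment> \<open>At \<open>k = 0\<close> the exponent \<open>k - 1\<close> truncates, which
        the factor \<open>real k\<close> makes harmless.\<close>
      have pk: "real k * T x ^ (k - 1) * (T x)\<^sup>2 = real k * T x ^ (k + 2) * (1 - x\<^sup>2)"
      proof (cases k)
        case (Suc n)
        have "T x ^ (k + 2) * (1 - x\<^sup>2) = T x ^ n * (T x)\<^sup>2 * (T x * (1 - x\<^sup>2))"
          by (simp add: Suc power2_eq_square)
        then have "T x ^ (k + 2) * (1 - x\<^sup>2) = T x ^ n * (T x)\<^sup>2"
          unfolding inv by simp
        then show ?thesis by (metis (no_types, lifting) Suc diff_Suc_1 mult.assoc)
      qed simp
      have p0: "T x ^ k = T x ^ (k + 2) * (1 - x\<^sup>2)\<^sup>2"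
      proof -
        have "T x ^ (k + 2) * (1 - x\<^sup>2)\<^sup>2 = T x ^ k * (T x * (1 - x\<^sup>2))\<^sup>2"
          unfolding power_add power_mult_distrib by (rule mult.assoc)
        then show ?thesis by (simp add: inv)
      qed
      have "poly p x * (real k * T x ^ (k - 1) * (2 * x * (T x)\<^sup>2)) * exp (- T x) =
         poly p x * (real k * T x ^ (k - 1) * (T x)\<^sup>2) * (2 * x) * exp (- T x)" by simp
      then have t2: "poly p x * (real k * T x ^ (k - 1) * (2 * x * (T x)\<^sup>2)) * exp (- T x) =
         poly p x * (real k * T x ^ (k + 2) * (1 - x\<^sup>2)) * (2 * x) * exp (- T x)"
        unfolding pk .
      have t1: "poly (pderiv p) x * T x ^ k * exp (- T x) =
          poly (pderiv p) x * (T x ^ (k + 2) * (1 - x\<^sup>2)\<^sup>2) * exp (- T x)"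
        using p0 by simp
      have t3: "poly p x * T x ^ k * exp (- T x) * (2 * x * (T x)\<^sup>2) =
          poly p x * T x ^ (k + 2) * exp (- T x) * (2 * x)"
        by (simp add: power_add power2_eq_square)
      have t4: "bump_term q (k + 2) x =
         (poly (pderiv p) x * (1 - x\<^sup>2)\<^sup>2 + 2 * real k * x * poly p x * (1 - x\<^sup>2) - 2 * x * poly p x) * T x ^ (k + 2) * exp (- T x)"
        using 1 by (simp add: bump_term_def T_def q_def power2_eq_square algebra_simps)
      show ?thesis unfolding t1 t2 t3 t4 by (simp only: ring_distribs mult_ac)
    qed
    ultimately have "((\<lambda>x. poly p x * T x ^ k * exp (- T x)) has_real_derivative bump_term q (k + 2) x) (at x)"
      by simp
    then show ?thesis
      by (rule has_field_derivative_transform_within_open[where S = "{-1<..<1}"])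
         (use 1 in \<open>auto simp: bump_term_def T_def\<close>)
  next
    case 2
    have "((\<lambda>x. 0) has_real_derivative 0) (at x)" by simp
    then have "(bump_term p k has_real_derivative 0) (at x)"
      by (rule has_field_derivative_transform_within_open[where S = "- {-1..1}"])
         (use 2 in \<open>auto simp: bump_term_def abs_if split: if_splits\<close>)
    then show ?thesis using 2 by (simp add: bump_term_def)
  next
    case 3
    obtain C where C: "\<And>y. \<bar>bump_term p k y\<bar> \<le> C * (1 - y\<^sup>2)\<^sup>2"
      using bump_term_le by blast
    have x2: "x\<^sup>2 = 1" using 3 by (metis one_power2 power2_abs)
    \<comment> \<open>As x^2 = 1, (1 - y^2)^2 equals (y - x)^2 (y + x)^2, so the quadratic bound
      leaves one factor |y - x| after division by y - x.\<close>
    have "((\<lambda>y. (bump_term p k y - bump_term p k x) / (y - x)) \<longlongrightarrow> 0) (at x)"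
    proof (rule Lim_null_comparison)
      show "((\<lambda>y. C * \<bar>y - x\<bar> * (y + x)\<^sup>2) \<longlongrightarrow> 0) (at x)"
        by (auto intro!: tendsto_eq_intros)
      show "\<forall>\<^sub>F y in at x. norm ((bump_term p k y - bump_term p k x) / (y - x)) \<le> C * \<bar>y - x\<bar> * (y + x)\<^sup>2"
        unfolding eventually_at
      proof (intro exI[of _ 1] conjI ballI impI)
        fix y assume y: "y \<noteq> x \<and> dist y x < 1"
        have "(1 - y\<^sup>2)\<^sup>2 = \<bar>y - x\<bar> * \<bar>y - x\<bar> * (y + x)\<^sup>2"
          unfolding x2[symmetric] by (simp add: abs_mult_self power2_eq_square algebra_simps)
        then have "\<bar>bump_term p k y\<bar> \<le> C * \<bar>y - x\<bar> * (y + x)\<^sup>2 * \<bar>y - x\<bar>"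
          using C[of y] by (simp add: mult_ac)
        moreover have "bump_term p k x = 0" using 3 by (simp add: bump_term_def)
        ultimately show "norm ((bump_term p k y - bump_term p k x) / (y - x)) \<le> C * \<bar>y - x\<bar> * (y + x)\<^sup>2"
          using y by (simp add: pos_divide_le_eq)
      qed auto
    qed
    then show ?thesis using 3 unfolding has_field_derivative_iff by (simp add: bump_term_def)
  qed
qed

definition bump :: "real \<Rightarrow> real" where
  "bump = bump_term 1 0"

lemma schwartz_bump: "schwartz (\<lambda>x. complex_of_real (bump x))"
proof (rule schwartzI[where S = "{\<lambda>x. complex_of_real (bump_term p k x) | p k. True}"])
  fix h assume "h \<in> {\<lambda>x. complex_of_real (bump_term p k x) | p k. True}"
  then obtain p k where h: "h = (\<lambda>x. complex_of_real (bump_term p k x))" by auto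
  show "\<exists>g\<in>{\<lambda>x. complex_of_real (bump_term p k x) | p k. True}. \<forall>x. (h has_vector_derivative g x) (at x)"
    unfolding h
    by (rule bexI, rule allI, rule has_vector_derivative_of_real, rule bump_term_deriv) blast
next
  fix h and m :: nat assume "h \<in> {\<lambda>x. complex_of_real (bump_term p k x) | p k. True}"
  then obtain p k where h: "h = (\<lambda>x. complex_of_real (bump_term p k x))" by auto
  obtain C where C: "\<And>y. \<bar>bump_term p k y\<bar> \<le> C * (1 - y\<^sup>2)\<^sup>2"
    using bump_term_le by blast
  have "norm (x ^ m *\<^sub>R h x) \<le> C" for x
  proof (cases "\<bar>x\<bar> < 1")
    case True
    then have x: "x\<^sup>2 \<ge> 0" "x\<^sup>2 \<le> 1" using abs_square_less_1[of x] by auto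
    have C0: "C \<ge> 0" using C[of 0] by auto
    have "\<bar>x\<bar> ^ m \<le> 1" using True by (simp add: power_le_one)
    then have "\<bar>x\<bar> ^ m * \<bar>bump_term p k x\<bar> \<le> 1 * (C * 1)"
      using x C0 by (intro mult_mono order_trans[OF C mult_left_mono]) (auto simp: power_le_one)
    then show ?thesis by (simp add: h power_abs)
  next
    case False
    then show ?thesis using C[of 0] by (simp add: h bump_term_def)
  qed
  then show "bounded (range (\<lambda>x. x ^ m *\<^sub>R h x))" unfolding bounded_iff by auto
qed (auto simp: bump_def)

lemma bump_nonneg: "0 \<le> bump x"
  and bump_le_1: "bump x \<le> 1"
  and bump_eq_0: "1 \<le> \<bar>x\<bar> \<Longrightarrow> bump x = 0"
  by (auto simp: bump_def bump_term_def abs_square_le_1 field_simps)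

text \<open>On this interval 1 / (1 - x^2) is at most 4/3; the exponent 2 is a round upper bound.
  The estimate later turns integrals of bumps into bounds on masses.\<close>

lemma bump_ge: "exp (- 2) \<le> bump x" if "\<bar>x\<bar> \<le> 1 / 2"
proof -
  have "x\<^sup>2 \<le> (1/2)\<^sup>2" using that by (metis abs_le_square_iff abs_of_nonneg zero_le_divide_1_iff zero_le_numeral)
  then have "1 / (1 - x\<^sup>2) \<le> 2" by (simp add: field_simps power2_eq_square)
  then show ?thesis using that by (simp add: bump_def bump_term_def)
qed

section \<open>Supertiles\<close>

definition tile :: "real^'a \<Rightarrow> 'a \<times> real \<Rightarrow> real set" where
  "tile l p = {snd p ..< snd p + l $ fst p}"

text \<open>The region \<open>I\<close> is a parameter so that tilings of the line and patches that
  fill a bounded interval share the same lemmas.\<close>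

definition tiles :: "real^'a \<Rightarrow> real set \<Rightarrow> ('a \<Rightarrow> real set) \<Rightarrow> bool" where
  "tiles l I \<Lambda> \<longleftrightarrow>
     (\<forall>p\<in>Sigma UNIV \<Lambda>. tile l p \<subseteq> I) \<and> (\<forall>y\<in>I. \<exists>!p. p \<in> Sigma UNIV \<Lambda> \<and> y \<in> tile l p)"

lemma is_tiling_iff_tiles: "is_tiling l \<Lambda> \<longleftrightarrow> tiles l UNIV \<Lambda>"
proof -
  have "(\<exists>!(i, x). x \<in> \<Lambda> i \<and> x \<le> y \<and> y < x + l $ i) \<longleftrightarrow>
      (\<exists>!p. p \<in> Sigma UNIV \<Lambda> \<and> y \<in> tile l p)" for y
    by (rule arg_cong[where f = Ex1]) (auto simp: fun_eq_iff tile_def)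
  then show ?thesis unfolding is_tiling_def tiles_def by simp
qed

section \<open>Iterated inflation of one prototile\<close>

text \<open>The order of the types is opposite to that in \<open>displacements\<close>:
  \<open>patch \<rho> lam l n a i\<close> holds the positions of the tiles of type \<open>i\<close>
  inside the inflated tile of type \<open>a\<close>.\<close>

definition patch :: "('a::finite \<Rightarrow> 'a list) \<Rightarrow> real \<Rightarrow> real^'a \<Rightarrow> nat \<Rightarrow> 'a \<Rightarrow> 'a \<Rightarrow> real set" where
  "patch \<rho> lam l n a = (inflate \<rho> lam l ^^ n) (\<lambda>i. if i = a then {0} else {})"

text \<open>The n-fold inflation acts like a single one with multiplier lam^n and displacement sets
  \<open>patch\<close>. This is an identity of sets; that the representation is unique is shown in
  \<open>supertile_decomposition_unique\<close>.\<close>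

lemma mem_inflate_pow_iff:
  "y \<in> (inflate \<rho> lam l ^^ n) \<Lambda> i \<longleftrightarrow>
     (\<exists>x t j. y = lam ^ n * x + t \<and> x \<in> \<Lambda> j \<and> t \<in> patch \<rho> lam l n j i)"
proof (induction n arbitrary: y i)
  case 0
  then show ?case by (auto simp: patch_def)
next
  case (Suc n)
  have "y \<in> (inflate \<rho> lam l ^^ Suc n) \<Lambda> i \<longleftrightarrow>
    (\<exists>w s j. y = lam * w + s \<and> w \<in> (inflate \<rho> lam l ^^ n) \<Lambda> j \<and> s \<in> displacements \<rho> l i j)"
    by (simp add: inflate_def)
  also have "\<dots> \<longleftrightarrow> (\<exists>x t k s j. y = lam * (lam ^ n * x + t) + s \<and> x \<in> \<Lambda> k
      \<and> t \<in> patch \<rho> lam l n k j \<and> s \<in> displacements \<rho> l i j)"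
    unfolding Suc.IH by blast
  also have "\<dots> \<longleftrightarrow> (\<exists>x k v. y = lam ^ Suc n * x + v \<and> x \<in> \<Lambda> k
      \<and> (\<exists>t s j. v = lam * t + s \<and> t \<in> patch \<rho> lam l n k j \<and> s \<in> displacements \<rho> l i j))"
  proof -
    have eq: "lam * (lam ^ n * x + t) + s = lam ^ Suc n * x + (lam * t + s)" for x t s
      by (simp add: algebra_simps)
    show ?thesis unfolding eq by blast
  qed
  also have "\<dots> \<longleftrightarrow> (\<exists>x v k. y = lam ^ Suc n * x + v \<and> x \<in> \<Lambda> k \<and> v \<in> patch \<rho> lam l (Suc n) k i)"
    by (simp add: patch_def inflate_def) blast
  finally show ?case .
qed

lemma patch_add: "patch \<rho> lam l (m + n) a = (inflate \<rho> lam l ^^ m) (patch \<rho> lam l n a)"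
  by (simp add: patch_def funpow_add)

lemma patch_1: "patch \<rho> lam l (Suc 0) a i = displacements \<rho> l i a"
  by (auto simp: patch_def inflate_def)

lemma finite_patch: "finite (patch \<rho> lam l n a i)"
proof (induction n arbitrary: i)
  case 0
  then show ?case by (simp add: patch_def)
next
  case (Suc n)
  have "finite (\<Union>j. (\<lambda>(x, t). lam * x + t) ` (patch \<rho> lam l n a j \<times> displacements \<rho> l i j))"
    using Suc.IH by (simp add: displacements_def)
  also have "(\<Union>j. (\<lambda>(x, t). lam * x + t) ` (patch \<rho> lam l n a j \<times> displacements \<rho> l i j)) =
      patch \<rho> lam l (Suc n) a i"
    by (auto simp: patch_def inflate_def)
  finally show ?case .
qed

lemma ex_subinterval:
  fixes s :: "nat \<Rightarrow> real"
  assumes "s 0 \<le> y" "y < s n"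
  shows "\<exists>p<n. s p \<le> y \<and> y < s (Suc p)"
  using assms(2)
proof (induction n)
  case (Suc n)
  then show ?case by (cases "y < s n") (auto intro: less_SucI)
qed (use assms in simp)

locale inflation_rule =
  fixes \<rho> :: "'a::finite \<Rightarrow> 'a list" and lam :: real and l :: "real^'a"
  assumes lam_gt_1: "lam > 1"
    and l_pos: "0 < l $ i"
    and left_eigenvector: "l v* subst_matrix \<rho> = lam *s l"
begin

abbreviation "infl \<equiv> inflate \<rho> lam l"
abbreviation "ptch \<equiv> patch \<rho> lam l"

lemma lam_power_pos: "lam ^ n > 0"
  using lam_gt_1 by simp

text \<open>This is the left eigenvector equation read geometrically: the dissected patch exactly
  fills the expanded tile.\<close>

lemma sum_lengths: "(\<Sum>q<length (\<rho> a). l $ (\<rho> a ! q)) = lam * l $ a"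
proof -
  have "(\<Sum>q<length (\<rho> a). l $ (\<rho> a ! q)) = sum_list (map (\<lambda>i. l $ i) (\<rho> a))"
    by (simp add: sum_list_sum_nth atLeast0LessThan)
  also have "\<dots> = (\<Sum>i\<in>UNIV. real (count_list (\<rho> a) i) * l $ i)"
  proof -
    have "sum_list (map (($) l) xs) = (\<Sum>i\<in>UNIV. real (count_list xs i) * l $ i)" for xs
    proof (induction xs)
      case (Cons x xs)
      have "real (count_list (x # xs) i) * l $ i = (if i = x then l $ i else 0) + real (count_list xs i) * l $ i" for i
        by (simp add: distrib_right)
      then show ?case using Cons.IH by (simp add: sum.distrib del: count_list.simps)
    qed simp
    then show ?thesis .
  qed
  also have "\<dots> = (l v* subst_matrix \<rho>) $ a"
    by (simp add: vector_matrix_mult_def subst_matrix_def mult.commute)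
  finally show ?thesis by (simp add: left_eigenvector)
qed

lemma tiles_displacements: "tiles l {0 ..< lam * l $ a} (\<lambda>i. displacements \<rho> l i a)"
proof -
  define s where "s p = (\<Sum>q<p. l $ (\<rho> a ! q))" for p
  have s_Suc: "s (Suc p) = s p + l $ (\<rho> a ! p)" for p
    by (simp add: s_def)
  have s_0: "s 0 = 0" and s_len: "s (length (\<rho> a)) = lam * l $ a"
    by (auto simp: s_def sum_lengths)
  have s_mono: "s p \<le> s q" if "p \<le> q" for p q
    using that by (rule lift_Suc_mono_le[of s, rotated]) (simp add: s_Suc less_imp_le[OF l_pos])
  have mem: "(i, x) \<in> (SIGMA i:UNIV. displacements \<rho> l i a) \<longleftrightarrow>
      (\<exists>p<length (\<rho> a). i = \<rho> a ! p \<and> x = s p)" for i x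
    by (auto simp: displacements_def s_def)
  have tile_eq: "tile l (\<rho> a ! p, s p) = {s p ..< s (Suc p)}" for p
    by (simp add: tile_def s_Suc)
  show ?thesis
    unfolding tiles_def
  proof (intro conjI ballI)
    fix p assume "p \<in> (SIGMA i:UNIV. displacements \<rho> l i a)"
    then obtain q where "q < length (\<rho> a)" "p = (\<rho> a ! q, s q)" using mem by (cases p) auto
    then show "tile l p \<subseteq> {0 ..< lam * l $ a}"
      using s_mono[of 0 q] s_mono[of "Suc q" "length (\<rho> a)"] by (auto simp: tile_eq s_0 s_len)
  next
    fix y assume y: "y \<in> {0 ..< lam * l $ a}"
    then obtain q where q: "q < length (\<rho> a)" "s q \<le> y" "y < s (Suc q)"
      using ex_subinterval[of s y "length (\<rho> a)"] by (auto simp: s_0 s_len)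
    show "\<exists>!p. p \<in> (SIGMA i:UNIV. displacements \<rho> l i a) \<and> y \<in> tile l p"
    proof (rule ex1I)
      show "(\<rho> a ! q, s q) \<in> (SIGMA i:UNIV. displacements \<rho> l i a) \<and> y \<in> tile l (\<rho> a ! q, s q)"
        using q by (auto simp: mem tile_eq simp del: mem_Sigma_iff)
    next
      fix p assume p: "p \<in> (SIGMA i:UNIV. displacements \<rho> l i a) \<and> y \<in> tile l p"
      then obtain q' where q': "q' < length (\<rho> a)" "p = (\<rho> a ! q', s q')" using mem by (cases p) auto
      then have "s q' \<le> y" "y < s (Suc q')" using p by (auto simp: tile_eq)
      then have "\<not> Suc q' \<le> q" "\<not> Suc q \<le> q'"
        using s_mono[of "Suc q'" q] s_mono[of "Suc q" q'] q by linarith+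
      then have "q' = q" by linarith
      then show "p = (\<rho> a ! q, s q)" using q' by simp
    qed
  qed
qed

text \<open>A tile around z forces z / lam into its parent tile (\<open>super\<close>). Existence
  and uniqueness therefore split into finding the parent in \<open>\<Lambda>\<close> and the child
  in its dissected patch.\<close>

lemma tiles_inflate:
  assumes "tiles l I \<Lambda>"
  shows "tiles l ((*) lam ` I) (infl \<Lambda>)"
proof -
  have lam: "lam > 0" using lam_gt_1 by simp
  have mem: "(i, y) \<in> Sigma UNIV (infl \<Lambda>) \<longleftrightarrow>
      (\<exists>x t j. y = lam * x + t \<and> (j, x) \<in> Sigma UNIV \<Lambda> \<and> (i, t) \<in> (SIGMA i:UNIV. displacements \<rho> l i j))" for i y
    by (auto simp: inflate_def)
  have tile_add: "tile l (i, lam * x + t) = (+) (lam * x) ` tile l (i, t)" for i x t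
    by (auto simp: tile_def image_add_atLeastLessThan algebra_simps)
  have super: "z / lam \<in> tile l (j, x)"
    if "(i, t) \<in> (SIGMA i:UNIV. displacements \<rho> l i j)" "z \<in> tile l (i, lam * x + t)" for i x t z j
  proof -
    have "z - lam * x \<in> tile l (i, t)" using that(2) unfolding tile_add by auto
    then have "z - lam * x \<in> {0..<lam * l $ j}"
      using tiles_displacements[of j] that(1) unfolding tiles_def by blast
    then show ?thesis using lam by (auto simp: tile_def field_simps)
  qed
  show ?thesis
    unfolding tiles_def
  proof (intro conjI ballI subsetI)
    fix p z assume "p \<in> Sigma UNIV (infl \<Lambda>)" "z \<in> tile l p"
    then obtain i x t j where p: "p = (i, lam * x + t)" "(j, x) \<in> Sigma UNIV \<Lambda>"
        "(i, t) \<in> (SIGMA i:UNIV. displacements \<rho> l i j)"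
      using mem by (cases p) blast
    then have "z / lam \<in> I" using super[of i t j z x] \<open>z \<in> tile l p\<close> assms unfolding tiles_def by blast
    then show "z \<in> (*) lam ` I" using lam by (intro image_eqI[of _ _ "z / lam"]) auto
  next
    fix z assume "z \<in> (*) lam ` I"
    then have "z / lam \<in> I" using lam by auto
    then obtain j x where jx: "(j, x) \<in> Sigma UNIV \<Lambda>" "z / lam \<in> tile l (j, x)"
      and jx_unique: "\<And>p. p \<in> Sigma UNIV \<Lambda> \<Longrightarrow> z / lam \<in> tile l p \<Longrightarrow> p = (j, x)"
      using assms unfolding tiles_def by (metis surj_pair)
    have "z - lam * x \<in> {0..<lam * l $ j}" using jx(2) lam by (auto simp: tile_def field_simps)
    then obtain i t where it: "(i, t) \<in> (SIGMA i:UNIV. displacements \<rho> l i j)" "z - lam * x \<in> tile l (i, t)"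
      and it_unique: "\<And>p. p \<in> (SIGMA i:UNIV. displacements \<rho> l i j) \<Longrightarrow> z - lam * x \<in> tile l p \<Longrightarrow> p = (i, t)"
      using tiles_displacements[of j] unfolding tiles_def by (metis surj_pair)
    show "\<exists>!p. p \<in> Sigma UNIV (infl \<Lambda>) \<and> z \<in> tile l p"
    proof (rule ex1I)
      have "z \<in> tile l (i, lam * x + t)" using it(2) unfolding tile_add by (auto intro: image_eqI[of _ _ "z - lam * x"])
      then show "(i, lam * x + t) \<in> Sigma UNIV (infl \<Lambda>) \<and> z \<in> tile l (i, lam * x + t)"
        using mem jx it by blast
    next
      fix p assume p: "p \<in> Sigma UNIV (infl \<Lambda>) \<and> z \<in> tile l p"
      then obtain i' x' t' j' where p': "p = (i', lam * x' + t')" "(j', x') \<in> Sigma UNIV \<Lambda>"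
          "(i', t') \<in> (SIGMA i:UNIV. displacements \<rho> l i j')"
        using mem by (cases p) blast
      then have "(j', x') = (j, x)" using super[of i' t' j' z x'] p jx_unique by blast
      moreover from this have "z - lam * x \<in> tile l (i', t')"
        using p p'(1) unfolding p'(1) tile_add by auto
      ultimately have "(i', t') = (i, t)" using it_unique p'(3) by auto
      with \<open>(j', x') = (j, x)\<close> show "p = (i, lam * x + t)" using p'(1) by simp
    qed
  qed
qed

lemma tiles_patch: "tiles l {0 ..< lam ^ n * l $ a} (ptch n a)"
proof (induction n)
  case 0
  have eq: "Sigma UNIV (ptch 0 a) = {(a, 0)}" by (auto simp: patch_def split: if_splits)
  show ?case unfolding tiles_def eq by (auto simp: tile_def)
next
  case (Suc n)
  have "(*) lam ` {0 ..< lam ^ n * l $ a} = {0 ..< lam ^ Suc n * l $ a}"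
    using lam_gt_1
    by (auto simp: image_iff mult.assoc[symmetric] intro!: bexI[of _ "_ / lam"]) (auto simp: field_simps)
  then show ?case using tiles_inflate[OF Suc.IH] by (simp add: patch_def)
qed

lemma patch_bounds:
  assumes "t \<in> ptch n a i"
  shows "0 \<le> t" "t < lam ^ n * l $ a"
proof -
  have "tile l (i, t) \<subseteq> {0 ..< lam ^ n * l $ a}"
    using tiles_patch[of n a] assms unfolding tiles_def by auto
  moreover have "t \<in> tile l (i, t)" by (simp add: tile_def l_pos)
  ultimately show "0 \<le> t" "t < lam ^ n * l $ a" by auto
qed

text \<open>Order 0 gives back the tile itself, so statements about tiles can be obtained from those
  about supertiles.\<close>

definition supertile :: "nat \<Rightarrow> 'a \<times> real \<Rightarrow> real set" where
  "supertile m p = {lam ^ m * snd p ..< lam ^ m * (snd p + l $ fst p)}"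

lemma mem_supertile_iff: "y \<in> supertile m p \<longleftrightarrow> y / lam ^ m \<in> tile l p"
  using lam_power_pos[of m] by (auto simp: supertile_def tile_def field_simps)

lemma add_patch_mem_supertile: "t \<in> ptch m j i \<Longrightarrow> lam ^ m * x + t \<in> supertile m (j, x)"
  using patch_bounds[of t m j i] by (simp add: supertile_def algebra_simps)

lemma supertile_unique:
  assumes "tiles l J \<Lambda>" "p \<in> Sigma UNIV \<Lambda>" "q \<in> Sigma UNIV \<Lambda>" "y \<in> supertile m p" "y \<in> supertile m q"
  shows "p = q"
proof -
  have "y / lam ^ m \<in> J" using assms unfolding mem_supertile_iff tiles_def by blast
  then show ?thesis using assms unfolding mem_supertile_iff tiles_def by blast
qed

text \<open>The point lies in the supertiles of both (j, x) and (j', x'), and distinct supertiles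
  are disjoint. This turns the sums over points of an inflated tiling into sums over parents and
  displacements.\<close>

lemma supertile_decomposition_unique:
  assumes "tiles l J \<Lambda>" "x \<in> \<Lambda> j" "x' \<in> \<Lambda> j'" "t \<in> ptch m j i" "t' \<in> ptch m j' i'"
    and "lam ^ m * x + t = lam ^ m * x' + t'"
  shows "j = j' \<and> x = x' \<and> t = t'"
  using supertile_unique[OF assms(1), of "(j, x)" "(j', x')" "lam ^ m * x + t" m]
    add_patch_mem_supertile[OF assms(4), of x] add_patch_mem_supertile[OF assms(5), of x'] assms by auto

lemma inflate_pow_Int_supertile:
  assumes "tiles l J \<Lambda>" "x \<in> \<Lambda> j"
  shows "(infl ^^ m) \<Lambda> i \<inter> supertile m (j, x) = (+) (lam ^ m * x) ` ptch m j i"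
proof (intro equalityI subsetI)
  fix y assume y: "y \<in> (infl ^^ m) \<Lambda> i \<inter> supertile m (j, x)"
  then obtain x' t j' where x': "y = lam ^ m * x' + t" "x' \<in> \<Lambda> j'" "t \<in> ptch m j' i"
    unfolding Int_iff mem_inflate_pow_iff by auto
  then have "(j', x') = (j, x)"
    using supertile_unique[OF assms(1), of "(j', x')" "(j, x)" y m] add_patch_mem_supertile[of t m j' i x'] assms y by auto
  then show "y \<in> (+) (lam ^ m * x) ` ptch m j i" using x' by auto
next
  fix y assume "y \<in> (+) (lam ^ m * x) ` ptch m j i"
  then show "y \<in> (infl ^^ m) \<Lambda> i \<inter> supertile m (j, x)"
    using add_patch_mem_supertile assms(2) unfolding Int_iff mem_inflate_pow_iff by auto
qed

text \<open>The innermost substitution is peeled off: a tile at x in the first patch becomes an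
  order-n patch at lam^n x. Its phase at k is that of x at lam^n k, which is the last factor of the
  cocycle, times the phases of the order-n patch.\<close>

lemma fourier_cocycle_entry:
  "fourier_cocycle \<rho> lam l n k $ i $ j = (\<Sum>t\<in>ptch n j i. cis (2 * pi * t * k))"
proof (induction n arbitrary: i j)
  case 0
  then show ?case by (simp add: patch_def mat_def)
next
  case (Suc n)
  define D where "D = (SIGMA c:UNIV. displacements \<rho> l c j \<times> ptch n c i)"
  have bij: "bij_betw (\<lambda>(c, x, t). lam ^ n * x + t) D (ptch (Suc n) j i)"
    unfolding bij_betw_def
  proof
    show "inj_on (\<lambda>(c, x, t). lam ^ n * x + t) D"
      using supertile_decomposition_unique[OF tiles_displacements[of j], of _ _ _ _ _ n]
      unfolding D_def inj_on_def by fastforce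
    have eq: "ptch (Suc n) j = (infl ^^ n) (ptch (Suc 0) j)"
      using patch_add[of \<rho> lam l n "Suc 0" j] by simp
    show "(\<lambda>(c, x, t). lam ^ n * x + t) ` D = ptch (Suc n) j i"
      unfolding eq set_eq_iff mem_inflate_pow_iff patch_1 by (force simp: D_def)
  qed
  have fin: "finite (displacements \<rho> l c j)" for c
    by (simp add: displacements_def)
  have "fourier_cocycle \<rho> lam l (Suc n) k $ i $ j =
     (\<Sum>c\<in>UNIV. (\<Sum>t\<in>ptch n c i. cis (2 * pi * t * k)) * (\<Sum>x\<in>displacements \<rho> l c j. cis (2 * pi * x * (lam ^ n * k))))"
    by (simp add: matrix_matrix_mult_def Suc.IH fourier_matrix_def)
  also have "\<dots> = (\<Sum>c\<in>UNIV. \<Sum>x\<in>displacements \<rho> l c j. \<Sum>t\<in>ptch n c i. cis (2 * pi * (lam ^ n * x + t) * k))"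
    by (simp add: sum_product cis_mult algebra_simps) (subst sum.swap, simp)
  also have "\<dots> = (\<Sum>(c, x, t)\<in>D. cis (2 * pi * (lam ^ n * x + t) * k))"
    unfolding D_def using fin finite_patch[of \<rho> lam l n]
    by (subst sum.Sigma[symmetric]) (auto simp: sum.cartesian_product intro!: finite_cartesian_product)
  also have "\<dots> = (\<Sum>t\<in>ptch (Suc n) j i. cis (2 * pi * t * k))"
    using sum.reindex_bij_betw[OF bij, of "\<lambda>t. cis (2 * pi * t * k)"] by (simp add: case_prod_unfold)
  finally show ?case .
qed

end

section \<open>Uniform densities\<close>

definition separated :: "real \<Rightarrow> real set \<Rightarrow> bool" where
  "separated \<delta> S \<longleftrightarrow> (\<forall>x\<in>S. \<forall>y\<in>S. x \<noteq> y \<longrightarrow> \<delta> \<le> \<bar>x - y\<bar>)"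

text \<open>Each half-open cell of length \<delta> holds at most one point. This bounds every
  boundary error that follows.\<close>

lemma separated_card:
  assumes "separated \<delta> S" "\<delta> > 0" "S \<subseteq> {a..a + w}" "0 \<le> w"
  shows "finite S" "real (card S) \<le> w / \<delta> + 1"
proof -
  define h where "h x = \<lfloor>(x - a) / \<delta>\<rfloor>" for x
  have inj: "inj_on h S"
  proof (rule inj_onI, rule ccontr)
    fix x y assume xy: "x \<in> S" "y \<in> S" "h x = h y" "x \<noteq> y"
    then have "\<bar>(x - a) / \<delta> - (y - a) / \<delta>\<bar> < 1" unfolding h_def by linarith
    moreover have "(x - a) / \<delta> - (y - a) / \<delta> = (x - y) / \<delta>" by (simp add: diff_divide_distrib)
    ultimately have "\<bar>x - y\<bar> < \<delta>" using assms(2) by (simp add: abs_divide)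
    then show False using assms(1) xy unfolding separated_def by force
  qed
  have sub: "h ` S \<subseteq> {0..\<lfloor>w / \<delta>\<rfloor>}"
  proof
    fix n assume "n \<in> h ` S"
    then obtain x where x: "x \<in> S" "n = h x" by auto
    then have "0 \<le> x - a" "x - a \<le> w" using assms(3) by auto
    then show "n \<in> {0..\<lfloor>w / \<delta>\<rfloor>}"
      using assms(2) x by (auto simp: h_def intro!: floor_mono divide_right_mono)
  qed
  show "finite S" using inj sub finite_imageD finite_subset by blast
  have "card S \<le> card {0..\<lfloor>w / \<delta>\<rfloor>}"
    using inj sub by (metis card_image card_mono finite_atLeastAtMost_int)
  moreover have "real (card {0..\<lfloor>w / \<delta>\<rfloor>}) \<le> w / \<delta> + 1"
    using assms(2,4) by simp
  ultimately show "real (card S) \<le> w / \<delta> + 1" by linarith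
qed

lemma separated_subset: "separated \<delta> S \<Longrightarrow> S' \<subseteq> S \<Longrightarrow> separated \<delta> S'"
  unfolding separated_def by blast

text \<open>Unlike in \<open>dens\<close>, the windows may sit anywhere and the error depends on
  their length alone. The finiteness clause excludes infinite intersections, whose
  \<open>card\<close> would be 0.\<close>

definition uniform_density :: "real set \<Rightarrow> real \<Rightarrow> bool" where
  "uniform_density S d \<longleftrightarrow> (\<forall>a b. finite (S \<inter> {a..b})) \<and>
     (\<forall>e>0. \<exists>R>0. \<forall>a b. R \<le> b - a \<longrightarrow> \<bar>real (card (S \<inter> {a..b})) - d * (b - a)\<bar> \<le> e * (b - a))"

lemma uniform_density_tendsto:
  assumes "uniform_density S d"
  shows "((\<lambda>r. real (card (S \<inter> {- r .. r})) / (2 * r)) \<longlongrightarrow> d) at_top"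
proof (rule tendstoI)
  fix e :: real assume "e > 0"
  then obtain R where R: "R > 0"
    "\<And>a b. R \<le> b - a \<Longrightarrow> \<bar>real (card (S \<inter> {a..b})) - d * (b - a)\<bar> \<le> (e / 2) * (b - a)"
    using assms unfolding uniform_density_def by (meson half_gt_zero)
  show "\<forall>\<^sub>F r in at_top. dist (real (card (S \<inter> {- r .. r})) / (2 * r)) d < e"
    unfolding eventually_at_top_linorder
  proof (intro exI[of _ R] allI impI)
    fix r assume r: "R \<le> r"
    then have r0: "r > 0" using R(1) by simp
    have "\<bar>real (card (S \<inter> {-r..r})) - d * (2 * r)\<bar> \<le> (e / 2) * (2 * r)"
      using R(2)[of r "-r"] r r0 by simp
    then have "\<bar>real (card (S \<inter> {-r..r})) - d * (2 * r)\<bar> / (2 * r) \<le> e / 2"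
      using r0 by (simp add: divide_le_eq)
    also have "\<bar>real (card (S \<inter> {-r..r})) - d * (2 * r)\<bar> / (2 * r) =
        \<bar>real (card (S \<inter> {-r..r})) / (2 * r) - d\<bar>"
      using r0 by (simp add: abs_if field_simps)
    finally show "dist (real (card (S \<inter> {- r .. r})) / (2 * r)) d < e"
      using \<open>e > 0\<close> by (simp add: dist_real_def)
  qed
qed

lemma uniform_density_dens: "uniform_density S d \<Longrightarrow> dens S = d"
  unfolding dens_def by (rule tendsto_Lim) (auto intro: uniform_density_tendsto)

lemma uniform_density_mono:
  assumes "uniform_density S d" "uniform_density S' d'" "S \<subseteq> S'"
  shows "d \<le> d'"
proof (rule tendsto_le[OF _ uniform_density_tendsto[OF assms(2)] uniform_density_tendsto[OF assms(1)]])
  show "\<forall>\<^sub>F r in at_top. real (card (S \<inter> {- r .. r})) / (2 * r) \<le> real (card (S' \<inter> {- r .. r})) / (2 * r)"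
    unfolding eventually_at_top_linorder
  proof (intro exI[of _ 0] allI impI)
    fix r :: real assume "0 \<le> r"
    have "card (S \<inter> {- r .. r}) \<le> card (S' \<inter> {- r .. r})"
      using assms(2,3) unfolding uniform_density_def by (intro card_mono) auto
    then show "real (card (S \<inter> {- r .. r})) / (2 * r) \<le> real (card (S' \<inter> {- r .. r})) / (2 * r)"
      using \<open>0 \<le> r\<close> by (simp add: divide_right_mono)
  qed
qed simp

lemma uniform_density_empty: "uniform_density {} 0"
  unfolding uniform_density_def by (auto intro!: exI[of _ 1])

lemma uniform_density_nonneg: "uniform_density S d \<Longrightarrow> 0 \<le> d"
  using uniform_density_mono[OF uniform_density_empty] by blast

lemma uniform_density_affine:
  assumes "uniform_density S d" "c > 0"
  shows "uniform_density ((\<lambda>x. c * x + r) ` S) (d / c)"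
proof -
  have eq: "(\<lambda>x. c * x + r) ` S \<inter> {a..b} = (\<lambda>x. c * x + r) ` (S \<inter> {(a - r) / c..(b - r) / c})" for a b
    using assms(2) by (auto simp: field_simps)
  have inj: "inj_on (\<lambda>x. c * x + r) X" for X
    using assms(2) by (auto simp: inj_on_def)
  show ?thesis
    unfolding uniform_density_def eq card_image[OF inj]
  proof (intro conjI allI impI)
    fix a b show "finite ((\<lambda>x. c * x + r) ` (S \<inter> {(a - r) / c..(b - r) / c}))"
      using assms(1) unfolding uniform_density_def by blast
  next
    fix e :: real assume "e > 0"
    then obtain R where R: "R > 0"
      "\<And>a b. R \<le> b - a \<Longrightarrow> \<bar>real (card (S \<inter> {a..b})) - d * (b - a)\<bar> \<le> (e * c) * (b - a)"
      using assms unfolding uniform_density_def by (meson mult_pos_pos)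
    show "\<exists>R>0. \<forall>a b. R \<le> b - a \<longrightarrow>
        \<bar>real (card (S \<inter> {(a - r) / c..(b - r) / c})) - d / c * (b - a)\<bar> \<le> e * (b - a)"
    proof (intro exI[of _ "c * R"] conjI allI impI)
      fix a b assume "c * R \<le> b - a"
      then have "R \<le> (b - r) / c - (a - r) / c"
        using assms(2) by (simp add: field_simps)
      from R(2)[OF this] show "\<bar>real (card (S \<inter> {(a - r) / c..(b - r) / c})) - d / c * (b - a)\<bar> \<le> e * (b - a)"
        using assms(2) by (simp add: diff_divide_distrib[symmetric])
    qed (use R(1) assms(2) in simp)
  qed
qed

lemma uniform_density_Un:
  assumes "uniform_density S d" "uniform_density S' d'" "S \<inter> S' = {}"
  shows "uniform_density (S \<union> S') (d + d')"
  unfolding uniform_density_def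
proof (intro conjI allI impI)
  fix a b show "finite ((S \<union> S') \<inter> {a..b})"
    using assms(1,2) unfolding uniform_density_def Int_Un_distrib2 by blast
next
  fix e :: real assume "e > 0"
  then obtain R where R: "R > 0"
      "\<And>a b. R \<le> b - a \<Longrightarrow> \<bar>real (card (S \<inter> {a..b})) - d * (b - a)\<bar> \<le> (e / 2) * (b - a)"
    using assms unfolding uniform_density_def by (meson half_gt_zero)
  obtain R' where R': "R' > 0"
      "\<And>a b. R' \<le> b - a \<Longrightarrow> \<bar>real (card (S' \<inter> {a..b})) - d' * (b - a)\<bar> \<le> (e / 2) * (b - a)"
    using assms \<open>e > 0\<close> unfolding uniform_density_def by (meson half_gt_zero)
  show "\<exists>R>0. \<forall>a b. R \<le> b - a \<longrightarrow>
      \<bar>real (card ((S \<union> S') \<inter> {a..b})) - (d + d') * (b - a)\<bar> \<le> e * (b - a)"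
  proof (intro exI[of _ "max R R'"] conjI allI impI)
    fix a b assume ab: "max R R' \<le> b - a"
    have "card ((S \<union> S') \<inter> {a..b}) = card (S \<inter> {a..b}) + card (S' \<inter> {a..b})"
      unfolding Int_Un_distrib2 using assms unfolding uniform_density_def
      by (intro card_Un_disjoint) auto
    then show "\<bar>real (card ((S \<union> S') \<inter> {a..b})) - (d + d') * (b - a)\<bar> \<le> e * (b - a)"
      using R(2)[of b a] R'(2)[of b a] ab by (simp add: ring_distribs)
  qed (use R(1) in simp)
qed

lemma uniform_density_UN:
  assumes "finite K" "\<And>k. k \<in> K \<Longrightarrow> uniform_density (S k) (d k)" "disjoint_family_on S K"
  shows "uniform_density (\<Union>k\<in>K. S k) (\<Sum>k\<in>K. d k)"
  using assms
proof (induction K rule: finite_induct)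
  case (insert k K)
  have "S k \<inter> (\<Union>k\<in>K. S k) = {}"
    using insert.prems(2) insert.hyps(2) by (fastforce simp: disjoint_family_on_def)
  moreover have "disjoint_family_on S K"
    using insert.prems(2) by (auto simp: disjoint_family_on_def)
  ultimately show ?case
    using uniform_density_Un[of "S k" "d k" "\<Union>k\<in>K. S k" "\<Sum>k\<in>K. d k"] insert by simp
qed (simp add: uniform_density_empty)

text \<open>The translation may change from window to window; uniformity in the position absorbs
  this. It is the tool for passing to the hull.\<close>

lemma uniform_density_local:
  assumes "uniform_density S d" "\<And>a b. \<exists>\<tau>. S' \<inter> {a..b} = (\<lambda>x. x + \<tau>) ` S \<inter> {a..b}"
  shows "uniform_density S' d"
  unfolding uniform_density_def
proof (intro conjI allI impI)
  have shift: "uniform_density ((\<lambda>x. x + \<tau>) ` S) d" for \<tau>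
    using uniform_density_affine[OF assms(1), of 1 \<tau>] by simp
  fix a b show "finite (S' \<inter> {a..b})"
    using assms(2)[of a b] shift unfolding uniform_density_def by auto
next
  have eq: "\<exists>\<tau>. card (S' \<inter> {a..b}) = card (S \<inter> {a - \<tau>..b - \<tau>})" for a b
  proof -
    obtain \<tau> where "S' \<inter> {a..b} = (\<lambda>x. x + \<tau>) ` S \<inter> {a..b}" using assms(2) by blast
    also have "\<dots> = (\<lambda>x. x + \<tau>) ` (S \<inter> {a - \<tau>..b - \<tau>})" by auto
    finally have "card (S' \<inter> {a..b}) = card (S \<inter> {a - \<tau>..b - \<tau>})"
      by (simp add: card_image)
    then show ?thesis by blast
  qed
  fix e :: real assume "e > 0"
  then obtain R where R: "R > 0"
      "\<And>a b. R \<le> b - a \<Longrightarrow> \<bar>real (card (S \<inter> {a..b})) - d * (b - a)\<bar> \<le> e * (b - a)"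
    using assms unfolding uniform_density_def by meson
  show "\<exists>R>0. \<forall>a b. R \<le> b - a \<longrightarrow> \<bar>real (card (S' \<inter> {a..b})) - d * (b - a)\<bar> \<le> e * (b - a)"
  proof (intro exI[of _ R] conjI allI impI)
    fix a b assume ab: "R \<le> b - a"
    obtain \<tau> where "card (S' \<inter> {a..b}) = card (S \<inter> {a - \<tau>..b - \<tau>})" using eq by blast
    then show "\<bar>real (card (S' \<inter> {a..b})) - d * (b - a)\<bar> \<le> e * (b - a)"
      using R(2)[of "b - \<tau>" "a - \<tau>"] ab by simp
  qed (use R(1) in simp)
qed

section \<open>Convergence of perturbed stochastic recursions\<close>

text \<open>For \<open>s\<close> strictly between max(a, \<theta>) and 1 and \<open>D\<close> with C
  \<le> (s - a) D, the bound D s^k reproduces itself under the recursion.\<close>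

lemma contraction_tendsto_0:
  fixes x :: "nat \<Rightarrow> real"
  assumes "\<And>k. 0 \<le> x k" "\<And>k. x (Suc k) \<le> a * x k + C * \<theta> ^ k"
    and "0 \<le> a" "a < 1" "0 \<le> \<theta>" "\<theta> < 1" "0 \<le> C"
  shows "x \<longlonglongrightarrow> 0"
proof -
  obtain s where s: "max a \<theta> < s" "s < 1" using assms dense[of "max a \<theta>" 1] by auto
  define D where "D = max (x 0) (C / (s - a))"
  have sa: "s - a > 0" using s by simp
  have D: "x 0 \<le> D" "C / (s - a) \<le> D" by (auto simp: D_def)
  then have D0: "0 \<le> D" using assms(1)[of 0] by simp
  have D2: "C \<le> (s - a) * D" using D(2) sa by (simp add: pos_divide_le_eq mult.commute)
  have "x k \<le> D * s ^ k" for k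
  proof (induction k)
    case (Suc k)
    have "x (Suc k) \<le> a * (D * s ^ k) + C * s ^ k"
      using Suc.IH s assms(3,5,7)
      by (intro order_trans[OF assms(2)] add_mono mult_left_mono power_mono) auto
    also have "\<dots> \<le> a * (D * s ^ k) + (s - a) * D * s ^ k"
      using D2 s assms by (intro add_left_mono mult_right_mono) auto
    finally show ?case by (simp add: algebra_simps)
  qed (use D in simp)
  moreover have "(\<lambda>k. D * s ^ k) \<longlonglongrightarrow> 0"
    using s assms by (intro tendsto_mult_right_zero LIMSEQ_power_zero) auto
  ultimately show ?thesis
    using assms(1) by (intro tendsto_sandwich[of "\<lambda>_. 0" x sequentially "\<lambda>k. D * s ^ k"]) auto
qed

text \<open>
  The minimum over the states is nondecreasing, and the oscillation contracts by the factor
  \<open>1 - \<eta>\<close> up to the error.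
\<close>

lemma stochastic_recursion_tendsto:
  fixes v :: "nat \<Rightarrow> 'a::finite \<Rightarrow> real" and P :: "'a \<Rightarrow> 'a \<Rightarrow> real"
  assumes sum1: "\<And>a. (\<Sum>b\<in>UNIV. P a b) = 1"
    and P_ge: "\<And>a b. \<eta> \<le> P a b" and "\<eta> > 0"
    and lower: "\<And>k a. (\<Sum>b\<in>UNIV. P a b * v k b) \<le> v (Suc k) a"
    and upper: "\<And>k a. v (Suc k) a \<le> (\<Sum>b\<in>UNIV. P a b * v k b) + C * \<theta> ^ k"
    and C: "0 \<le> C" and \<theta>: "0 \<le> \<theta>" "\<theta> < 1"
  shows "\<exists>d. \<forall>a. (\<lambda>k. v k a) \<longlonglongrightarrow> d"
proof -
  define U L where "U k = Max (range (v k))" and "L k = Min (range (v k))" for k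
  have UL: "L k \<le> v k a" "v k a \<le> U k" for k a by (auto simp: U_def L_def)
  have P0: "0 \<le> P a b" for a b using P_ge[of a b] \<open>\<eta> > 0\<close> by linarith
  have L_step: "L k \<le> v (Suc k) a" for k a
  proof -
    have "L k = (\<Sum>b\<in>UNIV. P a b * L k)" by (simp add: sum_distrib_right[symmetric] sum1)
    also have "\<dots> \<le> (\<Sum>b\<in>UNIV. P a b * v k b)" by (intro sum_mono mult_left_mono UL P0)
    finally show ?thesis using lower[of a k] by linarith
  qed
  have U_step: "v (Suc k) a \<le> U k - \<eta> * (U k - L k) + C * \<theta> ^ k" for k a
  proof -
    \<comment> \<open>A state at which the minimum is attained has weight at least \<eta>, and pulls
      the average down by \<eta> times the oscillation.\<close>
    have "L k \<in> range (v k)" unfolding L_def by (intro Min_in) auto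
    then obtain b0 where b0: "v k b0 = L k" by auto
    have "\<eta> * (U k - L k) \<le> P a b0 * (U k - v k b0)"
      using b0 UL[of k b0] P_ge P0 by (intro mult_mono) auto
    also have "\<dots> \<le> (\<Sum>b\<in>UNIV. P a b * (U k - v k b))"
      using UL P0 by (intro member_le_sum) auto
    also have "\<dots> = U k - (\<Sum>b\<in>UNIV. P a b * v k b)"
      by (simp add: right_diff_distrib sum_subtractf sum_distrib_right[symmetric] sum1)
    finally show ?thesis using upper[of k a] by linarith
  qed
  have in_range: "U k \<in> range (v k)" "L k \<in> range (v k)" for k
    unfolding U_def L_def by (auto intro!: Max_in Min_in simp del: Max_in Min_in)
  have L_mono: "L k \<le> L (Suc k)" for k using in_range(2)[of "Suc k"] L_step by auto
  have U_Suc: "U (Suc k) \<le> U k - \<eta> * (U k - L k) + C * \<theta> ^ k" for k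
    using in_range(1)[of "Suc k"] U_step by auto
  have "\<eta> \<le> 1"
  proof -
    have "P a b \<le> (\<Sum>b\<in>UNIV. P a b)" for a b using P0 by (intro member_le_sum) auto
    then show ?thesis using P_ge sum1 by (metis order_trans)
  qed
  have LU: "L k \<le> U k" for k using UL order_trans by blast
  have osc: "(\<lambda>k. U k - L k) \<longlonglongrightarrow> 0"
  proof (rule contraction_tendsto_0)
    show "U (Suc k) - L (Suc k) \<le> (1 - \<eta>) * (U k - L k) + C * \<theta> ^ k" for k
      using U_Suc[of k] L_mono[of k] by (simp add: algebra_simps)
  qed (use LU \<open>\<eta> \<le> 1\<close> \<open>\<eta> > 0\<close> C \<theta> in auto)
  \<comment> \<open>U k + C \<theta>^k / (1 - \<theta>) is nonincreasing, because the remaining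
    geometric errors are already charged in it.\<close>
  have "L k \<le> U 0 + C / (1 - \<theta>)" for k
  proof -
    have "U k + C * \<theta> ^ k / (1 - \<theta>) \<le> U 0 + C / (1 - \<theta>)"
    proof (induction k)
      case (Suc k)
      have "U (Suc k) \<le> U k + C * \<theta> ^ k"
        using U_Suc[of k] LU[of k] \<open>\<eta> > 0\<close> mult_nonneg_nonneg[of \<eta> "U k - L k"] by linarith
      moreover have "C * \<theta> ^ k + C * \<theta> ^ Suc k / (1 - \<theta>) = C * \<theta> ^ k / (1 - \<theta>)"
        using \<theta> by (simp add: field_simps)
      ultimately show ?case using Suc.IH by linarith
    qed simp
    moreover have "0 \<le> C * \<theta> ^ k / (1 - \<theta>)" using C \<theta> by simp
    ultimately show ?thesis using LU[of k] by linarith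
  qed
  then obtain d where d: "L \<longlonglongrightarrow> d"
    using incseq_convergent[OF incseq_SucI[of L]] L_mono by blast
  have "U \<longlonglongrightarrow> d" using tendsto_add[OF osc d] by simp
  then have "(\<lambda>k. v k a) \<longlonglongrightarrow> d" for a
    using d UL by (intro tendsto_sandwich[of L "\<lambda>k. v k a" sequentially U]) auto
  then show ?thesis by blast
qed

section \<open>Counting pairs at a fixed distance in supertiles\<close>

definition pair_set :: "('a \<Rightarrow> real set) \<Rightarrow> 'a \<Rightarrow> 'a \<Rightarrow> real \<Rightarrow> real set" where
  "pair_set \<Lambda> i j z = {x \<in> \<Lambda> i. x + z \<in> \<Lambda> j}"

lemma tiles_separated: "tiles l I \<Lambda> \<Longrightarrow> separated (l $ i) (\<Lambda> i)"
proof -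
  assume t: "tiles l I \<Lambda>"
  have *: "l $ i \<le> y - x" if "x \<in> \<Lambda> i" "y \<in> \<Lambda> i" "x < y" for x y
  proof (rule ccontr)
    assume "\<not> l $ i \<le> y - x"
    then have y: "y \<in> tile l (i, x)" "y \<in> tile l (i, y)" using that by (auto simp: tile_def)
    have "y \<in> I" using t y(1) that(1) unfolding tiles_def by blast
    then have "\<exists>!p. p \<in> Sigma UNIV \<Lambda> \<and> y \<in> tile l p" using t unfolding tiles_def by blast
    then have "(i, x) = (i, y)" by (rule ex1E) (use y that in \<open>metis SigmaI UNIV_I\<close>)
    then show False using that by simp
  qed
  show ?thesis unfolding separated_def using * by (metis abs_minus_commute abs_ge_self linorder_less_linear order_trans)
qed

context inflation_rule
begin

definition pair_count :: "'a \<Rightarrow> 'a \<Rightarrow> real \<Rightarrow> nat \<Rightarrow> 'a \<Rightarrow> nat" where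
  "pair_count i j z m b = card (pair_set (ptch m b) i j z)"

lemma tiles_inflate_pow: "tiles l I \<Lambda> \<Longrightarrow> \<exists>I'. tiles l I' ((infl ^^ m) \<Lambda>)"
  by (induction m) (auto intro: tiles_inflate)

text \<open>A pair whose first point lies in the supertile but whose second does not starts within
  |z| of the end that it crosses. First points are l_i-separated, so the error is independent of the
  order m.\<close>

lemma card_pair_set_supertile:
  fixes z :: real
  assumes "tiles l J \<Lambda>" "x \<in> \<Lambda> b"
    and P_def: "P = pair_set ((infl ^^ m) \<Lambda>) i j z"
  shows "finite (P \<inter> supertile m (b, x))"
    and "real (pair_count i j z m b) \<le> real (card (P \<inter> supertile m (b, x)))"
    and "real (card (P \<inter> supertile m (b, x))) \<le> real (pair_count i j z m b) + (\<bar>z\<bar> / l $ i + 1)"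
proof -
  let ?I = "supertile m (b, x)" and ?\<Lambda> = "(infl ^^ m) \<Lambda>"
  define A where "A = {y \<in> ?\<Lambda> i \<inter> ?I. y + z \<in> ?\<Lambda> j \<inter> ?I}"
  have A_eq: "A = (+) (lam ^ m * x) ` pair_set (ptch m b) i j z"
    unfolding A_def inflate_pow_Int_supertile[OF assms(1,2)] pair_set_def
    by (auto simp: image_iff)
  then have cardA: "card A = pair_count i j z m b"
    by (simp add: card_image pair_count_def)
  have finA: "finite A"
    unfolding A_eq pair_set_def using finite_patch[of \<rho> lam l m b i] by (intro finite_imageI) simp
  define E where "E = (P \<inter> ?I) - A"
  have sep: "separated (l $ i) (?\<Lambda> i)"
    using tiles_inflate_pow[OF assms(1), of m] tiles_separated by blast
  have E_sub: "E \<subseteq> ?\<Lambda> i" by (auto simp: E_def P_def pair_set_def)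
  \<comment> \<open>For z \<ge> 0 pairs escape over the right end, for z < 0 over the left
    end.\<close>
  define \<alpha> where "\<alpha> = (if z \<ge> 0 then lam ^ m * (x + l $ b) - z else lam ^ m * x)"
  have "E \<subseteq> {\<alpha>..\<alpha> + \<bar>z\<bar>}"
    by (auto simp: E_def P_def pair_set_def A_def supertile_def \<alpha>_def)
  note E = separated_card[OF separated_subset[OF sep E_sub] l_pos this abs_ge_zero]
  have PI: "P \<inter> ?I = A \<union> E" by (auto simp: E_def A_def P_def pair_set_def)
  then show "finite (P \<inter> ?I)" using E finA by simp
  have "card (P \<inter> ?I) = card A + card E"
    unfolding PI using finA E(1) by (intro card_Un_disjoint) (auto simp: E_def)
  then show "real (pair_count i j z m b) \<le> real (card (P \<inter> ?I))"
    "real (card (P \<inter> ?I)) \<le> real (pair_count i j z m b) + (\<bar>z\<bar> / l $ i + 1)"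
    using E(2) cardA by auto
qed

lemma disjoint_supertiles:
  "tiles l J \<Lambda> \<Longrightarrow> F \<subseteq> Sigma UNIV \<Lambda> \<Longrightarrow> disjoint_family_on (supertile m) F"
  unfolding disjoint_family_on_def using supertile_unique by blast

lemma finite_Sigma_patch: "finite (Sigma UNIV (ptch n a))"
  using finite_patch by (intro finite_SigmaI) auto

text \<open>The first points are sorted by the order-m supertiles of the large patch. The number of
  these depends on n and a only, so the error stays bounded as m grows.\<close>

lemma pair_count_add:
  shows "(\<Sum>b\<in>UNIV. real (card (ptch n a b)) * real (pair_count i j z m b)) \<le>
      real (pair_count i j z (m + n) a)" (is "?S \<le> _")
    and "real (pair_count i j z (m + n) a) \<le>
      (\<Sum>b\<in>UNIV. real (card (ptch n a b)) * real (pair_count i j z m b)) +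
      real (card (Sigma UNIV (ptch n a))) * (\<bar>z\<bar> / l $ i + 1)"
proof -
  let ?T = "Sigma UNIV (ptch n a)"
  define P where "P = pair_set (ptch (m + n) a) i j z"
  have P_eq: "P = pair_set ((infl ^^ m) (ptch n a)) i j z"
    by (simp add: P_def patch_add)
  have "P \<subseteq> (\<Union>p\<in>?T. supertile m p)"
  proof
    fix y assume "y \<in> P"
    then obtain x t c where "y = lam ^ m * x + t" "x \<in> ptch n a c" "t \<in> ptch m c i"
      unfolding P_eq pair_set_def mem_Collect_eq mem_inflate_pow_iff by blast
    then show "y \<in> (\<Union>p\<in>?T. supertile m p)"
      using add_patch_mem_supertile by (intro UN_I[of "(c, x)"]) auto
  qed
  then have "P = (\<Union>p\<in>?T. P \<inter> supertile m p)" by blast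
  moreover have "card (\<Union>p\<in>?T. P \<inter> supertile m p) = (\<Sum>p\<in>?T. card (P \<inter> supertile m p))"
  proof (rule card_UN_disjoint)
    show "\<forall>p\<in>?T. finite (P \<inter> supertile m p)"
      using card_pair_set_supertile(1)[OF tiles_patch _ P_eq] by auto
    show "\<forall>p\<in>?T. \<forall>q\<in>?T. p \<noteq> q \<longrightarrow> (P \<inter> supertile m p) \<inter> (P \<inter> supertile m q) = {}"
      using supertile_unique[OF tiles_patch] by blast
  qed (rule finite_Sigma_patch)
  ultimately have card: "real (pair_count i j z (m + n) a) = (\<Sum>p\<in>?T. real (card (P \<inter> supertile m p)))"
    by (simp add: pair_count_def P_def[symmetric])
  have S_eq: "?S = (\<Sum>p\<in>?T. real (pair_count i j z m (fst p)))"
    using sum.Sigma[of UNIV "ptch n a" "\<lambda>b x. real (pair_count i j z m b)"] finite_patch[of \<rho> lam l n a]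
    by (simp add: case_prod_unfold)
  have b: "real (pair_count i j z m (fst p)) \<le> real (card (P \<inter> supertile m p))"
      "real (card (P \<inter> supertile m p)) \<le> real (pair_count i j z m (fst p)) + (\<bar>z\<bar> / l $ i + 1)" if "p \<in> ?T" for p
    using card_pair_set_supertile(2,3)[OF tiles_patch _ P_eq, of "snd p" "fst p"] that by auto
  show "?S \<le> real (pair_count i j z (m + n) a)"
    unfolding card S_eq using b by (intro sum_mono) auto
  have "real (pair_count i j z (m + n) a) \<le> (\<Sum>p\<in>?T. real (pair_count i j z m (fst p)) + (\<bar>z\<bar> / l $ i + 1))"
    unfolding card using b by (intro sum_mono) auto
  then show "real (pair_count i j z (m + n) a) \<le>
      ?S + real (card (Sigma UNIV (ptch n a))) * (\<bar>z\<bar> / l $ i + 1)"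
    unfolding S_eq by (simp add: sum.distrib)
qed

lemma measure_supertile: "measure lborel (supertile m p) = lam ^ m * l $ fst p"
  using l_pos[of "fst p"] lam_power_pos[of m] by (simp add: supertile_def algebra_simps)

lemma measure_UN_supertile:
  assumes "tiles l J \<Lambda>" "F \<subseteq> Sigma UNIV \<Lambda>" "finite F"
  shows "measure lborel (\<Union>p\<in>F. supertile m p) = (\<Sum>p\<in>F. lam ^ m * l $ fst p)"
proof -
  have "measure lborel (\<Union>p\<in>F. supertile m p) = (\<Sum>p\<in>F. measure lborel (supertile m p))"
  proof (rule measure_finite_Union)
    show "disjoint_family_on (supertile m) F" using disjoint_supertiles assms by blast
    show "emeasure lborel (supertile m p) \<noteq> \<infinity>" for p
      unfolding supertile_def
      by (subst emeasure_lborel_Ico) (use lam_power_pos[of m] l_pos[of "fst p"] in \<open>auto simp: algebra_simps\<close>)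
  qed (use assms in \<open>auto simp: supertile_def\<close>)
  then show ?thesis by (simp add: measure_supertile)
qed

text \<open>Both sides are the Lebesgue measure of the interval that the patch tiles. The identity
  makes the weights in \<open>pair_count_limit\<close> stochastic.\<close>

lemma patch_length: "(\<Sum>b\<in>UNIV. real (card (ptch n a b)) * l $ b) = lam ^ n * l $ a"
proof -
  let ?T = "Sigma UNIV (ptch n a)"
  have "(\<Union>p\<in>?T. supertile 0 p) = {0 ..< lam ^ n * l $ a}"
  proof (intro equalityI subsetI)
    fix y assume "y \<in> {0 ..< lam ^ n * l $ a}"
    then have "\<exists>!p. p \<in> ?T \<and> y \<in> tile l p" using tiles_patch[of n a] unfolding tiles_def by blast
    then show "y \<in> (\<Union>p\<in>?T. supertile 0 p)" unfolding UN_iff mem_supertile_iff by auto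
  next
    fix y assume "y \<in> (\<Union>p\<in>?T. supertile 0 p)"
    then obtain p where "p \<in> ?T" "y \<in> tile l p" unfolding UN_iff mem_supertile_iff by auto
    then show "y \<in> {0 ..< lam ^ n * l $ a}"
      using tiles_patch[of n a] unfolding tiles_def by blast
  qed
  then have "lam ^ n * l $ a = (\<Sum>p\<in>?T. l $ fst p)"
    using measure_UN_supertile[OF tiles_patch order_refl finite_Sigma_patch, of 0 n a]
      lam_power_pos[of n] l_pos[of a] by simp
  also have "\<dots> = (\<Sum>b\<in>UNIV. real (card (ptch n a b)) * l $ b)"
    using sum.Sigma[of UNIV "ptch n a" "\<lambda>b x. l $ b"] finite_patch[of \<rho> lam l n a]
    by (simp add: case_prod_unfold)
  finally show ?thesis ..
qed

end

section \<open>Pair correlations of a fixed point\<close>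

text \<open>\<open>N\<close> is a period of \<open>\<Lambda>0\<close>, and \<open>q\<close> a
  primitivity exponent in geometric form: every prototile occurs in every patch of order
  \<open>q\<close>.\<close>

locale inflation_fixed_point = inflation_rule +
  fixes \<Lambda>0 :: "'a \<Rightarrow> real set" and N q :: nat
  assumes tiles_UNIV: "tiles l UNIV \<Lambda>0"
    and N_pos: "N \<ge> 1"
    and fixed_point: "(infl ^^ N) \<Lambda>0 = \<Lambda>0"
    and q_pos: "q \<ge> 1"
    and patch_q_nonempty: "ptch q a b \<noteq> {}"
begin

lemma inflate_pow_fixed: "(infl ^^ (N * k)) \<Lambda>0 = \<Lambda>0"
proof (induction k)
  case (Suc k)
  then show ?case by (simp add: funpow_add fixed_point)
qed simp

lemma patch_mult_nonempty: "ptch (q * Suc n) a b \<noteq> {}"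
proof (induction n arbitrary: b)
  case 0
  then show ?case using patch_q_nonempty by simp
next
  case (Suc n)
  obtain x t where x: "x \<in> ptch (q * Suc n) a b" and t: "t \<in> ptch q b b"
    using Suc.IH patch_q_nonempty by blast

  have "lam ^ q * x + t \<in> (infl ^^ q) (ptch (q * Suc n) a) b"
    unfolding mem_inflate_pow_iff using x t by blast
  then show ?case using patch_add[of \<rho> lam l q "q * Suc n" a] by auto
qed

text \<open>The weight \<open>P a b\<close> is the share of the order-Q patch of a that is covered
  by tiles of type b. \<open>Q\<close> is a multiple of \<open>q\<close> to make all weights
  positive, and of \<open>N\<close> so that the orders Q k leave \<open>\<Lambda>0\<close> fixed.
  The bounded error of one step, divided by the length of the patch, decays like lam^(-Q k).\<close>

lemma pair_count_limit:
  "\<exists>d. \<forall>a. (\<lambda>k. real (pair_count i j z (q * N * k) a) / (lam ^ (q * N * k) * l $ a)) \<longlonglongrightarrow> d"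
proof -
  define Q where "Q = q * N"
  define K where "K = \<bar>z\<bar> / l $ i + 1"
  define P where "P a b = real (card (ptch Q a b)) * l $ b / (lam ^ Q * l $ a)" for a b
  define \<eta> where "\<eta> = Min (range (\<lambda>(a, b). P a b))"
  define C where "C = Max (range (\<lambda>a. real (card (Sigma UNIV (ptch Q a))) * K / (lam ^ Q * l $ a)))"
  have K: "K > 0" using l_pos[of i] by (auto simp: K_def intro!: add_nonneg_pos)
  have P_pos: "P a b > 0" for a b
  proof -
    have "ptch Q a b \<noteq> {}" using patch_mult_nonempty[of "N - 1" a b] N_pos by (simp add: Q_def)
    then have "card (ptch Q a b) > 0" by (simp add: card_gt_0_iff finite_patch)
    then show ?thesis using l_pos[of a] l_pos[of b] lam_power_pos[of Q] by (simp add: P_def)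
  qed
  have "\<exists>d. \<forall>a. (\<lambda>k. real (pair_count i j z (Q * k) a) / (lam ^ (Q * k) * l $ a)) \<longlonglongrightarrow> d"
  proof (rule stochastic_recursion_tendsto)
    show "(\<Sum>b\<in>UNIV. P a b) = 1" for a
      using lam_gt_1 l_pos[of a]
      by (simp add: P_def sum_divide_distrib[symmetric] patch_length)
    show "\<eta> \<le> P a b" for a b unfolding \<eta>_def by (intro Min_le) auto
    show "\<eta> > 0" unfolding \<eta>_def using P_pos by (subst Min_gr_iff) auto
    have eq: "(\<Sum>b\<in>UNIV. P a b * (real (pair_count i j z (Q * k) b) / (lam ^ (Q * k) * l $ b))) =
        (\<Sum>b\<in>UNIV. real (card (ptch Q a b)) * real (pair_count i j z (Q * k) b)) / (lam ^ (Q * Suc k) * l $ a)" for a k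
      unfolding sum_divide_distrib
    proof (rule sum.cong)
      fix b
      show "P a b * (real (pair_count i j z (Q * k) b) / (lam ^ (Q * k) * l $ b)) =
        real (card (ptch Q a b)) * real (pair_count i j z (Q * k) b) / (lam ^ (Q * Suc k) * l $ a)"
        using l_pos[of b] by (simp add: P_def power_add)
    qed simp
    have add: "Q * Suc k = Q * k + Q" for k by simp
    show "(\<Sum>b\<in>UNIV. P a b * (real (pair_count i j z (Q * k) b) / (lam ^ (Q * k) * l $ b)))
        \<le> real (pair_count i j z (Q * Suc k) a) / (lam ^ (Q * Suc k) * l $ a)" for k a
      unfolding eq add using pair_count_add(1)[of Q a i j z "Q * k"] l_pos[of a] lam_power_pos
      by (intro divide_right_mono) (auto simp: less_imp_le)
    show "real (pair_count i j z (Q * Suc k) a) / (lam ^ (Q * Suc k) * l $ a) \<le>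
      (\<Sum>b\<in>UNIV. P a b * (real (pair_count i j z (Q * k) b) / (lam ^ (Q * k) * l $ b))) + C * (1 / lam ^ Q) ^ k" for k a
    proof -
      have "real (pair_count i j z (Q * Suc k) a) / (lam ^ (Q * Suc k) * l $ a) \<le>
        ((\<Sum>b\<in>UNIV. real (card (ptch Q a b)) * real (pair_count i j z (Q * k) b)) +
         real (card (Sigma UNIV (ptch Q a))) * K) / (lam ^ (Q * Suc k) * l $ a)"
        unfolding add K_def using pair_count_add(2)[of i j z "Q * k" Q a] l_pos[of a] lam_power_pos
        by (intro divide_right_mono) (auto simp: less_imp_le)
      also have "\<dots> = (\<Sum>b\<in>UNIV. P a b * (real (pair_count i j z (Q * k) b) / (lam ^ (Q * k) * l $ b))) +
          (real (card (Sigma UNIV (ptch Q a))) * K / (lam ^ Q * l $ a)) * (1 / lam ^ Q) ^ k"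
        unfolding eq by (simp add: add_divide_distrib power_add power_mult power_one_over field_simps)
      also have "\<dots> \<le> (\<Sum>b\<in>UNIV. P a b * (real (pair_count i j z (Q * k) b) / (lam ^ (Q * k) * l $ b))) +
          C * (1 / lam ^ Q) ^ k"
        unfolding C_def using lam_power_pos[of Q] by (intro add_left_mono mult_right_mono Max_ge) auto
      finally show ?thesis .
    qed
    have "0 \<le> real (card (Sigma UNIV (ptch Q a))) * K / (lam ^ Q * l $ a)" for a
      using K l_pos[of a] lam_power_pos[of Q] by simp
    then show "0 \<le> C" unfolding C_def by (subst Max_ge_iff) auto
    show "0 \<le> 1 / lam ^ Q" using lam_power_pos[of Q] by simp
    show "1 / lam ^ Q < 1" using lam_gt_1 q_pos N_pos by (simp add: Q_def)
  qed
  then show ?thesis by (simp add: Q_def)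
qed

section \<open>From supertiles to arbitrary windows\<close>

lemma pair_set_Int_finite:
  assumes "tiles l J \<Lambda>"
  shows "finite (pair_set \<Lambda> i j z \<inter> {a..b})"
proof (cases "a \<le> b")
  case True
  have "pair_set \<Lambda> i j z \<inter> {a..b} \<subseteq> \<Lambda> i" by (auto simp: pair_set_def)
  then show ?thesis
    using separated_card(1)[OF separated_subset[OF tiles_separated[OF assms]] l_pos, of _ i a "b - a"] True
    by simp
qed simp

text \<open>Supertiles inside the window contribute the relative error \<epsilon>. The rest of the
  window lies in two end strips of length \<open>W\<close>, the maximal supertile length, which cost
  at most 2 W in length and W / l_i + 1 points each.\<close>

lemma card_pair_set_window:
  assumes m: "N dvd m"
    and pc: "\<And>b. \<bar>real (pair_count i j z m b) - d * (lam ^ m * l $ b)\<bar> + (\<bar>z\<bar> / l $ i + 1) \<le> \<epsilon> * (lam ^ m * l $ b)"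
    and W: "\<And>b. lam ^ m * l $ b \<le> W" and ab: "a \<le> b" and "\<epsilon> \<ge> 0"
  shows "\<bar>real (card (pair_set \<Lambda>0 i j z \<inter> {a..b})) - d * (b - a)\<bar> \<le>
     \<epsilon> * (b - a) + (\<bar>d\<bar> * (2 * W) + 2 * (W / l $ i + 1))"
proof -
  define P where "P = pair_set \<Lambda>0 i j z"
  define F where "F = {p \<in> Sigma UNIV \<Lambda>0. supertile m p \<subseteq> {a..b}}"
  define G where "G = (\<Union>p\<in>F. supertile m p)"
  define E where "E = P \<inter> {a..b} - G"
  define len where "len p = lam ^ m * l $ fst p" for p :: "'a \<times> real"
  have fixm: "(infl ^^ m) \<Lambda>0 = \<Lambda>0" using m inflate_pow_fixed by (auto elim: dvdE)
  have W0: "W \<ge> 0" using W[of i] l_pos[of i] lam_power_pos[of m] by (meson less_imp_le mult_pos_pos order_trans)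
  have sep: "separated (l $ j) (\<Lambda>0 j)" for j using tiles_separated[OF tiles_UNIV] .
  have F_sub: "F \<subseteq> Sigma UNIV \<Lambda>0" by (auto simp: F_def)
  have finF: "finite F"
  proof (rule finite_subset)
    show "F \<subseteq> (SIGMA j:UNIV. \<Lambda>0 j \<inter> {a / lam ^ m..a / lam ^ m + (b - a) / lam ^ m})"
    proof
      fix p assume p: "p \<in> F"
      have "lam ^ m * snd p \<in> supertile m p"
        using l_pos[of "fst p"] lam_power_pos[of m] by (simp add: supertile_def)
      then have "lam ^ m * snd p \<in> {a..b}" using p by (auto simp: F_def)
      then show "p \<in> (SIGMA j:UNIV. \<Lambda>0 j \<inter> {a / lam ^ m..a / lam ^ m + (b - a) / lam ^ m})"
        using p lam_power_pos[of m] by (auto simp: F_def field_simps add_divide_distrib[symmetric])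
    qed
    have "finite (\<Lambda>0 j \<inter> {a / lam ^ m..a / lam ^ m + (b - a) / lam ^ m})" for j
      using separated_card(1)[OF separated_subset[OF sep[of j]] l_pos[of j],
          of "\<Lambda>0 j \<inter> {a / lam ^ m..a / lam ^ m + (b - a) / lam ^ m}" "a / lam ^ m" "(b - a) / lam ^ m"]
        ab lam_power_pos[of m] by simp
    then show "finite (SIGMA j:UNIV. \<Lambda>0 j \<inter> {a / lam ^ m..a / lam ^ m + (b - a) / lam ^ m})"
      by (intro finite_SigmaI) auto
  qed
  have G_sub: "G \<subseteq> {a..b}" by (auto simp: G_def F_def)
  have st: "finite (P \<inter> supertile m p)"
    "\<bar>real (card (P \<inter> supertile m p)) - d * len p\<bar> \<le> \<epsilon> * len p" if "p \<in> F" for p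
  proof -
    obtain c x where p: "p = (c, x)" "x \<in> \<Lambda>0 c" using \<open>p \<in> F\<close> by (cases p) (auto simp: F_def)
    note c = card_pair_set_supertile[OF tiles_UNIV p(2) refl, where m = m and i = i and j = j and z = z, unfolded fixm, folded P_def p(1)]
    show "finite (P \<inter> supertile m p)" by (rule c(1))
    show "\<bar>real (card (P \<inter> supertile m p)) - d * len p\<bar> \<le> \<epsilon> * len p"
      using c(2,3) pc[of c] by (simp add: len_def p(1))
  qed
  have uncovered: "y \<in> {a..a + W} \<union> {b - W..b - W + W}" if "y \<in> {a..b} - G" for y
  proof -
    have "\<exists>!p. p \<in> Sigma UNIV \<Lambda>0 \<and> y / lam ^ m \<in> tile l p"
      using tiles_UNIV unfolding tiles_def by blast
    then obtain p where p: "p \<in> Sigma UNIV \<Lambda>0" "y \<in> supertile m p"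
      unfolding mem_supertile_iff by blast
    then have "\<not> supertile m p \<subseteq> {a..b}" using that by (auto simp: G_def F_def)
    then show ?thesis
      using p(2) that W[of "fst p"] unfolding supertile_def
      by (force simp: distrib_left)
  qed
  have E_bound: "finite E \<and> real (card E) \<le> 2 * (W / l $ i + 1)"
  proof -
    have sub: "E \<inter> X \<subseteq> \<Lambda>0 i" for X by (auto simp: E_def P_def pair_set_def)
    have e1: "finite (E \<inter> {a..a + W})" "real (card (E \<inter> {a..a + W})) \<le> W / l $ i + 1"
      using separated_card[OF separated_subset[OF sep sub] l_pos _ W0, of "{a..a + W}" a] by auto
    have e2: "finite (E \<inter> {b - W..b - W + W})" "real (card (E \<inter> {b - W..b - W + W})) \<le> W / l $ i + 1"
      using separated_card[OF separated_subset[OF sep sub] l_pos _ W0, of "{b - W..b - W + W}" "b - W"] by auto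
    have "y \<in> {a..a + W} \<union> {b - W..b - W + W}" if "y \<in> E" for y
      using uncovered[of y] that unfolding E_def by blast
    then have "E = (E \<inter> {a..a + W}) \<union> (E \<inter> {b - W..b - W + W})" by blast
    then have "card E \<le> card (E \<inter> {a..a + W}) + card (E \<inter> {b - W..b - W + W})" "finite E"
      using card_Un_le[of "E \<inter> {a..a + W}" "E \<inter> {b - W..b - W + W}"] e1 e2 finite_UnI by metis+
    then have "finite E" "real (card E) \<le> (W / l $ i + 1) + (W / l $ i + 1)"
      using e1(2) e2(2) by linarith+
    then show ?thesis by simp
  qed
  have measG: "measure lborel G = (\<Sum>p\<in>F. len p)"
    unfolding G_def len_def by (rule measure_UN_supertile[OF tiles_UNIV F_sub finF])
  have G_sets: "G \<in> sets borel" unfolding G_def using finF by (intro sets.finite_UN) (auto simp: supertile_def)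
  have Icc: "{u..v} \<in> fmeasurable lborel" for u v :: real
    by (auto simp: fmeasurable_def emeasure_lborel_Icc_eq)
  have sum_le: "(\<Sum>p\<in>F. len p) \<le> b - a"
  proof -
    have "measure lborel G \<le> measure lborel {a..b}"
      using G_sub G_sets Icc by (intro measure_mono_fmeasurable) auto
    then show ?thesis using measG ab by simp
  qed
  have sum_ge: "b - a - 2 * W \<le> (\<Sum>p\<in>F. len p)"
  proof -
    have G_fin: "G \<in> fmeasurable lborel"
      by (rule fmeasurableI2[OF Icc G_sub]) (use G_sets in simp)
    have "{a..b} \<subseteq> G \<union> ({a..a + W} \<union> {b - W..b - W + W})" using uncovered by blast
    then have "measure lborel {a..b} \<le> measure lborel (G \<union> ({a..a + W} \<union> {b - W..b - W + W}))"
      by (rule measure_mono_fmeasurable) (simp, rule fmeasurable.Un[OF G_fin fmeasurable.Un[OF Icc Icc]])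
    also have "\<dots> \<le> measure lborel G + measure lborel ({a..a + W} \<union> {b - W..b - W + W})"
      by (rule measure_Un_le) (use G_sets in auto)
    also have "\<dots> \<le> measure lborel G + (measure lborel {a..a + W} + measure lborel {b - W..b - W + W})"
      by (rule add_left_mono, rule measure_Un_le) auto
    finally show ?thesis using measG ab W0 by simp
  qed
  have "card (P \<inter> {a..b}) = card (\<Union>p\<in>F. P \<inter> supertile m p) + card E"
  proof -
    have "P \<inter> {a..b} = (\<Union>p\<in>F. P \<inter> supertile m p) \<union> E"
      using G_sub by (auto simp: E_def G_def)
    moreover have "card ((\<Union>p\<in>F. P \<inter> supertile m p) \<union> E) = card (\<Union>p\<in>F. P \<inter> supertile m p) + card E"
      by (rule card_Un_disjoint[OF finite_UN_I[OF finF st(1)]]) (use E_bound in \<open>auto simp: E_def G_def\<close>)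
    ultimately show ?thesis by simp
  qed
  moreover have "card (\<Union>p\<in>F. P \<inter> supertile m p) = (\<Sum>p\<in>F. card (P \<inter> supertile m p))"
  proof (rule card_UN_disjoint[OF finF])
    show "\<forall>p\<in>F. finite (P \<inter> supertile m p)" using st by blast
    show "\<forall>p\<in>F. \<forall>r\<in>F. p \<noteq> r \<longrightarrow> (P \<inter> supertile m p) \<inter> (P \<inter> supertile m r) = {}"
      using supertile_unique[OF tiles_UNIV] F_sub by blast
  qed
  ultimately have card: "real (card (P \<inter> {a..b})) = (\<Sum>p\<in>F. real (card (P \<inter> supertile m p))) + real (card E)"
    by simp
  have "\<bar>real (card (P \<inter> {a..b})) - d * (b - a)\<bar> =
      \<bar>(\<Sum>p\<in>F. real (card (P \<inter> supertile m p)) - d * len p) + d * ((\<Sum>p\<in>F. len p) - (b - a)) + real (card E)\<bar>"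
    unfolding card by (simp add: sum_subtractf sum_distrib_left[symmetric] algebra_simps)
  also have "\<dots> \<le> \<bar>\<Sum>p\<in>F. real (card (P \<inter> supertile m p)) - d * len p\<bar> + \<bar>d * ((\<Sum>p\<in>F. len p) - (b - a))\<bar> + real (card E)"
    by linarith
  also have "\<dots> \<le> \<epsilon> * (b - a) + \<bar>d\<bar> * (2 * W) + 2 * (W / l $ i + 1)"
  proof (intro add_mono)
    have "\<bar>\<Sum>p\<in>F. real (card (P \<inter> supertile m p)) - d * len p\<bar> \<le> (\<Sum>p\<in>F. \<epsilon> * len p)"
      using st(2) by (intro order_trans[OF sum_abs] sum_mono)
    also have "\<dots> \<le> \<epsilon> * (b - a)"
      using sum_le \<open>\<epsilon> \<ge> 0\<close> by (simp add: sum_distrib_left[symmetric] mult_left_mono)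
    finally show "\<bar>\<Sum>p\<in>F. real (card (P \<inter> supertile m p)) - d * len p\<bar> \<le> \<epsilon> * (b - a)" .
    show "\<bar>d * ((\<Sum>p\<in>F. len p) - (b - a))\<bar> \<le> \<bar>d\<bar> * (2 * W)"
      unfolding abs_mult using sum_le sum_ge by (intro mult_left_mono) auto
    show "real (card E) \<le> 2 * (W / l $ i + 1)" using E_bound by blast
  qed
  finally show ?thesis by (simp add: P_def add.assoc)
qed

lemma uniform_density_pair_set_exists: "\<exists>d. uniform_density (pair_set \<Lambda>0 i j z) d"
proof -
  obtain d where d: "\<And>a. (\<lambda>k. real (pair_count i j z (q * N * k) a) / (lam ^ (q * N * k) * l $ a)) \<longlonglongrightarrow> d"
    using pair_count_limit by blast
  define K where "K = \<bar>z\<bar> / l $ i + 1"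
  have "uniform_density (pair_set \<Lambda>0 i j z) d"
    unfolding uniform_density_def
  proof (intro conjI allI impI)
    fix a b show "finite (pair_set \<Lambda>0 i j z \<inter> {a..b})" by (rule pair_set_Int_finite[OF tiles_UNIV])
  next
    fix e :: real assume e: "e > 0"
    have "\<forall>\<^sub>F k in sequentially. \<forall>b. \<bar>real (pair_count i j z (q * N * k) b) - d * (lam ^ (q * N * k) * l $ b)\<bar> + K
        \<le> e / 2 * (lam ^ (q * N * k) * l $ b)"
    proof (rule eventually_all_finite)
      fix b
      have "(\<lambda>k. K / l $ b * (1 / lam ^ (q * N)) ^ k) \<longlonglongrightarrow> K / l $ b * 0"
        using lam_gt_1 q_pos N_pos by (intro tendsto_mult_left LIMSEQ_power_zero) simp
      then have "\<forall>\<^sub>F k in sequentially. K / l $ b * (1 / lam ^ (q * N)) ^ k < e / 4"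
        using e by (intro order_tendstoD(2)) auto
      moreover have "\<forall>\<^sub>F k in sequentially. \<bar>real (pair_count i j z (q * N * k) b) / (lam ^ (q * N * k) * l $ b) - d\<bar> < e / 4"
        using tendstoD[OF d[of b], of "e / 4"] e by (simp add: dist_real_def)
      ultimately show "\<forall>\<^sub>F k in sequentially. \<bar>real (pair_count i j z (q * N * k) b) - d * (lam ^ (q * N * k) * l $ b)\<bar> + K
        \<le> e / 2 * (lam ^ (q * N * k) * l $ b)"
      proof eventually_elim
        case (elim k)
        define L where "L = lam ^ (q * N * k) * l $ b"
        have L: "L > 0" using lam_power_pos l_pos by (simp add: L_def)
        have "K / l $ b * (1 / lam ^ (q * N)) ^ k = K / L"
          by (simp add: L_def power_mult power_one_over)
        then have "K / L < e / 4" using elim(1) by simp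
        then have "K < e / 4 * L" using L by (simp add: pos_divide_less_eq)
        moreover have "real (pair_count i j z (q * N * k) b) / L - d = (real (pair_count i j z (q * N * k) b) - d * L) / L"
          using L by (simp add: field_simps)
        then have "\<bar>real (pair_count i j z (q * N * k) b) - d * L\<bar> / L < e / 4"
          using elim(2) L by (simp add: L_def[symmetric] abs_divide)
        then have "\<bar>real (pair_count i j z (q * N * k) b) - d * L\<bar> < e / 4 * L"
          using L by (simp add: pos_divide_less_eq)
        ultimately show ?case unfolding L_def[symmetric] by simp
      qed
    qed
    from eventually_happens'[OF sequentially_bot this]
    obtain k where k: "\<And>b. \<bar>real (pair_count i j z (q * N * k) b) - d * (lam ^ (q * N * k) * l $ b)\<bar> + K
        \<le> e / 2 * (lam ^ (q * N * k) * l $ b)"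
      by blast
    define W where "W = Max (range (\<lambda>b. lam ^ (q * N * k) * l $ b))"
    have W: "lam ^ (q * N * k) * l $ b \<le> W" for b unfolding W_def by (intro Max_ge) auto
    have W0: "W > 0" using W[of i] l_pos[of i] lam_power_pos[of "q * N * k"] by (meson less_le_trans mult_pos_pos)
    define B where "B = \<bar>d\<bar> * (2 * W) + 2 * (W / l $ i + 1)"
    have B: "B > 0" using W0 l_pos[of i] by (auto simp: B_def intro!: add_nonneg_pos mult_nonneg_nonneg)
    show "\<exists>R>0. \<forall>a b. R \<le> b - a \<longrightarrow> \<bar>real (card (pair_set \<Lambda>0 i j z \<inter> {a..b})) - d * (b - a)\<bar> \<le> e * (b - a)"
    \<comment> \<open>With the order k fixed, \<open>B\<close> is a constant of that order; in
      windows longer than 2 B / e it uses only the second half of the allowed error.\<close>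
    proof (intro exI[of _ "2 * B / e"] conjI allI impI)
      show "2 * B / e > 0" using B e by simp
      fix a b assume ab: "2 * B / e \<le> b - a"
      then have "B \<le> e / 2 * (b - a)" using e by (simp add: field_simps)
      moreover have "a \<le> b" using ab \<open>2 * B / e > 0\<close> by linarith
      then have "\<bar>real (card (pair_set \<Lambda>0 i j z \<inter> {a..b})) - d * (b - a)\<bar> \<le> e / 2 * (b - a) + B"
        unfolding B_def using e by (intro card_pair_set_window[where m = "q * N * k"] k[unfolded K_def] W) auto
      ultimately show "\<bar>real (card (pair_set \<Lambda>0 i j z \<inter> {a..b})) - d * (b - a)\<bar> \<le> e * (b - a)"
        by linarith
    qed
  qed
  then show ?thesis by blast
qed

section \<open>Exact renormalisation of the pair densities\<close>

text \<open>This is not divided by the density of all points: the factor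
  \<open>dens (point_set \<Lambda>)\<close> in \<open>autocorrelation\<close> restores exactly this
  quantity.\<close>

definition freq :: "'a \<Rightarrow> 'a \<Rightarrow> real \<Rightarrow> real" where
  "freq i j z = dens (pair_set \<Lambda>0 i j z)"

lemma uniform_density_pair_set: "uniform_density (pair_set \<Lambda>0 i j z) (freq i j z)"
  unfolding freq_def using uniform_density_pair_set_exists[of i j z] uniform_density_dens by metis

text \<open>In contrast to \<open>pair_count_add\<close> there is no boundary error, because the two
  points of a pair are sorted independently and may lie in different supertiles. If y = lam^m x + r
  and y + z = lam^m x' + s, then x' - x = (z + r - s) / lam^m; the outer factor is the density lost
  by dilation.\<close>

lemma freq_renormalisation:
  assumes "N dvd m"
  shows "freq i j z = (\<Sum>p\<in>UNIV. \<Sum>p'\<in>UNIV. \<Sum>r\<in>ptch m p i. \<Sum>s\<in>ptch m p' j.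
     freq p p' ((z + r - s) / lam ^ m)) / lam ^ m"
proof -
  define I where "I = (SIGMA p:UNIV. SIGMA p':UNIV. ptch m p i \<times> ptch m p' j)"
  define S where "S = (\<lambda>(p, p', r, s). (\<lambda>x. lam ^ m * x + r) ` pair_set \<Lambda>0 p p' ((z + r - s) / lam ^ m))"
  have fixm: "(infl ^^ m) \<Lambda>0 = \<Lambda>0" using assms inflate_pow_fixed by (auto elim: dvdE)
  have mem: "y \<in> \<Lambda>0 i \<longleftrightarrow> (\<exists>x t j. y = lam ^ m * x + t \<and> x \<in> \<Lambda>0 j \<and> t \<in> ptch m j i)" for y i
    using mem_inflate_pow_iff[where \<Lambda> = \<Lambda>0 and n = m and \<rho> = \<rho> and lam = lam and l = l]
    unfolding fixm .
  have finI: "finite I"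
    unfolding I_def using finite_patch[of \<rho> lam l m] by (intro finite_SigmaI finite_cartesian_product) auto
  have L: "lam ^ m > 0" by (rule lam_power_pos)
  have UN: "pair_set \<Lambda>0 i j z = (\<Union>k\<in>I. S k)"
  proof (intro equalityI subsetI)
    fix y assume "y \<in> pair_set \<Lambda>0 i j z"
    then have y: "y \<in> \<Lambda>0 i" "y + z \<in> \<Lambda>0 j" by (auto simp: pair_set_def)
    obtain x r p where x: "y = lam ^ m * x + r" "x \<in> \<Lambda>0 p" "r \<in> ptch m p i"
      using y(1) mem[of y i] by blast
    obtain x' s p' where x': "y + z = lam ^ m * x' + s" "x' \<in> \<Lambda>0 p'" "s \<in> ptch m p' j"
      using y(2) mem[of "y + z" j] by blast
    note * = x x'
    have "z + r - s = lam ^ m * (x' - x)" using *(1,4) by (simp add: algebra_simps)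
    then have "x + (z + r - s) / lam ^ m = x'" using lam_gt_1 by simp
    then have "x \<in> pair_set \<Lambda>0 p p' ((z + r - s) / lam ^ m)" using * by (simp add: pair_set_def)
    then show "y \<in> (\<Union>k\<in>I. S k)"
      using * by (intro UN_I[of "(p, p', r, s)"]) (auto simp: I_def S_def)
  next
    fix y assume "y \<in> (\<Union>k\<in>I. S k)"
    then obtain p p' r s where k: "(p, p', r, s) \<in> I" "y \<in> S (p, p', r, s)"
      by auto
    then obtain x where *: "r \<in> ptch m p i" "s \<in> ptch m p' j" "y = lam ^ m * x + r"
        "x \<in> \<Lambda>0 p" "x + (z + r - s) / lam ^ m \<in> \<Lambda>0 p'"
      by (auto simp: I_def S_def pair_set_def)
    have "lam ^ m * (x + (z + r - s) / lam ^ m) = lam ^ m * x + (z + r - s)"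
      using lam_gt_1 by (simp add: distrib_left)
    then have "y + z = lam ^ m * (x + (z + r - s) / lam ^ m) + s" using *(3) by simp
    then have "y + z \<in> \<Lambda>0 j" using mem[of "y + z" j] * by blast
    moreover have "y \<in> \<Lambda>0 i" using mem[of y i] * by blast
    ultimately show "y \<in> pair_set \<Lambda>0 i j z" by (simp add: pair_set_def)
  qed
  have "uniform_density (\<Union>k\<in>I. S k) (\<Sum>k\<in>I. case k of (p, p', r, s) \<Rightarrow> freq p p' ((z + r - s) / lam ^ m) / lam ^ m)"
  proof (rule uniform_density_UN[OF finI])
    show "uniform_density (S k) (case k of (p, p', r, s) \<Rightarrow> freq p p' ((z + r - s) / lam ^ m) / lam ^ m)" for k
      unfolding S_def by (cases k) (simp add: uniform_density_affine uniform_density_pair_set L)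
    show "disjoint_family_on S I"
      unfolding disjoint_family_on_def
    proof (intro ballI impI, rule ccontr)
      fix k k' assume k: "k \<in> I" "k' \<in> I" "k \<noteq> k'" "S k \<inter> S k' \<noteq> {}"
      obtain p p' r s where pk: "k = (p, p', r, s)" by (metis surj_pair)
      obtain o1 o' u v where ok: "k' = (o1, o', u, v)" by (metis surj_pair)
      obtain x x' where *: "lam ^ m * x + r = lam ^ m * x' + u" "x \<in> \<Lambda>0 p" "x' \<in> \<Lambda>0 o1"
          "x + (z + r - s) / lam ^ m \<in> \<Lambda>0 p'" "x' + (z + u - v) / lam ^ m \<in> \<Lambda>0 o'"
        using k(4) by (auto simp: S_def pk ok pair_set_def)
      have "lam ^ m * (x + (z + r - s) / lam ^ m) + s = lam ^ m * (x' + (z + u - v) / lam ^ m) + v"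
        using *(1) lam_gt_1 by (simp add: distrib_left)
      moreover have mems: "r \<in> ptch m p i" "s \<in> ptch m p' j" "u \<in> ptch m o1 i" "v \<in> ptch m o' j"
        using k(1,2) by (auto simp: I_def pk ok)
      ultimately have "p' = o' \<and> s = v"
        using supertile_decomposition_unique[OF tiles_UNIV *(4,5)] by blast
      moreover have "p = o1 \<and> r = u"
        using supertile_decomposition_unique[OF tiles_UNIV *(2,3) mems(1,3) *(1)] by blast
      ultimately show False using k(3) by (simp add: pk ok)
    qed
  qed
  then have "uniform_density (pair_set \<Lambda>0 i j z) (\<Sum>k\<in>I. case k of (p, p', r, s) \<Rightarrow> freq p p' ((z + r - s) / lam ^ m) / lam ^ m)"
    unfolding UN .
  then have "freq i j z = (\<Sum>k\<in>I. case k of (p, p', r, s) \<Rightarrow> freq p p' ((z + r - s) / lam ^ m) / lam ^ m)"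
    using uniform_density_dens by (simp add: freq_def)
  also have "\<dots> = (\<Sum>p\<in>UNIV. \<Sum>p'\<in>UNIV. \<Sum>r\<in>ptch m p i. \<Sum>s\<in>ptch m p' j.
     freq p p' ((z + r - s) / lam ^ m) / lam ^ m)"
    unfolding I_def using finite_patch[of \<rho> lam l m]
    by (subst sum.Sigma[symmetric], simp, simp add: finite_SigmaI finite_cartesian_product)+
       (simp add: sum.cartesian_product)
  also have "\<dots> = (\<Sum>p\<in>UNIV. \<Sum>p'\<in>UNIV. \<Sum>r\<in>ptch m p i. \<Sum>s\<in>ptch m p' j.
     freq p p' ((z + r - s) / lam ^ m)) / lam ^ m"
    by (simp add: sum_divide_distrib)
  finally show ?thesis .
qed

section \<open>Transfer to the hull\<close>

text \<open>One translation serves all types at once, which is what keeps pairs of different types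
  intact.\<close>

lemma hull_local:
  assumes "\<Lambda> \<in> tiling_hull \<Lambda>0"
  shows "\<exists>\<tau>. \<forall>i. \<Lambda> i \<inter> {a..b} = (\<lambda>x. x + \<tau>) ` \<Lambda>0 i \<inter> {a..b}"
proof -
  define R where "R = max 1 (max \<bar>a\<bar> \<bar>b\<bar>)"
  have R: "R > 0" by (simp add: R_def)
  obtain t where "locally_close (1 / R) \<Lambda> (shift_tiling t \<Lambda>0)"
    using assms R unfolding tiling_hull_def mem_Collect_eq by (meson zero_less_divide_1_iff)
  then obtain s where s: "\<And>i. \<Lambda> i \<inter> {- R .. R} = shift_tiling s (shift_tiling t \<Lambda>0) i \<inter> {- R .. R}"
    unfolding locally_close_def by auto
  have "\<Lambda> i \<inter> {a..b} = (\<lambda>x. x + (t + s)) ` \<Lambda>0 i \<inter> {a..b}" for i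
  proof -
    have sub: "{a..b} \<subseteq> {-R..R}" by (auto simp: R_def)
    have "shift_tiling s (shift_tiling t \<Lambda>0) i = (\<lambda>x. x + (t + s)) ` \<Lambda>0 i"
      by (simp add: shift_tiling_def image_image add.assoc)
    then show ?thesis using s[of i] sub by blast
  qed
  then show ?thesis by blast
qed

lemma hull_pair_set:
  assumes "\<Lambda> \<in> tiling_hull \<Lambda>0"
  shows "uniform_density (pair_set \<Lambda> i j z) (freq i j z)"
proof (rule uniform_density_local[OF uniform_density_pair_set])
  fix a b
  \<comment> \<open>The window is enlarged by |z| so that the partner y + z of a point is controlled
    as well.\<close>
  obtain \<tau> where \<tau>: "\<And>i. \<Lambda> i \<inter> {a - \<bar>z\<bar>..b + \<bar>z\<bar>} = (\<lambda>x. x + \<tau>) ` \<Lambda>0 i \<inter> {a - \<bar>z\<bar>..b + \<bar>z\<bar>}"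
    using hull_local[OF assms] by blast
  have mem: "y \<in> \<Lambda> i \<longleftrightarrow> y - \<tau> \<in> \<Lambda>0 i" if "y \<in> {a - \<bar>z\<bar>..b + \<bar>z\<bar>}" for y i
  proof -
    have "y \<in> \<Lambda> i \<longleftrightarrow> y \<in> (\<lambda>x. x + \<tau>) ` \<Lambda>0 i" using \<tau>[of i] that by blast
    also have "\<dots> \<longleftrightarrow> y - \<tau> \<in> \<Lambda>0 i" by (auto simp: image_iff) (metis diff_add_cancel)
    finally show ?thesis .
  qed
  have "y \<in> pair_set \<Lambda> i j z \<longleftrightarrow> y \<in> (\<lambda>x. x + \<tau>) ` pair_set \<Lambda>0 i j z" if "y \<in> {a..b}" for y
  proof -
    have "y \<in> {a - \<bar>z\<bar>..b + \<bar>z\<bar>}" "y + z \<in> {a - \<bar>z\<bar>..b + \<bar>z\<bar>}" using that by auto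
    then have "y \<in> pair_set \<Lambda> i j z \<longleftrightarrow> y - \<tau> \<in> pair_set \<Lambda>0 i j z"
      using mem by (simp add: pair_set_def algebra_simps)
    also have "\<dots> \<longleftrightarrow> y \<in> (\<lambda>x. x + \<tau>) ` pair_set \<Lambda>0 i j z" by (auto simp: image_iff) (metis diff_add_cancel)
    finally show ?thesis .
  qed
  then show "\<exists>\<tau>. pair_set \<Lambda> i j z \<inter> {a..b} = (\<lambda>x. x + \<tau>) ` pair_set \<Lambda>0 i j z \<inter> {a..b}" by blast
qed

lemma autocorrelation_eq:
  assumes "\<Lambda> \<in> tiling_hull \<Lambda>0"
  shows "autocorrelation \<Lambda> u z = (\<Sum>i\<in>UNIV. \<Sum>j\<in>UNIV. cnj (u $ i) * complex_of_real (freq i j z) * u $ j)"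
proof -
  let ?D = "dens (point_set \<Lambda>)"
  have pair0: "pair_set \<Lambda> i i 0 = \<Lambda> i" for i by (auto simp: pair_set_def)
  have disj: "disjoint_family_on \<Lambda> UNIV"
    unfolding disjoint_family_on_def
  proof (intro ballI impI, rule ccontr)
    fix i j assume "i \<noteq> j" "\<Lambda> i \<inter> \<Lambda> j \<noteq> {}"
    then obtain y where y: "y \<in> \<Lambda> i" "y \<in> \<Lambda> j" by blast
    obtain \<tau> where \<tau>: "\<And>i. \<Lambda> i \<inter> {y..y} = (\<lambda>x. x + \<tau>) ` \<Lambda>0 i \<inter> {y..y}"
      using hull_local[OF assms] by blast
    have "y \<in> (\<lambda>x. x + \<tau>) ` \<Lambda>0 i" "y \<in> (\<lambda>x. x + \<tau>) ` \<Lambda>0 j" using \<tau>[of i] \<tau>[of j] y by auto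
    then have "y - \<tau> \<in> \<Lambda>0 i" "y - \<tau> \<in> \<Lambda>0 j" by auto
    then have "(i, y - \<tau>) \<in> Sigma UNIV \<Lambda>0" "(j, y - \<tau>) \<in> Sigma UNIV \<Lambda>0" by auto
    moreover have "y - \<tau> \<in> supertile 0 (i, y - \<tau>)" "y - \<tau> \<in> supertile 0 (j, y - \<tau>)"
      using l_pos by (auto simp: supertile_def)
    ultimately show False using supertile_unique[OF tiles_UNIV] \<open>i \<noteq> j\<close> by blast
  qed
  have D: "uniform_density (point_set \<Lambda>) (\<Sum>i\<in>UNIV. freq i i 0)"
    using uniform_density_UN[OF finite_class.finite_UNIV _ disj, of "\<lambda>i. freq i i 0"] hull_pair_set[OF assms, of _ _ 0]
    by (metis pair0)
  \<comment> \<open>If the density \<open>?D\<close> were 0, the quotient would be 0 by convention;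
    then \<open>freq\<close> is 0 too, by monotonicity of densities, and the identity
    persists.\<close>
  have pc: "?D * pair_correlation \<Lambda> i j z = freq i j z" for i j
  proof -
    have eq: "\<Lambda> i \<inter> (\<lambda>x. x - z) ` \<Lambda> j = pair_set \<Lambda> i j z"
      by (auto simp: pair_set_def image_iff) (metis add_diff_cancel)
    have "uniform_density (point_set \<Lambda>) ?D" using D uniform_density_dens by metis
    then have "freq i j z \<le> ?D"
      by (rule uniform_density_mono[OF hull_pair_set[OF assms]]) (auto simp: pair_set_def)
    moreover have "0 \<le> freq i j z" using uniform_density_nonneg[OF hull_pair_set[OF assms]] .
    moreover have "dens (pair_set \<Lambda> i j z) = freq i j z" using uniform_density_dens[OF hull_pair_set[OF assms]] .
    ultimately show ?thesis by (cases "?D = 0") (auto simp: pair_correlation_def eq)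
  qed
  show ?thesis
    unfolding autocorrelation_def sum_distrib_left
    by (intro sum.cong refl) (simp add: pc[symmetric] algebra_simps)
qed

text \<open>This extends sums over the difference set to all reals, where the affine substitutions
  of the renormalisation are bijections.\<close>

lemma freq_eq_0:
  assumes "\<Lambda> \<in> tiling_hull \<Lambda>0" "z \<notin> difference_set \<Lambda>"
  shows "freq i j z = 0"
proof -
  have "pair_set \<Lambda> i j z = {}"
  proof (rule ccontr)
    assume "pair_set \<Lambda> i j z \<noteq> {}"
    then obtain x where "x \<in> \<Lambda> i" "x + z \<in> \<Lambda> j" by (auto simp: pair_set_def)
    then have "\<exists>a b. z = a - b \<and> a \<in> point_set \<Lambda> \<and> b \<in> point_set \<Lambda>"
      by (intro exI[of _ "x + z"] exI[of _ x]) auto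
    then show False using assms(2) unfolding difference_set_def by blast
  qed
  then show ?thesis
    using uniform_density_dens[OF hull_pair_set[OF assms(1), of i j z]] uniform_density_dens[OF uniform_density_empty] by simp
qed

end

section \<open>Combs whose Fourier transform is a measure\<close>

text \<open>The function sums bumps of width \<delta> centred at the grid points of \<delta> times
  the integers that are nearest to \<open>A\<close>. At most two of them overlap at a point, so the
  bounds do not depend on \<delta>, which may later shrink with the order m.\<close>

lemma ex_bump_on:
  fixes A :: "real set"
  assumes A: "A \<subseteq> {- M..M}" and \<delta>: "\<delta> > 0"
  obtains b :: "real \<Rightarrow> real" where "schwartz (\<lambda>x. complex_of_real (b x))"
    "\<And>x. 0 \<le> b x" "\<And>x. b x \<le> 2" "\<And>x. x \<in> A \<Longrightarrow> exp (- 2) \<le> b x"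
    "\<And>x. b x \<noteq> 0 \<Longrightarrow> \<exists>a\<in>A. \<bar>x - a\<bar> < 2 * \<delta>"
proof -
  define J where "J = {j::int. \<exists>a\<in>A. \<bar>a / \<delta> - of_int j\<bar> \<le> 1 / 2}"
  define b where "b x = (\<Sum>j\<in>J. bump (x / \<delta> - of_int j))" for x
  have finJ: "finite J"
  proof (rule finite_subset)
    show "J \<subseteq> {\<lfloor>- M / \<delta> - 1\<rfloor>..\<lceil>M / \<delta> + 1\<rceil>}"
    proof
      fix j assume "j \<in> J"
      then obtain a where a: "a \<in> A" "\<bar>a / \<delta> - of_int j\<bar> \<le> 1 / 2" by (auto simp: J_def)
      have "- M \<le> a" "a \<le> M" using a(1) A by auto
      then have "- M / \<delta> \<le> a / \<delta>" "a / \<delta> \<le> M / \<delta>" using \<delta> by (intro divide_right_mono; simp)+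
      then have "- M / \<delta> - 1 \<le> of_int j" "of_int j \<le> M / \<delta> + 1" using a(2) by linarith+
      then show "j \<in> {\<lfloor>- M / \<delta> - 1\<rfloor>..\<lceil>M / \<delta> + 1\<rceil>}" unfolding atLeastAtMost_iff by linarith
    qed
  qed simp
  show ?thesis
  proof (rule that[of b])
    have "schwartz (\<lambda>x. complex_of_real (bump (x / \<delta> - of_int j)))" for j
      using schwartz_affine[OF schwartz_bump, of "1 / \<delta>" "- of_int j"] \<delta> by simp
    then show "schwartz (\<lambda>x. complex_of_real (b x))"
      unfolding b_def of_real_sum by (intro schwartz_sum finJ)
    show "0 \<le> b x" for x unfolding b_def by (intro sum_nonneg bump_nonneg)
    show "b x \<le> 2" for x
    proof -
      have "b x = (\<Sum>j\<in>J \<inter> {\<lfloor>x / \<delta>\<rfloor>, \<lfloor>x / \<delta>\<rfloor> + 1}. bump (x / \<delta> - of_int j))"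
        unfolding b_def
      proof (rule sum.mono_neutral_right)
        show "\<forall>j\<in>J - J \<inter> {\<lfloor>x / \<delta>\<rfloor>, \<lfloor>x / \<delta>\<rfloor> + 1}. bump (x / \<delta> - of_int j) = 0"
        proof
          fix j assume "j \<in> J - J \<inter> {\<lfloor>x / \<delta>\<rfloor>, \<lfloor>x / \<delta>\<rfloor> + 1}"
          then have "j \<le> \<lfloor>x / \<delta>\<rfloor> - 1 \<or> j \<ge> \<lfloor>x / \<delta>\<rfloor> + 2" by auto
          then have "1 \<le> \<bar>x / \<delta> - of_int j\<bar>" by linarith
          then show "bump (x / \<delta> - of_int j) = 0" by (rule bump_eq_0)
        qed
      qed (use finJ in auto)
      also have "\<dots> \<le> (\<Sum>j\<in>J \<inter> {\<lfloor>x / \<delta>\<rfloor>, \<lfloor>x / \<delta>\<rfloor> + 1}. 1)"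
        by (intro sum_mono bump_le_1)
      also have "\<dots> \<le> real (card {\<lfloor>x / \<delta>\<rfloor>, \<lfloor>x / \<delta>\<rfloor> + 1})"
        by (simp add: card_mono del: card_insert_disjoint)
      also have "\<dots> = 2" by simp
      finally show ?thesis .
    qed
    show "exp (- 2) \<le> b x" if "x \<in> A" for x
    proof -
      define j where "j = round (x / \<delta>)"
      have r: "\<bar>x / \<delta> - of_int j\<bar> \<le> 1 / 2"
        using of_int_round_abs_le[of "x / \<delta>"] unfolding j_def by linarith
      then have "j \<in> J" using that by (auto simp: J_def)
      have "exp (- 2) \<le> bump (x / \<delta> - of_int j)" by (rule bump_ge[OF r])
      also have "\<dots> \<le> b x"
        unfolding b_def using bump_nonneg finJ \<open>j \<in> J\<close> by (intro member_le_sum) auto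
      finally show ?thesis .
    qed
    show "\<exists>a\<in>A. \<bar>x - a\<bar> < 2 * \<delta>" if nz: "b x \<noteq> 0" for x
    proof -
      obtain j where j: "j \<in> J" "bump (x / \<delta> - of_int j) \<noteq> 0"
        using sum.not_neutral_contains_not_neutral[OF nz[unfolded b_def]] by blast
      then obtain a where a: "a \<in> A" "\<bar>a / \<delta> - of_int j\<bar> \<le> 1 / 2" by (auto simp: J_def)
      have "\<bar>x / \<delta> - of_int j\<bar> < 1" using j(2) bump_eq_0 by (meson not_le)
      then have "\<bar>x / \<delta> - a / \<delta>\<bar> < 2" using a(2) by linarith
      then have "\<bar>x - a\<bar> / \<delta> < 2" using \<delta> by (simp add: diff_divide_distrib[symmetric] abs_divide)
      then show ?thesis using a(1) \<delta> by (auto simp: pos_divide_less_eq)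
    qed
  qed
qed

text \<open>An affine substitution on the side of the comb becomes a dilation and a phase on the
  side of the test function, and both preserve the Schwartz class.\<close>

lemma fourier_transform_affine:
  assumes "c > 0"
  shows "fourier_transform \<phi> (c * w + a) =
    complex_of_real (1 / c) * fourier_transform (\<lambda>k. cis (- 2 * pi * (a / c) * k) * \<phi> (k / c)) w"
proof -
  have "fourier_transform \<phi> (c * w + a) =
      (1 / c) *\<^sub>R (LINT x|lborel. cis (- 2 * pi * (c * w + a) * (0 + 1 / c * x)) * \<phi> (0 + 1 / c * x))"
    unfolding fourier_transform_def
    by (subst lborel_integral_real_affine[where c = "1 / c" and t = 0]) (use assms in auto)
  also have "(\<lambda>x. cis (- 2 * pi * (c * w + a) * (0 + 1 / c * x)) * \<phi> (0 + 1 / c * x)) =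
      (\<lambda>x. cis (- 2 * pi * w * x) * (cis (- 2 * pi * (a / c) * x) * \<phi> (x / c)))"
  proof
    fix x
    have eq: "- 2 * pi * (c * w + a) * (0 + 1 / c * x) = - 2 * pi * w * x + - 2 * pi * (a / c) * x"
      using assms by (simp add: field_simps)
    show "cis (- 2 * pi * (c * w + a) * (0 + 1 / c * x)) * \<phi> (0 + 1 / c * x) =
        cis (- 2 * pi * w * x) * (cis (- 2 * pi * (a / c) * x) * \<phi> (x / c))"
      unfolding eq cis_mult[symmetric] by simp
  qed
  finally show ?thesis by (simp add: fourier_transform_def scaleR_conv_of_real)
qed

lemma fourier_transform_shift:
  "fourier_transform (\<lambda>k. \<phi> (k - t)) z = cis (- 2 * pi * z * t) * fourier_transform \<phi> z"
proof -
  have "fourier_transform (\<lambda>k. \<phi> (k - t)) z =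
      (LINT x|lborel. cis (- 2 * pi * z * (t + 1 * x)) * \<phi> (t + 1 * x - t))"
    unfolding fourier_transform_def
    by (subst lborel_integral_real_affine[where c = 1 and t = t]) auto
  also have "(\<lambda>x. cis (- 2 * pi * z * (t + 1 * x)) * \<phi> (t + 1 * x - t)) =
      (\<lambda>x. cis (- 2 * pi * z * t) * (cis (- 2 * pi * z * x) * \<phi> x))"
  proof
    fix x
    have eq: "- 2 * pi * z * (t + 1 * x) = - 2 * pi * z * t + - 2 * pi * z * x"
      by (simp add: algebra_simps)
    show "cis (- 2 * pi * z * (t + 1 * x)) * \<phi> (t + 1 * x - t) =
        cis (- 2 * pi * z * t) * (cis (- 2 * pi * z * x) * \<phi> x)"
      unfolding eq cis_mult[symmetric] by simp
  qed
  finally show ?thesis by (simp add: fourier_transform_def)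
qed

context
  fixes Z :: "real set" and g :: "real \<Rightarrow> complex" and \<mu> :: "real measure"
  assumes ft: "is_fourier_transform_of_comb Z g \<mu>"
begin

lemma sets_comb: "sets \<mu> = sets borel"
  using ft unfolding is_fourier_transform_of_comb_def by blast

lemma space_comb: "space \<mu> = UNIV"
  using sets_eq_imp_space_eq[OF sets_comb] by simp

lemma emeasure_comb_bounded:
  assumes "A \<in> sets borel" "A \<subseteq> {a..b}"
  shows "emeasure \<mu> A < \<infinity>"
proof -
  have "emeasure \<mu> A \<le> emeasure \<mu> {a..b}" using assms sets_comb by (intro emeasure_mono) auto
  also have "\<dots> < \<infinity>" using ft unfolding is_fourier_transform_of_comb_def by auto
  finally show ?thesis .
qed

lemma measure_le_integral_bump:
  fixes b :: "real \<Rightarrow> real"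
  assumes A: "A \<in> sets borel" "A \<subseteq> {x..y}"
    and b: "schwartz (\<lambda>x. complex_of_real (b x))" "\<And>x. 0 \<le> b x" "\<And>x. x \<in> A \<Longrightarrow> c \<le> b x"
  shows "c * measure \<mu> A \<le> norm (LINT k|\<mu>. complex_of_real (b k))"
proof -
  have int: "integrable \<mu> (\<lambda>k. complex_of_real (b k))"
    using ft b(1) unfolding is_fourier_transform_of_comb_def by blast
  from integrable_Re[OF this] have intb: "integrable \<mu> b" by simp
  have "c * measure \<mu> A = (LINT k|\<mu>. c * indicator A k)"
    using A sets_comb space_comb by simp
  also have "\<dots> \<le> (LINT k|\<mu>. b k)"
  proof (rule integral_mono)
    show "integrable \<mu> (\<lambda>k. c * indicator A k)"
      using A sets_comb emeasure_comb_bounded[OF A] by (intro integrable_mult_right integrable_real_indicator) auto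
    show "c * indicator A k \<le> b k" for k using b(2,3) by (auto simp: indicator_def)
  qed (rule intb)
  also have "\<dots> \<le> norm (LINT k|\<mu>. complex_of_real (b k))"
    by simp
  finally show ?thesis .
qed

text \<open>
  Translating a test function only multiplies its Fourier transform by a phase, so its integral
  against \<open>\<mu>\<close> is bounded uniformly in the translation.
\<close>

lemma comb_linear_growth: "\<exists>C\<ge>0. \<forall>R\<ge>0. measure \<mu> {- R..R} \<le> C * (1 + R)"
proof -
  let ?\<phi> = "\<lambda>x. complex_of_real (bump x)"
  define B where "B = (\<Sum>\<^sub>\<infinity>z\<in>Z. norm (g z * fourier_transform ?\<phi> z))"
  have "(\<lambda>z. g z * fourier_transform ?\<phi> z) summable_on Z"
    using ft schwartz_bump unfolding is_fourier_transform_of_comb_def summable_on_def by blast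
  \<comment> \<open>For complex families, unconditional and absolute summability coincide; thus
    \<open>B\<close> is a genuine sum and not a default value.\<close>
  then have abs: "(\<lambda>z. norm (g z * fourier_transform ?\<phi> z)) summable_on Z"
    by (simp add: summable_on_iff_abs_summable_on_complex)
  have B0: "0 \<le> B" unfolding B_def by (intro infsum_nonneg) auto
  have unit: "measure \<mu> {t - 1 / 2..t + 1 / 2} \<le> exp 2 * B" for t
  proof -
    have sch: "schwartz (\<lambda>x. complex_of_real (bump (x - t)))"
      using schwartz_affine[OF schwartz_bump, of 1 "- t"] by simp
    then have "((\<lambda>z. g z * fourier_transform (\<lambda>x. ?\<phi> (x - t)) z) has_sum
        (LINT k|\<mu>. complex_of_real (bump (k - t)))) Z"
      using ft unfolding is_fourier_transform_of_comb_def by blast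
    then have "(LINT k|\<mu>. complex_of_real (bump (k - t))) =
        (\<Sum>\<^sub>\<infinity>z\<in>Z. g z * fourier_transform (\<lambda>x. ?\<phi> (x - t)) z)"
      by (simp add: infsumI)
    also have "norm \<dots> \<le> (\<Sum>\<^sub>\<infinity>z\<in>Z. norm (g z * fourier_transform (\<lambda>x. ?\<phi> (x - t)) z))"
      using abs by (intro norm_infsum_bound) (simp add: fourier_transform_shift[of ?\<phi> t] norm_mult)
    also have "\<dots> = B" by (simp add: B_def fourier_transform_shift[of ?\<phi> t] norm_mult)
    finally have "norm (LINT k|\<mu>. complex_of_real (bump (k - t))) \<le> B" .
    moreover have "exp (- 2) * measure \<mu> {t - 1 / 2..t + 1 / 2} \<le> norm (LINT k|\<mu>. complex_of_real (bump (k - t)))"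
    proof (rule measure_le_integral_bump[OF _ _ sch bump_nonneg])
      fix x assume "x \<in> {t - 1 / 2..t + 1 / 2}"
      then have "\<bar>x - t\<bar> \<le> 1 / 2" unfolding atLeastAtMost_iff by linarith
      then show "exp (- 2) \<le> bump (x - t)" by (rule bump_ge)
    qed auto
    ultimately have "exp (- 2) * measure \<mu> {t - 1 / 2..t + 1 / 2} \<le> B" by linarith
    then have "exp 2 * (exp (- 2) * measure \<mu> {t - 1 / 2..t + 1 / 2}) \<le> exp 2 * B"
      by (intro mult_left_mono) auto
    then show ?thesis by (simp add: mult.assoc[symmetric] exp_add[symmetric])
  qed
  have "measure \<mu> {- R..R} \<le> (3 * exp 2 * B) * (1 + R)" if "R \<ge> 0" for R
  proof -
    \<comment> \<open>Unit intervals centred at -R, -R + 1, ..., -R + n cover the window, and n + 1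
      \<le> 2 R + 2 \<le> 3 (1 + R).\<close>
    define n where "n = nat \<lceil>2 * R\<rceil>"
    define T where "T j = {(- R + real j) - 1 / 2..(- R + real j) + 1 / 2}" for j
    have T_fin: "emeasure \<mu> (T j) \<noteq> \<infinity>" for j
      using emeasure_comb_bounded[of "T j"] unfolding T_def by force
    have "{- R..R} \<subseteq> (\<Union>j\<in>{..n}. T j)"
    proof
      fix x assume x: "x \<in> {- R..R}"
      define j where "j = nat (round (x + R))"
      have r: "\<bar>of_int (round (x + R)) - (x + R)\<bar> \<le> 1 / 2" by (rule of_int_round_abs_le)
      have "round (x + R) \<ge> 0" using round_mono[of 0 "x + R"] x by simp
      then have "real j = of_int (round (x + R))" by (simp add: j_def)
      then have "x \<in> T j" using r unfolding T_def atLeastAtMost_iff by linarith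
      moreover have "round (x + R) \<le> \<lceil>2 * R\<rceil>"
      proof -
        have "x + R \<le> of_int \<lceil>2 * R\<rceil>" using x by simp linarith
        then have "round (x + R) \<le> round (of_int \<lceil>2 * R\<rceil> :: real)" by (rule round_mono)
        then show ?thesis by simp
      qed
      then have "j \<le> n" by (simp add: j_def n_def)
      ultimately show "x \<in> (\<Union>j\<in>{..n}. T j)" by blast
    qed
    then have "measure \<mu> {- R..R} \<le> measure \<mu> (\<Union>j\<in>{..n}. T j)"
    proof (rule measure_mono_fmeasurable)
      show "(\<Union>j\<in>{..n}. T j) \<in> fmeasurable \<mu>"
        using T_fin sets_comb
        by (intro fmeasurable.finite_UN) (auto simp: fmeasurable_def T_def less_top)
    qed (simp add: sets_comb)
    also have "\<dots> \<le> (\<Sum>j\<in>{..n}. measure \<mu> (T j))"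
      using sets_comb T_fin by (intro measure_UNION_le) (auto simp: T_def)
    also have "\<dots> \<le> (\<Sum>j\<in>{..n}. exp 2 * B)"
      unfolding T_def by (intro sum_mono unit)
    also have "\<dots> = (real n + 1) * (exp 2 * B)" by simp
    also have "\<dots> \<le> (3 * (1 + R)) * (exp 2 * B)"
      using B0 that unfolding n_def by (intro mult_right_mono) (auto, linarith)
    finally show ?thesis by (simp add: algebra_simps)
  qed
  then show ?thesis using B0 by (intro exI[of _ "3 * exp 2 * B"]) auto
qed

end

section \<open>Polarisation\<close>

definition polarisation_vector :: "'a::finite \<Rightarrow> 'a \<Rightarrow> nat \<Rightarrow> complex^'a" where
  "polarisation_vector p q s = axis p 1 + axis q (\<i> ^ s)"

text \<open>The weights (-i)^s average out the diagonal terms and the reversed term f q p. No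
  symmetry of f enters, and p = q is included.\<close>

lemma polarisation:
  fixes f :: "'a::finite \<Rightarrow> 'a \<Rightarrow> complex"
  shows "f p q = (1 / 4) * (\<Sum>s<4. (- \<i>) ^ s *
    (\<Sum>i\<in>UNIV. \<Sum>j\<in>UNIV. cnj (polarisation_vector p q s $ i) * f i j * polarisation_vector p q s $ j))"
proof -
  have *: "(\<Sum>i\<in>UNIV. \<Sum>j\<in>UNIV. cnj ((axis p 1 + axis q c) $ i) * f i j * (axis p 1 + axis q c) $ j) =
     f p p + c * f p q + cnj c * f q p + cnj c * c * f q q" for c :: complex
  proof -
    have r: "(\<Sum>j\<in>UNIV. h j * (axis p 1 + axis q c) $ j) = h p + h q * c" for h :: "'a \<Rightarrow> complex"
      by (simp add: axis_def distrib_left sum.distrib if_distrib[of "\<lambda>x. _ * x"] cong: if_cong)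
    have l: "(\<Sum>i\<in>UNIV. cnj ((axis p 1 + axis q c) $ i) * h i) = h p + cnj c * h q" for h :: "'a \<Rightarrow> complex"
      by (simp add: axis_def distrib_right sum.distrib if_distrib[of "\<lambda>x. x * _"] if_distrib[of cnj] cong: if_cong)
    have "(\<Sum>i\<in>UNIV. \<Sum>j\<in>UNIV. cnj ((axis p 1 + axis q c) $ i) * f i j * (axis p 1 + axis q c) $ j) =
      (\<Sum>i\<in>UNIV. cnj ((axis p 1 + axis q c) $ i) * (f i p + f i q * c))"
      unfolding r[symmetric] by (simp add: sum_distrib_left mult.assoc)
    also have "\<dots> = f p p + f p q * c + cnj c * (f q p + f q q * c)" by (rule l)
    finally show ?thesis by (simp add: algebra_simps)
  qed
  show ?thesis
    unfolding polarisation_vector_def * by (simp add: numeral_eq_Suc algebra_simps)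
qed

section \<open>Renormalisation of the diffraction measure\<close>

lemma has_sum_sum:
  fixes f :: "'i \<Rightarrow> 'b \<Rightarrow> 'c::topological_comm_monoid_add"
  assumes "\<And>x. x \<in> X \<Longrightarrow> (f x has_sum s x) A"
  shows "((\<lambda>z. \<Sum>x\<in>X. f x z) has_sum (\<Sum>x\<in>X. s x)) A"
  using assms by (induction X rule: infinite_finite_induct) (auto intro: has_sum_add)

text \<open>The whole family of diffraction measures is fixed because renormalising one weight
  vector brings in all pair correlations, and with them the measures of the polarisation
  vectors.\<close>

locale inflation_diffraction = inflation_fixed_point +
  fixes \<Lambda> :: "'a \<Rightarrow> real set" and \<mu> :: "complex^'a \<Rightarrow> real measure"
  assumes hull: "\<Lambda> \<in> tiling_hull \<Lambda>0"
    and diffraction: "is_diffraction_measure \<Lambda> u (\<mu> u)"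
begin

lemma comb: "is_fourier_transform_of_comb (difference_set \<Lambda>) (autocorrelation \<Lambda> u) (\<mu> u)"
  using diffraction unfolding is_diffraction_measure_def .

lemma integrable_schwartz: "schwartz \<phi> \<Longrightarrow> integrable (\<mu> u) \<phi>"
  using comb unfolding is_fourier_transform_of_comb_def by blast

lemma has_sum_diffraction:
  assumes "schwartz \<phi>"
  shows "((\<lambda>z. (\<Sum>i\<in>UNIV. \<Sum>j\<in>UNIV. cnj (u $ i) * complex_of_real (freq i j z) * u $ j) *
    fourier_transform \<phi> z) has_sum (LINT k|\<mu> u. \<phi> k)) UNIV"
proof -
  have "((\<lambda>z. autocorrelation \<Lambda> u z * fourier_transform \<phi> z) has_sum (LINT k|\<mu> u. \<phi> k)) (difference_set \<Lambda>)"
    using comb assms unfolding is_fourier_transform_of_comb_def by blast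
  then show ?thesis
    by (subst has_sum_cong_neutral[of "difference_set \<Lambda>" UNIV])
       (auto simp: autocorrelation_eq[OF hull] freq_eq_0[OF hull])
qed

text \<open>
  The functional \<open>pair_functional p p'\<close> is integration against the complex measure that is the
  Fourier transform of the pair correlation of the types \<open>p\<close> and \<open>p'\<close>.
\<close>

definition pair_functional :: "'a \<Rightarrow> 'a \<Rightarrow> (real \<Rightarrow> complex) \<Rightarrow> complex" where
  "pair_functional p p' \<psi> = (1 / 4) * (\<Sum>s<4. (- \<i>) ^ s * (LINT k|\<mu> (polarisation_vector p p' s). \<psi> k))"

lemma has_sum_freq:
  assumes "schwartz \<psi>"
  shows "((\<lambda>z. complex_of_real (freq p p' z) * fourier_transform \<psi> z) has_sum pair_functional p p' \<psi>) UNIV"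
proof -
  have "((\<lambda>z. (1 / 4) * (\<Sum>s<4. (- \<i>) ^ s * ((\<Sum>i\<in>UNIV. \<Sum>j\<in>UNIV.
      cnj (polarisation_vector p p' s $ i) * complex_of_real (freq i j z) * polarisation_vector p p' s $ j) *
      fourier_transform \<psi> z))) has_sum pair_functional p p' \<psi>) UNIV"
    unfolding pair_functional_def
    by (intro has_sum_cmult_right has_sum_sum has_sum_diffraction assms)
  moreover have "(1 / 4) * (\<Sum>s<4. (- \<i>) ^ s * ((\<Sum>i\<in>UNIV. \<Sum>j\<in>UNIV.
      cnj (polarisation_vector p p' s $ i) * complex_of_real (freq i j z) * polarisation_vector p p' s $ j) *
      fourier_transform \<psi> z)) = complex_of_real (freq p p' z) * fourier_transform \<psi> z" for z
    by (subst polarisation[of "\<lambda>i j. complex_of_real (freq i j z)" p p'])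
       (simp only: sum_distrib_right mult.assoc)
  ultimately show ?thesis by simp
qed

lemma pair_functional_sum:
  assumes "finite X" "\<And>x. x \<in> X \<Longrightarrow> schwartz (\<psi> x)"
  shows "pair_functional p p' (\<lambda>k. \<Sum>x\<in>X. c x * \<psi> x k) = (\<Sum>x\<in>X. c x * pair_functional p p' (\<psi> x))"
proof -
  have "(LINT k|\<mu> v. (\<Sum>x\<in>X. c x * \<psi> x k)) = (\<Sum>x\<in>X. c x * (LINT k|\<mu> v. \<psi> x k))" for v
    using assms integrable_schwartz by (subst Bochner_Integration.integral_sum) auto
  then show ?thesis
    unfolding pair_functional_def
    by (simp add: sum_distrib_left sum_distrib_right mult_ac) (subst sum.swap, simp add: mult_ac)
qed

text \<open>A common majorant: up to the sup norm, it bounds the sum of all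
  \<open>pair_functional\<close> values on a function supported in the window.\<close>

definition total_mass :: "real \<Rightarrow> real" where
  "total_mass R = (\<Sum>p\<in>UNIV. \<Sum>p'\<in>UNIV. \<Sum>s<4. measure (\<mu> (polarisation_vector p p' s)) {- R..R})"

lemma total_mass_linear_growth: "\<exists>C\<ge>0. \<forall>R\<ge>0. total_mass R \<le> C * (1 + R)"
proof -
  have "\<exists>C. \<forall>u. C u \<ge> 0 \<and> (\<forall>R\<ge>0. measure (\<mu> u) {- R..R} \<le> C u * (1 + R))"
    using comb_linear_growth[OF comb] by metis
  then obtain C where C: "\<And>u. C u \<ge> 0" "\<And>u R. R \<ge> 0 \<Longrightarrow> measure (\<mu> u) {- R..R} \<le> C u * (1 + R)"
    by blast
  show ?thesis
  proof (intro exI[of _ "\<Sum>p\<in>UNIV. \<Sum>p'\<in>UNIV. \<Sum>s<4. C (polarisation_vector p p' s)"] conjI allI impI)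
    show "0 \<le> (\<Sum>p\<in>UNIV. \<Sum>p'\<in>UNIV. \<Sum>s<4. C (polarisation_vector p p' s))"
      by (intro sum_nonneg C)
    show "total_mass R \<le> (\<Sum>p\<in>UNIV. \<Sum>p'\<in>UNIV. \<Sum>s<4. C (polarisation_vector p p' s)) * (1 + R)" if "R \<ge> 0" for R
      unfolding total_mass_def sum_distrib_right by (intro sum_mono C that)
  qed
qed

lemma norm_pair_functional_le:
  assumes "\<And>k. norm (\<psi> k) \<le> c * indicator {- R..R} k"
  shows "norm (pair_functional p p' \<psi>) \<le> c * (\<Sum>s<4. measure (\<mu> (polarisation_vector p p' s)) {- R..R})"
proof -
  have c: "0 \<le> c * indicator {- R..R} k" for k using assms[of k] norm_ge_zero order_trans by blast
  have int: "norm (LINT k|\<mu> u. \<psi> k) \<le> c * measure (\<mu> u) {- R..R}" for u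
  proof -
    have "norm (LINT k|\<mu> u. \<psi> k) \<le> (LINT k|\<mu> u. c * indicator {- R..R} k)"
    proof (cases "integrable (\<mu> u) \<psi>")
      case True
      have "integrable (\<mu> u) (\<lambda>k. c * indicator {- R..R} k)"
        using sets_comb[OF comb] emeasure_comb_bounded[OF comb, of "{- R..R}" "- R" R]
        by (intro integrable_mult_right integrable_real_indicator) auto
      with True show ?thesis by (rule Bochner_Integration.integral_norm_bound_integral) (rule assms)
    next
      \<comment> \<open>The integral of a non-integrable function is 0 by convention, and the bound
        is nonnegative.\<close>
      case False
      then have "(LINT k|\<mu> u. \<psi> k) = 0" by (rule not_integrable_integral_eq)
      moreover have "0 \<le> (LINT k|\<mu> u. c * indicator {- R..R} k)" using c by (rule Bochner_Integration.integral_nonneg)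
      ultimately show ?thesis by simp
    qed
    also have "\<dots> = c * measure (\<mu> u) {- R..R}"
      using sets_comb[OF comb] space_comb[OF comb] by simp
    finally show ?thesis .
  qed
  have "norm (pair_functional p p' \<psi>) \<le> (1 / 4) * (\<Sum>s<4. norm ((- \<i>) ^ s * (LINT k|\<mu> (polarisation_vector p p' s). \<psi> k)))"
    unfolding pair_functional_def by (subst norm_mult) (intro mult_mono norm_sum, auto)
  also have "\<dots> \<le> 1 * (\<Sum>s<4. norm ((- \<i>) ^ s * (LINT k|\<mu> (polarisation_vector p p' s). \<psi> k)))"
    by (intro mult_right_mono sum_nonneg) auto
  also have "\<dots> \<le> (\<Sum>s<4. c * measure (\<mu> (polarisation_vector p p' s)) {- R..R})"
    using int by (simp add: norm_mult norm_power sum_mono)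
  finally show ?thesis by (simp add: sum_distrib_left)
qed

text \<open>\<open>a p\<close> is the component p of the row vector u^* B^(m). Substituting z =
  lam^m w - (r - s) in the comb dilates the test function and adds a phase; the phase splits into a
  factor for r and a conjugate factor for s, which sum to cocycle entries. One factor lam^(-m) comes
  from the densities, the other from the dilation.\<close>

lemma diffraction_renormalisation:
  fixes u :: "complex^'a" and m :: nat
  assumes m: "N dvd m" and \<phi>: "schwartz \<phi>"
  defines "a \<equiv> \<lambda>p k. \<Sum>i\<in>UNIV. cnj (u $ i) * fourier_cocycle \<rho> lam l m k $ i $ p"
  shows "(LINT k|\<mu> u. \<phi> k) = complex_of_real (1 / lam ^ (2 * m)) * (\<Sum>p\<in>UNIV. \<Sum>p'\<in>UNIV.
    pair_functional p p' (\<lambda>k. a p (k / lam ^ m) * cnj (a p' (k / lam ^ m)) * \<phi> (k / lam ^ m)))"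
proof -
  let ?c = "lam ^ m"
  have c: "?c > 0" by (rule lam_power_pos)
  define \<psi> where "\<psi> d k = cis (2 * pi * (d / ?c) * k) * \<phi> (k / ?c)" for d k
  have sch: "schwartz (\<psi> d)" for d
    unfolding \<psi>_def
    using schwartz_mult_cis[OF schwartz_affine[OF \<phi>, of "1 / ?c" 0], of "2 * pi * (d / ?c)"] lam_gt_1 by simp
  have ft: "fourier_transform \<phi> (?c * w - d) = complex_of_real (1 / ?c) * fourier_transform (\<psi> d) w" for w d
    using fourier_transform_affine[OF c, of \<phi> w "- d"] by (simp add: \<psi>_def[abs_def])
  have single: "((\<lambda>z. complex_of_real (freq p p' ((z + d) / ?c)) * fourier_transform \<phi> z) has_sum
      complex_of_real (1 / ?c) * pair_functional p p' (\<psi> d)) UNIV" for p p' d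
  proof -
    have "bij_betw (\<lambda>w. ?c * w - d) UNIV UNIV"
      by (rule bij_betwI[where g = "\<lambda>z. (z + d) / ?c"]) (use lam_gt_1 in auto)
    moreover have "((\<lambda>w. complex_of_real (freq p p' (((?c * w - d) + d) / ?c)) * fourier_transform \<phi> (?c * w - d)) has_sum
      complex_of_real (1 / ?c) * pair_functional p p' (\<psi> d)) UNIV"
    proof -
      have "complex_of_real (freq p p' (((?c * w - d) + d) / ?c)) * fourier_transform \<phi> (?c * w - d) =
          complex_of_real (1 / ?c) * (complex_of_real (freq p p' w) * fourier_transform (\<psi> d) w)" for w
        unfolding ft using lam_gt_1 by simp
      then show ?thesis
        using has_sum_cmult_right[OF has_sum_freq[OF sch, of p p' d], of "complex_of_real (1 / ?c)"]
        by simp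
    qed
    ultimately show ?thesis
      using has_sum_reindex_bij_betw[of "\<lambda>w. ?c * w - d" UNIV UNIV] by blast
  qed
  have "((\<lambda>z. \<Sum>i\<in>UNIV. \<Sum>j\<in>UNIV. \<Sum>p\<in>UNIV. \<Sum>p'\<in>UNIV. \<Sum>r\<in>ptch m p i. \<Sum>s\<in>ptch m p' j.
      cnj (u $ i) * u $ j * complex_of_real (1 / ?c) *
      (complex_of_real (freq p p' ((z + (r - s)) / ?c)) * fourier_transform \<phi> z)) has_sum
     (\<Sum>i\<in>UNIV. \<Sum>j\<in>UNIV. \<Sum>p\<in>UNIV. \<Sum>p'\<in>UNIV. \<Sum>r\<in>ptch m p i. \<Sum>s\<in>ptch m p' j.
      cnj (u $ i) * u $ j * complex_of_real (1 / ?c) *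
      (complex_of_real (1 / ?c) * pair_functional p p' (\<psi> (r - s))))) UNIV"
    by (intro has_sum_sum has_sum_cmult_right single)
  moreover have "(\<Sum>i\<in>UNIV. \<Sum>j\<in>UNIV. \<Sum>p\<in>UNIV. \<Sum>p'\<in>UNIV. \<Sum>r\<in>ptch m p i. \<Sum>s\<in>ptch m p' j.
      cnj (u $ i) * u $ j * complex_of_real (1 / ?c) *
      (complex_of_real (freq p p' ((z + (r - s)) / ?c)) * fourier_transform \<phi> z)) =
    (\<Sum>i\<in>UNIV. \<Sum>j\<in>UNIV. cnj (u $ i) * complex_of_real (freq i j z) * u $ j) * fourier_transform \<phi> z" for z
    unfolding freq_renormalisation[OF m, of _ _ z]
    by (simp add: sum_distrib_left sum_distrib_right sum_divide_distrib mult_ac add_diff_eq)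
  ultimately have "(LINT k|\<mu> u. \<phi> k) =
     (\<Sum>i\<in>UNIV. \<Sum>j\<in>UNIV. \<Sum>p\<in>UNIV. \<Sum>p'\<in>UNIV. \<Sum>r\<in>ptch m p i. \<Sum>s\<in>ptch m p' j.
      cnj (u $ i) * u $ j * complex_of_real (1 / ?c) *
      (complex_of_real (1 / ?c) * pair_functional p p' (\<psi> (r - s))))"
    using has_sum_unique[OF has_sum_diffraction[OF \<phi>, of u]] by simp
  also have "\<dots> = complex_of_real (1 / lam ^ (2 * m)) *
     (\<Sum>i\<in>UNIV. \<Sum>j\<in>UNIV. \<Sum>p\<in>UNIV. \<Sum>p'\<in>UNIV. \<Sum>r\<in>ptch m p i. \<Sum>s\<in>ptch m p' j.
      cnj (u $ i) * u $ j * pair_functional p p' (\<psi> (r - s)))"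
    by (simp add: sum_distrib_left power_mult power2_eq_square mult_ac)
  also have "(\<Sum>i\<in>UNIV. \<Sum>j\<in>UNIV. \<Sum>p\<in>UNIV. \<Sum>p'\<in>UNIV. \<Sum>r\<in>ptch m p i. \<Sum>s\<in>ptch m p' j.
      cnj (u $ i) * u $ j * pair_functional p p' (\<psi> (r - s))) =
     (\<Sum>p\<in>UNIV. \<Sum>p'\<in>UNIV. \<Sum>i\<in>UNIV. \<Sum>j\<in>UNIV. \<Sum>r\<in>ptch m p i. \<Sum>s\<in>ptch m p' j.
      cnj (u $ i) * u $ j * pair_functional p p' (\<psi> (r - s)))"
  proof -
    have "(\<Sum>i\<in>UNIV. \<Sum>j\<in>UNIV. \<Sum>p\<in>UNIV. \<Sum>p'\<in>UNIV. h i j p p') =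
        (\<Sum>p\<in>UNIV. \<Sum>p'\<in>UNIV. \<Sum>i\<in>UNIV. \<Sum>j\<in>UNIV. h i j p p')" for h :: "'a \<Rightarrow> 'a \<Rightarrow> 'a \<Rightarrow> 'a \<Rightarrow> complex"
    proof -
      have "(\<Sum>i\<in>UNIV. \<Sum>j\<in>UNIV. \<Sum>p\<in>UNIV. \<Sum>p'\<in>UNIV. h i j p p') =
          (\<Sum>i\<in>UNIV. \<Sum>p\<in>UNIV. \<Sum>j\<in>UNIV. \<Sum>p'\<in>UNIV. h i j p p')"
        by (rule sum.cong[OF refl], rule sum.swap)
      also have "\<dots> = (\<Sum>p\<in>UNIV. \<Sum>i\<in>UNIV. \<Sum>j\<in>UNIV. \<Sum>p'\<in>UNIV. h i j p p')"
        by (rule sum.swap)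
      also have "\<dots> = (\<Sum>p\<in>UNIV. \<Sum>i\<in>UNIV. \<Sum>p'\<in>UNIV. \<Sum>j\<in>UNIV. h i j p p')"
        by (rule sum.cong[OF refl], rule sum.cong[OF refl], rule sum.swap)
      also have "\<dots> = (\<Sum>p\<in>UNIV. \<Sum>p'\<in>UNIV. \<Sum>i\<in>UNIV. \<Sum>j\<in>UNIV. h i j p p')"
        by (rule sum.cong[OF refl], rule sum.swap)
      finally show ?thesis .
    qed
    then show ?thesis .
  qed
  also have "\<dots> = (\<Sum>p\<in>UNIV. \<Sum>p'\<in>UNIV.
    pair_functional p p' (\<lambda>k. a p (k / ?c) * cnj (a p' (k / ?c)) * \<phi> (k / ?c)))"
  proof (intro sum.cong refl)
    fix p p'
    define X where "X = (SIGMA i:UNIV. SIGMA j:UNIV. ptch m p i \<times> ptch m p' j)"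
    have finX: "finite X"
      unfolding X_def using finite_patch[of \<rho> lam l m] by (intro finite_SigmaI finite_cartesian_product) auto
    have X: "(\<Sum>i\<in>UNIV. \<Sum>j\<in>UNIV. \<Sum>r\<in>ptch m p i. \<Sum>s\<in>ptch m p' j. h i j r s) = (\<Sum>(i, j, r, s)\<in>X. h i j r s)"
      for h :: "'a \<Rightarrow> 'a \<Rightarrow> real \<Rightarrow> real \<Rightarrow> complex"
      unfolding X_def using finite_patch[of \<rho> lam l m]
      by (subst sum.Sigma[symmetric], simp, simp add: finite_SigmaI finite_cartesian_product)+
         (simp add: sum.cartesian_product)
    have "(\<Sum>i\<in>UNIV. \<Sum>j\<in>UNIV. \<Sum>r\<in>ptch m p i. \<Sum>s\<in>ptch m p' j.
      cnj (u $ i) * u $ j * pair_functional p p' (\<psi> (r - s))) =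
      (\<Sum>x\<in>X. (case x of (i, j, r, s) \<Rightarrow> cnj (u $ i) * u $ j) *
        pair_functional p p' (case x of (i, j, r, s) \<Rightarrow> \<psi> (r - s)))"
      unfolding X by (intro sum.cong) auto
    also have "\<dots> = pair_functional p p' (\<lambda>k. \<Sum>x\<in>X. (case x of (i, j, r, s) \<Rightarrow> cnj (u $ i) * u $ j) *
        (case x of (i, j, r, s) \<Rightarrow> \<psi> (r - s)) k)"
      by (rule pair_functional_sum[symmetric, OF finX]) (auto simp: sch split: prod.split)
    also have "(\<lambda>k. \<Sum>x\<in>X. (case x of (i, j, r, s) \<Rightarrow> cnj (u $ i) * u $ j) *
        (case x of (i, j, r, s) \<Rightarrow> \<psi> (r - s)) k) =
        (\<lambda>k. a p (k / ?c) * cnj (a p' (k / ?c)) * \<phi> (k / ?c))"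
    proof
      fix k
      have "(\<Sum>x\<in>X. (case x of (i, j, r, s) \<Rightarrow> cnj (u $ i) * u $ j) * (case x of (i, j, r, s) \<Rightarrow> \<psi> (r - s)) k) =
        (\<Sum>i\<in>UNIV. \<Sum>j\<in>UNIV. \<Sum>r\<in>ptch m p i. \<Sum>s\<in>ptch m p' j. cnj (u $ i) * u $ j * \<psi> (r - s) k)"
        unfolding X by (intro sum.cong) auto
      also have "\<dots> = (\<Sum>i\<in>UNIV. \<Sum>j\<in>UNIV. \<Sum>r\<in>ptch m p i. \<Sum>s\<in>ptch m p' j.
          (cnj (u $ i) * cis (2 * pi * r * (k / ?c))) * (u $ j * cnj (cis (2 * pi * s * (k / ?c)))) * \<phi> (k / ?c))"
      proof (intro sum.cong refl)
        fix i j r s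
        have "2 * pi * ((r - s) / ?c) * k = 2 * pi * r * (k / ?c) + - (2 * pi * s * (k / ?c))"
          by (simp add: diff_divide_distrib algebra_simps)
        then have "\<psi> (r - s) k = cis (2 * pi * r * (k / ?c)) * cnj (cis (2 * pi * s * (k / ?c))) * \<phi> (k / ?c)"
          unfolding \<psi>_def cis_cnj cis_mult by simp
        then show "cnj (u $ i) * u $ j * \<psi> (r - s) k =
          (cnj (u $ i) * cis (2 * pi * r * (k / ?c))) * (u $ j * cnj (cis (2 * pi * s * (k / ?c)))) * \<phi> (k / ?c)"
          by simp
      qed
      also have "\<dots> = (\<Sum>i\<in>UNIV. \<Sum>r\<in>ptch m p i. cnj (u $ i) * cis (2 * pi * r * (k / ?c))) *
          (\<Sum>j\<in>UNIV. \<Sum>s\<in>ptch m p' j. u $ j * cnj (cis (2 * pi * s * (k / ?c)))) * \<phi> (k / ?c)"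
      proof -
        have "(\<Sum>r\<in>R. \<Sum>s\<in>S. f r * g s * c) = (\<Sum>r\<in>R. f r) * (\<Sum>s\<in>S. g s) * c"
          for R S :: "real set" and f g :: "real \<Rightarrow> complex" and c
          unfolding sum_product unfolding sum_distrib_right ..
        moreover have "(\<Sum>i\<in>UNIV. \<Sum>j\<in>UNIV. f i * g j * c) = (\<Sum>i\<in>UNIV. f i) * (\<Sum>j\<in>UNIV. g j) * c"
          for f g :: "'a \<Rightarrow> complex" and c
          unfolding sum_product unfolding sum_distrib_right ..
        ultimately show ?thesis by simp
      qed
      also have "\<dots> = a p (k / ?c) * cnj (a p' (k / ?c)) * \<phi> (k / ?c)"
        unfolding a_def fourier_cocycle_entry by (simp add: sum_distrib_left)
      finally show "(\<Sum>x\<in>X. (case x of (i, j, r, s) \<Rightarrow> cnj (u $ i) * u $ j) * (case x of (i, j, r, s) \<Rightarrow> \<psi> (r - s)) k) =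
        a p (k / ?c) * cnj (a p' (k / ?c)) * \<phi> (k / ?c)" .
    qed
    finally show "(\<Sum>i\<in>UNIV. \<Sum>j\<in>UNIV. \<Sum>r\<in>ptch m p i. \<Sum>s\<in>ptch m p' j.
      cnj (u $ i) * u $ j * pair_functional p p' (\<psi> (r - s))) =
      pair_functional p p' (\<lambda>k. a p (k / ?c) * cnj (a p' (k / ?c)) * \<phi> (k / ?c))" .
  qed
  finally show ?thesis .
qed

section \<open>Sets where the cocycle is small carry no diffraction\<close>

lemma continuous_on_cocycle: "continuous_on S (fourier_cocycle \<rho> lam l m)"
proof -
  have "fourier_cocycle \<rho> lam l m = (\<lambda>k. \<chi> i j. \<Sum>t\<in>ptch m j i. cis (2 * pi * t * k))"
    by (simp add: fun_eq_iff vec_eq_iff fourier_cocycle_entry)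
  then show ?thesis by (auto intro!: continuous_intros)
qed

text \<open>The bound is known on \<open>A\<close> only, whereas a test function lives on a
  neighbourhood. For each fixed m, uniform continuity of the cocycle carries it over up to a factor
  2 if \<delta> is small enough; \<delta> depends on m, but no other constant does.\<close>

lemma measure_eq_0_of_cocycle_bound:
  assumes A: "A \<in> sets borel" "A \<subseteq> {- M..M}" and \<epsilon>: "\<epsilon> > 0"
    and bound: "\<And>n k. n \<ge> n0 \<Longrightarrow> k \<in> A \<Longrightarrow> (norm (fourier_cocycle \<rho> lam l n k))\<^sup>2 \<le> lam ^ n * exp (- (real n * \<epsilon>))"
  shows "measure (\<mu> u) A = 0"
proof -
  \<comment> \<open>The neighbourhood has radius 2 \<delta>, which is at most 2.\<close>
  define M' where "M' = \<bar>M\<bar> + 2"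
  have M': "M' \<ge> 0" by (simp add: M'_def)
  define D where "D = (\<Sum>i\<in>UNIV. norm (u $ i))"
  have D0: "D \<ge> 0" unfolding D_def by (intro sum_nonneg) auto
  obtain C where C: "C \<ge> 0" "\<And>R. R \<ge> 0 \<Longrightarrow> total_mass R \<le> C * (1 + R)"
    using total_mass_linear_growth by blast
  \<comment> \<open>The factor 4 combines the bound 2 on the bump and the loss from E to 2 E near
    \<open>A\<close>; D^2 comes from the two vectors \<open>a p\<close> and \<open>a p'\<close>, and
    C (1 + M') from the linear growth.\<close>
  define K where "K = 4 * D\<^sup>2 * C * (1 + M')"
  have main: "exp (- 2) * measure (\<mu> u) A \<le> K * exp (- (real m * \<epsilon>))" if m: "N dvd m" "m \<ge> n0" for m
  proof -
    define B where "B = fourier_cocycle \<rho> lam l m"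
    define E where "E = lam ^ m * exp (- (real m * \<epsilon>))"
    have E: "E > 0" using lam_power_pos by (simp add: E_def)
    have "uniformly_continuous_on {- M'..M'} (\<lambda>k. (norm (B k))\<^sup>2)"
      unfolding B_def by (intro compact_uniformly_continuous continuous_intros continuous_on_cocycle) auto
    then obtain \<delta>' where \<delta>': "\<delta>' > 0" "\<And>x y. x \<in> {- M'..M'} \<Longrightarrow> y \<in> {- M'..M'} \<Longrightarrow> dist y x < \<delta>' \<Longrightarrow>
        dist ((norm (B y))\<^sup>2) ((norm (B x))\<^sup>2) < E"
      using E unfolding uniformly_continuous_on_def by meson
    define \<delta> where "\<delta> = min 1 (\<delta>' / 2)"
    have \<delta>: "\<delta> > 0" "2 * \<delta> \<le> \<delta>'" "\<delta> \<le> 1" using \<delta>'(1) by (auto simp: \<delta>_def)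
    obtain b where b: "schwartz (\<lambda>x. complex_of_real (b x))" "\<And>x. 0 \<le> b x" "\<And>x. b x \<le> 2"
      "\<And>x. x \<in> A \<Longrightarrow> exp (- 2) \<le> b x" "\<And>x. b x \<noteq> 0 \<Longrightarrow> \<exists>a\<in>A. \<bar>x - a\<bar> < 2 * \<delta>"
      using ex_bump_on[OF A(2) \<delta>(1)] by metis
    have near: "(norm (B x))\<^sup>2 \<le> 2 * E \<and> \<bar>x\<bar> \<le> M'" if x: "b x \<noteq> 0" for x
    proof -
      obtain a where a: "a \<in> A" "\<bar>x - a\<bar> < 2 * \<delta>" using b(5) x by blast
      have aM: "\<bar>a\<bar> \<le> \<bar>M\<bar>" using a(1) A(2) by force
      have xM: "\<bar>x\<bar> \<le> M'" using aM a(2) \<delta>(3) unfolding M'_def by linarith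
      have "dist ((norm (B x))\<^sup>2) ((norm (B a))\<^sup>2) < E"
        by (rule \<delta>'(2)) (use aM xM a(2) \<delta>(2) in \<open>auto simp: M'_def dist_real_def abs_le_iff\<close>)
      moreover have "(norm (B a))\<^sup>2 \<le> E" using bound[OF m(2) a(1)] by (simp add: B_def E_def)
      ultimately show ?thesis using xM unfolding dist_real_def by linarith
    qed
    define a where "a p k = (\<Sum>i\<in>UNIV. cnj (u $ i) * B k $ i $ p)" for p k
    have a_le: "norm (a p k) \<le> D * norm (B k)" for p k
    proof -
      have "norm (a p k) \<le> (\<Sum>i\<in>UNIV. norm (u $ i) * norm (B k $ i $ p))"
        unfolding a_def by (rule order_trans[OF norm_sum]) (simp add: norm_mult)
      also have "\<dots> \<le> (\<Sum>i\<in>UNIV. norm (u $ i) * norm (B k))"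
        by (intro sum_mono mult_left_mono order_trans[OF Finite_Cartesian_Product.norm_nth_le
              Finite_Cartesian_Product.norm_nth_le]) auto
      finally show ?thesis by (simp add: D_def sum_distrib_right)
    qed
    have pointwise: "norm (a p (k / lam ^ m) * cnj (a p' (k / lam ^ m)) * complex_of_real (b (k / lam ^ m))) \<le>
        (4 * D\<^sup>2 * E) * indicator {- (lam ^ m * M')..lam ^ m * M'} k" for p p' k
    proof (cases "b (k / lam ^ m) = 0")
      case True
      then show ?thesis using E by (auto simp: indicator_def)
    next
      case False
      let ?x = "k / lam ^ m"
      have "\<bar>?x\<bar> \<le> M'" using near[OF False] by blast
      then have "k \<in> {- (lam ^ m * M')..lam ^ m * M'}"
        using lam_power_pos[of m] by (auto simp: abs_le_iff field_simps)
      moreover have "norm (a p ?x * cnj (a p' ?x) * complex_of_real (b ?x)) \<le>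
          (D * norm (B ?x)) * (D * norm (B ?x)) * 2"
        unfolding norm_mult complex_mod_cnj norm_of_real
        using a_le[of _ ?x] b(2,3)[of ?x] D0 by (intro mult_mono) auto
      moreover have "(D * norm (B ?x)) * (D * norm (B ?x)) * 2 = 2 * D\<^sup>2 * (norm (B ?x))\<^sup>2"
        by (simp add: power2_eq_square)
      moreover have "2 * D\<^sup>2 * (norm (B ?x))\<^sup>2 \<le> 2 * D\<^sup>2 * (2 * E)"
        using near[OF False] by (intro mult_left_mono) auto
      moreover have "2 * D\<^sup>2 * (2 * E) = 4 * D\<^sup>2 * E" by simp
      ultimately have "norm (a p ?x * cnj (a p' ?x) * complex_of_real (b ?x)) \<le> 4 * D\<^sup>2 * E"
        by linarith
      then show ?thesis using \<open>k \<in> {- (lam ^ m * M')..lam ^ m * M'}\<close> by simp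
    qed
    have "exp (- 2) * measure (\<mu> u) A \<le> norm (LINT k|\<mu> u. complex_of_real (b k))"
      by (rule measure_le_integral_bump[OF comb A b(1,2,4)])
    also have "\<dots> = (1 / lam ^ (2 * m)) * norm (\<Sum>p\<in>UNIV. \<Sum>p'\<in>UNIV.
        pair_functional p p' (\<lambda>k. a p (k / lam ^ m) * cnj (a p' (k / lam ^ m)) * complex_of_real (b (k / lam ^ m))))"
      unfolding diffraction_renormalisation[OF m(1) b(1)] a_def B_def norm_mult
      using lam_gt_1 by (simp add: norm_divide norm_power)
    also have "\<dots> \<le> (1 / lam ^ (2 * m)) * (\<Sum>p\<in>UNIV. \<Sum>p'\<in>UNIV. (4 * D\<^sup>2 * E) *
        (\<Sum>s<4. measure (\<mu> (polarisation_vector p p' s)) {- (lam ^ m * M')..lam ^ m * M'}))"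
      using lam_power_pos[of "2 * m"]
      by (intro mult_left_mono order_trans[OF norm_sum] sum_mono norm_pair_functional_le pointwise) auto
    also have "\<dots> = (1 / lam ^ (2 * m)) * ((4 * D\<^sup>2 * E) * total_mass (lam ^ m * M'))"
      by (simp add: total_mass_def sum_distrib_left)
    also have "\<dots> \<le> (1 / lam ^ (2 * m)) * ((4 * D\<^sup>2 * E) * (C * (lam ^ m * (1 + M'))))"
    proof -
      have "1 \<le> lam ^ m" using lam_gt_1 by simp
      then have "C * (1 + lam ^ m * M') \<le> C * (lam ^ m * (1 + M'))"
        using C(1) by (intro mult_left_mono) (auto simp: distrib_left)
      moreover have "total_mass (lam ^ m * M') \<le> C * (1 + lam ^ m * M')"
        using lam_power_pos[of m] M' by (intro C(2)) simp
      ultimately show ?thesis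
        using lam_power_pos[of "2 * m"] E D0 by (intro mult_left_mono) auto
    qed
    also have "\<dots> = K * exp (- (real m * \<epsilon>))"
      using lam_gt_1 by (simp add: K_def E_def mult_2 power_add)
    finally show ?thesis .
  qed
  \<comment> \<open>The orders N (n0 + j) are multiples of the period that are at least n0.\<close>
  have "(\<lambda>j. K * exp (- \<epsilon>) ^ (N * (n0 + j))) \<longlonglongrightarrow> K * 0"
  proof (intro tendsto_mult_left)
    have "(\<lambda>j. (exp (- \<epsilon>) ^ N) ^ (n0 + j)) \<longlonglongrightarrow> 0"
      using \<epsilon> N_pos by (subst add.commute, intro LIMSEQ_ignore_initial_segment LIMSEQ_power_zero)
         (simp add: power_less_one_iff)
    then show "(\<lambda>j. exp (- \<epsilon>) ^ (N * (n0 + j))) \<longlonglongrightarrow> 0" by (simp add: power_mult)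
  qed
  moreover have "exp (- 2) * measure (\<mu> u) A \<le> K * exp (- \<epsilon>) ^ (N * (n0 + j))" for j
  proof -
    have "n0 \<le> N * (n0 + j)" using N_pos by (metis add_leE mult_le_mono1 nat_mult_1 trans_le_add1 order_trans le_add1)
    then have "exp (- 2) * measure (\<mu> u) A \<le> K * exp (- (real (N * (n0 + j)) * \<epsilon>))"
      by (intro main) auto
    then show ?thesis by (metis exp_of_nat_mult mult_minus_right)
  qed
  ultimately have "exp (- 2) * measure (\<mu> u) A \<le> K * 0"
    by (intro LIMSEQ_le_const) auto
  then show ?thesis using measure_nonneg[of "\<mu> u" A] by (simp add: mult_le_0_iff)
qed

end

section \<open>From the Lyapunov exponent to the Lebesgue decomposition\<close>

text \<open>Half of \<epsilon> is given up to make the limsup inequality strict; squaring the norm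
  doubles the exponent and restores the full \<epsilon>. A vanishing norm has logarithm -\<infinity>
  and is treated apart.\<close>

lemma lyapunov_bound_eventually:
  assumes "lyapunov_exponent \<rho> lam l k \<le> ereal (ln (sqrt lam) - \<epsilon>)" "\<epsilon> > 0" "lam > 1"
  shows "\<forall>\<^sub>F n in sequentially. (norm (fourier_cocycle \<rho> lam l n k))\<^sup>2 \<le> lam ^ n * exp (- (real n * \<epsilon>))"
proof -
  have "limsup (\<lambda>n. ereal (1 / real n) * ereal_log (norm (fourier_cocycle \<rho> lam l n k))) < ereal (ln (sqrt lam) - \<epsilon> / 2)"
    by (rule order.strict_trans1[OF assms(1)[unfolded lyapunov_exponent_def]]) (use assms(2) in simp)
  then have "\<forall>\<^sub>F n in sequentially. ereal (1 / real n) * ereal_log (norm (fourier_cocycle \<rho> lam l n k)) < ereal (ln (sqrt lam) - \<epsilon> / 2)"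
    by (rule Limsup_lessD)
  with eventually_gt_at_top[of 0] show ?thesis
  proof eventually_elim
    case (elim n)
    let ?x = "norm (fourier_cocycle \<rho> lam l n k)"
    show ?case
    proof (cases "?x = 0")
      case True
      then show ?thesis using assms(3) by simp
    next
      case False
      then have x: "?x > 0" by simp
      have "ereal (1 / real n * ln ?x) < ereal (ln (sqrt lam) - \<epsilon> / 2)"
        using elim False by (simp add: ereal_log_def)
      then have "1 / real n * ln ?x < ln (sqrt lam) - \<epsilon> / 2" by (simp only: less_ereal.simps)
      then have "ln ?x < real n * (ln (sqrt lam) - \<epsilon> / 2)" using elim(1) by (simp add: field_simps)
      then have "2 * ln ?x \<le> real n * ln lam - real n * \<epsilon>"
        using assms(3) by (simp add: ln_sqrt algebra_simps)
      then have "exp (2 * ln ?x) \<le> exp (real n * ln lam - real n * \<epsilon>)" by simp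
      moreover have "exp (2 * ln ?x) = ?x\<^sup>2"
        using x exp_of_nat_mult[of 2 "ln ?x"] by (simp add: exp_double)
      moreover have "exp (real n * ln lam - real n * \<epsilon>) = lam ^ n * exp (- (real n * \<epsilon>))"
        using assms(3) by (simp add: exp_diff exp_of_nat_mult exp_minus divide_inverse)
      ultimately show ?thesis by simp
    qed
  qed
qed

text \<open>Because \<open>ac_part\<close> is a definite description, uniqueness is part of the
  claim: any absolutely continuous part vanishes on \<open>E\<close> because \<open>E\<close> is
  Lebesgue-null, and off \<open>E\<close> because \<nu> dominates it.\<close>

lemma ac_part_eq_null_measure:
  assumes sets: "sets \<nu> = sets borel" and E: "E \<in> null_sets lborel" "emeasure \<nu> (- E) = 0"
  shows "ac_part \<nu> = null_measure borel"
  unfolding ac_part_def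
proof (rule the_equality)
  show "\<exists>\<mu>s. lebesgue_decomposition \<nu> (null_measure borel) \<mu>s"
    unfolding lebesgue_decomposition_def using assms
    by (intro exI[of _ \<nu>]) (auto simp: absolutely_continuous_def null_sets_def)
next
  fix \<mu>ac assume "\<exists>\<mu>s. lebesgue_decomposition \<nu> \<mu>ac \<mu>s"
  then obtain \<mu>s where L: "lebesgue_decomposition \<nu> \<mu>ac \<mu>s" by blast
  have sac: "sets \<mu>ac = sets borel" using L unfolding lebesgue_decomposition_def by blast
  have Eb: "E \<in> sets borel" using E(1) by (auto simp: null_sets_def)
  show "\<mu>ac = null_measure borel"
  proof (rule measure_eqI)
    fix A assume A: "A \<in> sets \<mu>ac"
    then have Ab: "A \<in> sets borel" using sac by simp
    have "E \<in> null_sets \<mu>ac"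
      using L E(1) unfolding lebesgue_decomposition_def absolutely_continuous_def by blast
    then have "emeasure \<mu>ac E = 0" by (auto simp: null_sets_def)
    moreover have "emeasure \<mu>ac (- E) \<le> emeasure \<nu> (- E)"
      using L Eb unfolding lebesgue_decomposition_def by (metis borel_comp le_iff_add)
    ultimately have "emeasure \<mu>ac E + emeasure \<mu>ac (- E) = 0" using E(2) by simp
    moreover have "emeasure \<mu>ac A \<le> emeasure \<mu>ac E + emeasure \<mu>ac (- E)"
      by (rule order_trans[OF emeasure_mono emeasure_subadditive]) (use Eb sac in auto)
    ultimately show "emeasure \<mu>ac A = emeasure (null_measure borel) A" by simp
  qed (simp add: sac)
qed

text \<open>This translates primitivity into geometry. Only the positivity pattern of the matrix
  power matters: a positive sum has a positive summand, which names an intermediate letter.\<close>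

lemma patch_nonempty_of_power_pos:
  assumes "0 < (((**) (subst_matrix \<rho>) ^^ n) (mat 1)) $ b $ a"
    and nonneg: "\<And>i j. 0 \<le> (subst_matrix \<rho>) $ i $ j"
  shows "patch \<rho> lam l n a b \<noteq> {}"
  using assms(1)
proof (induction n arbitrary: b)
  case 0
  then show ?case by (auto simp: patch_def mat_def split: if_splits)
next
  case (Suc n)
  let ?P = "((**) (subst_matrix \<rho>) ^^ n) (mat 1)"
  have "0 < (\<Sum>c\<in>UNIV. subst_matrix \<rho> $ b $ c * ?P $ c $ a)"
    using Suc.prems unfolding funpow.simps o_apply by (subst (asm) matrix_matrix_mult_def) simp
  then obtain c where c: "0 < subst_matrix \<rho> $ b $ c * ?P $ c $ a"
    by (meson linorder_not_le sum_nonpos)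
  then have "0 < ?P $ c $ a" "0 < subst_matrix \<rho> $ b $ c"
    using nonneg[of b c] by (auto simp: zero_less_mult_iff)
  then obtain t where t: "t \<in> patch \<rho> lam l n a c" using Suc.IH by blast
  have "count_list (\<rho> c) b \<noteq> 0" using \<open>0 < subst_matrix \<rho> $ b $ c\<close> by (simp add: subst_matrix_def)
  then have "b \<in> set (\<rho> c)" by (simp add: count_list_0_iff)
  then obtain x where "x \<in> displacements \<rho> l b c" by (auto simp: displacements_def in_set_conv_nth)
  with t show ?case by (auto simp: patch_def inflate_def)
qed

theorem theorem3p28:
  fixes \<rho> :: "'a::finite \<Rightarrow> 'a list"
    and lam :: real
    and l :: "real^'a"
    and \<Lambda>0 \<Lambda> :: "'a \<Rightarrow> real set"
    and diffr :: "complex^'a \<Rightarrow> real measure"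
    and \<epsilon> :: real
  assumes "primitive_substitution \<rho>"
    and "is_pf_eigenvalue (subst_matrix \<rho>) lam"
    and "lam > 1"
    and "is_left_pf_eigenvector (subst_matrix \<rho>) lam l"
    and "is_inflation_fixed_point \<rho> lam l \<Lambda>0"
    and "\<Lambda> \<in> tiling_hull \<Lambda>0"
    and "\<And>u. is_diffraction_measure \<Lambda> u (diffr u)"
    and "\<exists>k. det (fourier_matrix \<rho> l k) \<noteq> 0"
    and "\<epsilon> > 0"
    and "AE k in lborel. lyapunov_exponent \<rho> lam l k \<le> ereal (ln (sqrt lam) - \<epsilon>)"
  shows "\<forall>u. ac_part (diffr u) = null_measure borel"
proof
  fix u
  have prim: "primitive_matrix (subst_matrix \<rho>)"
    using assms(1) unfolding primitive_substitution_def by blast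
  then obtain q where q: "q \<ge> 1" "\<And>i j. 0 < (((**) (subst_matrix \<rho>) ^^ q) (mat 1)) $ i $ j"
    unfolding primitive_matrix_def by blast
  have nonneg: "0 \<le> subst_matrix \<rho> $ i $ j" for i j
    by (simp add: subst_matrix_def)
  obtain N where N: "N \<ge> 1" "(inflate \<rho> lam l ^^ N) \<Lambda>0 = \<Lambda>0" and tiling: "is_tiling l \<Lambda>0"
    using assms(5) unfolding is_inflation_fixed_point_def by blast
  interpret inflation_diffraction \<rho> lam l \<Lambda>0 N q \<Lambda> diffr
  proof
    show "0 < l $ i" for i using assms(4) unfolding is_left_pf_eigenvector_def by blast
    show "l v* subst_matrix \<rho> = lam *s l" using assms(4) unfolding is_left_pf_eigenvector_def by blast
    show "tiles l UNIV \<Lambda>0" using tiling is_tiling_iff_tiles by blast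
    show "patch \<rho> lam l q a b \<noteq> {}" for a b
      by (rule patch_nonempty_of_power_pos[OF q(2) nonneg])
  qed (use assms N q in auto)
  define w where "w n k = (norm (fourier_cocycle \<rho> lam l n k))\<^sup>2" for n k
  \<comment> \<open>The index j bounds both the window and the order from which the estimate holds,
    so countably many sets suffice; they are closed, hence Borel, by continuity of the
    cocycle.\<close>
  define A where "A j = {- real j..real j} \<inter> (\<Inter>n\<in>{j..}. {k. w n k \<le> lam ^ n * exp (- (real n * \<epsilon>))})" for j
  have "closed {k. w n k \<le> lam ^ n * exp (- (real n * \<epsilon>))}" for n
    unfolding w_def by (intro closed_Collect_le continuous_intros continuous_on_cocycle)
  then have "closed (A j)" for j unfolding A_def by (intro closed_Int closed_INT) auto
  then have A_borel: "A j \<in> sets borel" for j by (rule borel_closed)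
  have "measure (diffr u) (A j) = 0" for j
    by (rule measure_eq_0_of_cocycle_bound[OF A_borel, of _ "real j" \<epsilon> j]) (use assms(9) in \<open>auto simp: A_def w_def\<close>)
  moreover have "emeasure (diffr u) (A j) \<noteq> \<infinity>" for j
    using emeasure_comb_bounded[OF comb A_borel, of j "- real j" "real j" u] unfolding A_def by force
  ultimately have A_null: "A j \<in> null_sets (diffr u)" for j
    using A_borel sets_comb[OF comb] by (auto simp: null_sets_def emeasure_eq_ennreal_measure)
  \<comment> \<open>\<open>E\<close> is Lebesgue-null by the bound on the exponent, and its
    complement is a countable union of sets without diffraction: the measure is concentrated on
    \<open>E\<close>.\<close>
  define E where "E = - (\<Union>j. A j)"
  have "AE k in lborel. k \<notin> E"
    using assms(10)
  proof eventually_elim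
    case (elim k)
    then have "\<forall>\<^sub>F n in sequentially. w n k \<le> lam ^ n * exp (- (real n * \<epsilon>))"
      unfolding w_def using lyapunov_bound_eventually assms(3,9) by blast
    then obtain n0 where n0: "\<And>n. n \<ge> n0 \<Longrightarrow> w n k \<le> lam ^ n * exp (- (real n * \<epsilon>))"
      unfolding eventually_sequentially by blast
    define j where "j = max n0 (nat \<lceil>\<bar>k\<bar>\<rceil>)"
    have "\<bar>k\<bar> \<le> real j" unfolding j_def by linarith
    then have "k \<in> A j" using n0 by (auto simp: A_def j_def abs_le_iff)
    then show ?case by (auto simp: E_def)
  qed
  moreover have E_borel: "E \<in> sets lborel" unfolding E_def sets_lborel using A_borel by (intro borel_comp sets.countable_UN) auto
  ultimately have "E \<in> null_sets lborel" using AE_iff_null_sets by blast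
  moreover have "emeasure (diffr u) (- E) = 0"
    using null_sets_UN[of A "diffr u"] A_null by (auto simp: E_def null_sets_def)
  ultimately show "ac_part (diffr u) = null_measure borel"
    by (rule ac_part_eq_null_measure[OF sets_comb[OF comb]])
qed

end
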